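(* Let $V$ be a complex affine algebraic variety defined over a countable field $k\subset\mathbb{C}$ and let $(f_j)_{j\in J}$ be a generating family for $V$. If $J$ is finite, then $CB(V')=T(I)$.
   Context: $k[V]$ is the coordinate ring of $V$ over $k$. A generating family is a family $(f_j)_{j\in J}$ of elements of $k[V]$, with $J$ finite or countable, generating $k[V]$ as a $k$-algebra. Put $V'=\{x\in V: f_j(x)\neq 0\ \forall j\in J\}$ (with the classical topology) and $\mathrm{Log}:V'\to\mathbb{R}^J$, $x\mapsto(\log|f_j(x)|)_{j\in J}$. $\mathbb{R}^J$ has the product topology, $\mathcal{S}=(\mathbb{R}^J\setminus\{0\})/\mathbb{R}_{>0}$ the quotient topology, $\pi:\mathbb{R}^J\setminus\{0\}\to\mathcal{S}$ is the projection. The set of ideal points $B(V')\subset\mathcal{S}$ is the set of $b\in\mathcal{S}$ for which there is a sequence $(x_n)\subset V'$, eventually leaving every compact subset of $V'$, with $\pi(\mathrm{Log}(x_n))\to b$. $CB(V')=\{0\}\cup\pi^{-1}(B(V'))$ if $V'\neq\emptyset$, and $CB(V')=\emptyset$ if $V'=\emptyset$. $k[V']$ is the localization of $k[V]$ at the multiplicative set generated by the $f_j$, and $I$ is the kernel of the $k$-algebra homomorphism $k[(X_j),(X_j^{-1})]\to k[V']$, $X_j\mapsto f_j$, from the Laurent polynomial ring. For $f=\sum_{\omega\in\mathbb{Z}^{\oplus J}}a_\omega X^\omega\in I$ let $A_f=\{\omega:a_\omega\neq0\}$ (finite), $f_0=\bigoplus_{\omega\in A_f}X^{\odot\omega}$,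 i.e. $f_0(x)=\max_{\omega\in A_f}\langle x,\omega\rangle$ with $\langle x,\omega\rangle=\sum_jx_j\omega_j$, and $$T(f_0)=\Big\{x\in\mathbb{R}^J:\ \forall w\in A_f,\ \langle x,w\rangle\le\max_{\omega\in A_f\setminus\{w\}}\langle x,\omega\rangle\Big\}$$ (maximum of the empty set is $-\infty$). $T(I)=\bigcap_{f\in I}T(f_0)$. *)

theory Defs
  imports
    "HOL-Analysis.Analysis"
    "HOL-Library.Poly_Mapping"
    "HOL-Algebra.Generated_Rings"
    "HOL-Algebra.RingHom"
    "HOL-Algebra.Algebraic_Closure_Type"
begin

section \<open>Affine varieties over a subfield of the complex numbers\<close>

text \<open>
  Polynomials in variables indexed by \<^typ>\<open>'n\<close> are finitely supported functions from exponent
  vectors to coefficients; their ring structure is the convolution of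
  \<^theory>\<open>HOL-Library.Poly_Mapping\<close>.
\<close>

definition polys_over :: "complex set \<Rightarrow> (('n \<Rightarrow>\<^sub>0 nat) \<Rightarrow>\<^sub>0 complex) set" where
  "polys_over k = {p. \<forall>m. Poly_Mapping.lookup p m \<in> k}"

definition poly_eval :: "(('n::finite \<Rightarrow>\<^sub>0 nat) \<Rightarrow>\<^sub>0 complex) \<Rightarrow> complex ^ 'n \<Rightarrow> complex" where
  "poly_eval p v =
     (\<Sum>m\<in>Poly_Mapping.keys p.
        Poly_Mapping.lookup p m * (\<Prod>i\<in>UNIV. (v $ i) ^ Poly_Mapping.lookup m i))"

text \<open>Zero loci; neither irreducibility nor non-emptiness is required.\<close>

definition affine_variety_over :: "complex set \<Rightarrow> (complex ^ 'n::finite) set \<Rightarrow> bool" where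
  "affine_variety_over k V \<longleftrightarrow>
     (\<exists>P \<subseteq> polys_over k. V = {v. \<forall>p\<in>P. poly_eval p v = 0})"

text \<open>
  The coordinate ring \<open>k[V]\<close>: functions on \<open>V\<close> (extensional, that is, \<^const>\<open>undefined\<close> off \<open>V\<close>)
  that are restrictions of polynomials with coefficients in \<open>k\<close>.
\<close>

definition coordinate_ring ::
    "complex set \<Rightarrow> (complex ^ 'n::finite) set \<Rightarrow> (complex ^ 'n \<Rightarrow> complex) ring" where
  "coordinate_ring k V =
     \<lparr>carrier = (\<lambda>p. restrict (poly_eval p) V) ` polys_over k,
      monoid.mult = (\<lambda>g h. \<lambda>x\<in>V. g x * h x),
      one = (\<lambda>x\<in>V. 1),
      ring.zero = (\<lambda>x\<in>V. 0),
      add = (\<lambda>g h. \<lambda>x\<in>V. g x + h x)\<rparr>"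

text \<open>
  A \<open>k\<close>-subalgebra is a subring containing the constants from \<open>k\<close>.
\<close>

definition generating_family ::
    "complex set \<Rightarrow> (complex ^ 'n::finite) set \<Rightarrow> 'j set \<Rightarrow> ('j \<Rightarrow> complex ^ 'n \<Rightarrow> complex) \<Rightarrow> bool"
  where
  "generating_family k V J f \<longleftrightarrow>
     countable J \<and>
     f ` J \<subseteq> carrier (coordinate_ring k V) \<and>
     generate_ring (coordinate_ring k V) ((\<lambda>c. \<lambda>x\<in>V. c) ` k \<union> f ` J) =
       carrier (coordinate_ring k V)"


section \<open>Ideal points\<close>

text \<open>
  The space $\mathbb{R}^J$ is the set of functions \<^typ>\<open>'j \<Rightarrow> real\<close> that are extensional on \<open>J\<close>,
  the topological space of \<^term>\<open>powertop_real J\<close>.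
\<close>

definition zero_vec :: "'j set \<Rightarrow> 'j \<Rightarrow> real" where
  "zero_vec J = (\<lambda>j\<in>J. 0)"

definition punctured_space :: "'j set \<Rightarrow> ('j \<Rightarrow> real) topology" where
  "punctured_space J = subtopology (powertop_real J) (- {zero_vec J})"

definition quotient_topology :: "'a topology \<Rightarrow> ('a \<Rightarrow> 'b) \<Rightarrow> 'b topology" where
  "quotient_topology T p =
     topology (\<lambda>U. U \<subseteq> p ` topspace T \<and> openin T {x \<in> topspace T. p x \<in> U})"

lemma openin_quotient_topology:
  "openin (quotient_topology T p) U \<longleftrightarrow>
     U \<subseteq> p ` topspace T \<and> openin T {x \<in> topspace T. p x \<in> U}"
proof -
  have "istopology (\<lambda>U. U \<subseteq> p ` topspace T \<and> openin T {x \<in> topspace T. p x \<in> U})"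
    unfolding istopology_def
  proof (intro conjI allI impI)
    fix A B
    assume "A \<subseteq> p ` topspace T \<and> openin T {x \<in> topspace T. p x \<in> A}"
      and "B \<subseteq> p ` topspace T \<and> openin T {x \<in> topspace T. p x \<in> B}"
    moreover have "{x \<in> topspace T. p x \<in> A \<inter> B} =
        {x \<in> topspace T. p x \<in> A} \<inter> {x \<in> topspace T. p x \<in> B}"
      by auto
    ultimately show "A \<inter> B \<subseteq> p ` topspace T" "openin T {x \<in> topspace T. p x \<in> A \<inter> B}"
      by auto
  next
    fix \<K>
    assume "\<forall>K\<in>\<K>. K \<subseteq> p ` topspace T \<and> openin T {x \<in> topspace T. p x \<in> K}"
    moreover have "{x \<in> topspace T. p x \<in> \<Union>\<K>} = (\<Union>K\<in>\<K>. {x \<in> topspace T. p x \<in> K})"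
      by auto
    ultimately show "\<Union>\<K> \<subseteq> p ` topspace T" "openin T {x \<in> topspace T. p x \<in> \<Union>\<K>}"
      by auto
  qed
  then show ?thesis
    by (simp add: quotient_topology_def topology_inverse')
qed

lemma topspace_quotient_topology: "topspace (quotient_topology T p) = p ` topspace T"
proof -
  have "{x \<in> topspace T. p x \<in> p ` topspace T} = topspace T"
    by blast
  then have "openin (quotient_topology T p) (p ` topspace T)"
    by (simp add: openin_quotient_topology)
  then show ?thesis
    by (metis openin_quotient_topology openin_subset openin_topspace subset_antisym)
qed

lemma quotient_map_quotient_topology: "quotient_map T (quotient_topology T p) p"
  by (simp add: quotient_map_def topspace_quotient_topology openin_quotient_topology)

text \<open>
  The projection \<open>\<pi>\<close> sends a vector to its orbit under positive scaling. It is total, but the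
  orbit of the zero vector is not a point of the quotient space.
\<close>

definition ray :: "'j set \<Rightarrow> ('j \<Rightarrow> real) \<Rightarrow> ('j \<Rightarrow> real) set" where
  "ray J x = {(\<lambda>j\<in>J. c * x j) | c. 0 < c}"

definition ray_space :: "'j set \<Rightarrow> ('j \<Rightarrow> real) set topology" where
  "ray_space J = quotient_topology (punctured_space J) (ray J)"

definition nonvanishing_part ::
    "'a set \<Rightarrow> 'j set \<Rightarrow> ('j \<Rightarrow> 'a \<Rightarrow> complex) \<Rightarrow> 'a set" where
  "nonvanishing_part V J f = {x \<in> V. \<forall>j\<in>J. f j x \<noteq> 0}"

definition Log_map :: "'j set \<Rightarrow> ('j \<Rightarrow> 'a \<Rightarrow> complex) \<Rightarrow> 'a \<Rightarrow> 'j \<Rightarrow> real" where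
  "Log_map J f x = (\<lambda>j\<in>J. ln (cmod (f j x)))"

text \<open>
  Convergence to a point of \<^term>\<open>ray_space J\<close> forces \<^term>\<open>Log_map J f (x n)\<close> to be nonzero for
  all large \<open>n\<close>, so that its projection is eventually defined.
\<close>

definition ideal_points ::
    "(complex ^ 'n::finite) set \<Rightarrow> 'j set \<Rightarrow> ('j \<Rightarrow> complex ^ 'n \<Rightarrow> complex) \<Rightarrow> ('j \<Rightarrow> real) set set"
  where
  "ideal_points V J f =
     {b \<in> topspace (ray_space J).
        \<exists>x :: nat \<Rightarrow> complex ^ 'n.
          (\<forall>n. x n \<in> nonvanishing_part V J f) \<and>
          (\<forall>K. compact K \<and> K \<subseteq> nonvanishing_part V J f \<longrightarrow> (\<forall>\<^sub>F n in sequentially. x n \<notin> K)) \<and>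
          limitin (ray_space J) (\<lambda>n. ray J (Log_map J f (x n))) b sequentially}"

definition cone_over_ideal_points ::
    "(complex ^ 'n::finite) set \<Rightarrow> 'j set \<Rightarrow> ('j \<Rightarrow> complex ^ 'n \<Rightarrow> complex) \<Rightarrow> ('j \<Rightarrow> real) set"
  where
  "cone_over_ideal_points V J f =
     (if nonvanishing_part V J f = {} then {}
      else {zero_vec J} \<union> {x \<in> topspace (punctured_space J). ray J x \<in> ideal_points V J f})"


section \<open>The ideal of Laurent relations\<close>

text \<open>
  The fraction \<open>a / s\<close> as an equivalence class of pairs, for the localization of a commutative
  ring at a multiplicative set \<open>S\<close>, which may contain zero divisors or zero.
\<close>

definition fraction :: "('a, 'm) ring_scheme \<Rightarrow> 'a set \<Rightarrow> 'a \<Rightarrow> 'a \<Rightarrow> ('a \<times> 'a) set" where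
  "fraction R S a s =
     {(b, t) \<in> carrier R \<times> S. \<exists>u\<in>S. u \<otimes>\<^bsub>R\<^esub> (a \<otimes>\<^bsub>R\<^esub> t \<ominus>\<^bsub>R\<^esub> b \<otimes>\<^bsub>R\<^esub> s) = \<zero>\<^bsub>R\<^esub>}"

definition localization :: "('a, 'm) ring_scheme \<Rightarrow> 'a set \<Rightarrow> ('a \<times> 'a) set ring" where
  "localization R S =
     \<lparr>carrier = {fraction R S a s | a s. a \<in> carrier R \<and> s \<in> S},
      monoid.mult = (\<lambda>P Q. \<Union>(a, s)\<in>P. \<Union>(b, t)\<in>Q. fraction R S (a \<otimes>\<^bsub>R\<^esub> b) (s \<otimes>\<^bsub>R\<^esub> t)),
      one = fraction R S \<one>\<^bsub>R\<^esub> \<one>\<^bsub>R\<^esub>,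
      ring.zero = fraction R S \<zero>\<^bsub>R\<^esub> \<one>\<^bsub>R\<^esub>,
      add = (\<lambda>P Q. \<Union>(a, s)\<in>P. \<Union>(b, t)\<in>Q.
               fraction R S (a \<otimes>\<^bsub>R\<^esub> t \<oplus>\<^bsub>R\<^esub> b \<otimes>\<^bsub>R\<^esub> s) (s \<otimes>\<^bsub>R\<^esub> t))\<rparr>"

definition family_mult_set ::
    "complex set \<Rightarrow> (complex ^ 'n::finite) set \<Rightarrow> 'j set \<Rightarrow> ('j \<Rightarrow> complex ^ 'n \<Rightarrow> complex) \<Rightarrow>
     (complex ^ 'n \<Rightarrow> complex) set" where
  "family_mult_set k V J f = (\<lambda>S. submonoid S (coordinate_ring k V)) hull (f ` J)"

definition localized_fraction ::
    "complex set \<Rightarrow> (complex ^ 'n::finite) set \<Rightarrow> 'j set \<Rightarrow> ('j \<Rightarrow> complex ^ 'n \<Rightarrow> complex) \<Rightarrow>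
     (complex ^ 'n \<Rightarrow> complex) \<Rightarrow>
     ((complex ^ 'n \<Rightarrow> complex) \<times> (complex ^ 'n \<Rightarrow> complex)) set" where
  "localized_fraction k V J f g =
     fraction (coordinate_ring k V) (family_mult_set k V J f) g \<one>\<^bsub>coordinate_ring k V\<^esub>"

definition localized_coordinate_ring ::
    "complex set \<Rightarrow> (complex ^ 'n::finite) set \<Rightarrow> 'j set \<Rightarrow> ('j \<Rightarrow> complex ^ 'n \<Rightarrow> complex) \<Rightarrow>
     ((complex ^ 'n \<Rightarrow> complex) \<times> (complex ^ 'n \<Rightarrow> complex)) set ring" where
  "localized_coordinate_ring k V J f =
     localization (coordinate_ring k V) (family_mult_set k V J f)"

text \<open>
  Laurent polynomials over \<open>k\<close> in variables indexed by \<open>J\<close>: exponents are finitely supported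
  integer vectors supported in \<open>J\<close>.
\<close>

definition laurent_ring :: "complex set \<Rightarrow> 'j set \<Rightarrow> (('j \<Rightarrow>\<^sub>0 int) \<Rightarrow>\<^sub>0 complex) ring" where
  "laurent_ring k J =
     ring_of_type_algebra
       \<lparr>carrier := {p. (\<forall>\<omega>. Poly_Mapping.lookup p \<omega> \<in> k) \<and>
                       (\<forall>\<omega>\<in>Poly_Mapping.keys p. Poly_Mapping.keys \<omega> \<subseteq> J)}\<rparr>"

text \<open>
  The \<open>k\<close>-algebra homomorphism sending the \<open>j\<close>-th variable to the image of \<open>f j\<close> in the
  localization. The power has an integer exponent, the images of the \<open>f j\<close> being units.
\<close>

definition laurent_hom ::
    "complex set \<Rightarrow> (complex ^ 'n::finite) set \<Rightarrow> 'j set \<Rightarrow> ('j \<Rightarrow> complex ^ 'n \<Rightarrow> complex) \<Rightarrow>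
     (('j \<Rightarrow>\<^sub>0 int) \<Rightarrow>\<^sub>0 complex) \<Rightarrow>
     ((complex ^ 'n \<Rightarrow> complex) \<times> (complex ^ 'n \<Rightarrow> complex)) set" where
  "laurent_hom k V J f p =
     (let L = localized_coordinate_ring k V J f; \<iota> = localized_fraction k V J f
      in \<Oplus>\<^bsub>L\<^esub>\<omega>\<in>Poly_Mapping.keys p.
           \<iota> (\<lambda>x\<in>V. Poly_Mapping.lookup p \<omega>) \<otimes>\<^bsub>L\<^esub>
           (\<Otimes>\<^bsub>L\<^esub>j\<in>Poly_Mapping.keys \<omega>. \<iota> (f j) [^]\<^bsub>L\<^esub> Poly_Mapping.lookup \<omega> j))"

definition laurent_ideal ::
    "complex set \<Rightarrow> (complex ^ 'n::finite) set \<Rightarrow> 'j set \<Rightarrow> ('j \<Rightarrow> complex ^ 'n \<Rightarrow> complex) \<Rightarrow>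
     (('j \<Rightarrow>\<^sub>0 int) \<Rightarrow>\<^sub>0 complex) set" where
  "laurent_ideal k V J f =
     a_kernel (laurent_ring k J) (localized_coordinate_ring k V J f) (laurent_hom k V J f)"


section \<open>Tropical varieties\<close>

definition exponent_pairing :: "('j \<Rightarrow> real) \<Rightarrow> ('j \<Rightarrow>\<^sub>0 int) \<Rightarrow> real" where
  "exponent_pairing x \<omega> =
     (\<Sum>j\<in>Poly_Mapping.keys \<omega>. x j * real_of_int (Poly_Mapping.lookup \<omega> j))"

text \<open>
  The tropical polynomial with finite set of exponents \<open>A\<close>, as a function. With values in the
  extended reals the supremum is a maximum, and it is \<open>- \<infinity>\<close> for empty \<open>A\<close>.
\<close>

definition tropical_poly :: "('j \<Rightarrow>\<^sub>0 int) set \<Rightarrow> ('j \<Rightarrow> real) \<Rightarrow> ereal" where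
  "tropical_poly A x = (SUP \<omega>\<in>A. ereal (exponent_pairing x \<omega>))"

definition tropical_hypersurface :: "'j set \<Rightarrow> ('j \<Rightarrow>\<^sub>0 int) set \<Rightarrow> ('j \<Rightarrow> real) set" where
  "tropical_hypersurface J A =
     {x \<in> topspace (powertop_real J).
        \<forall>w\<in>A. ereal (exponent_pairing x w) \<le> tropical_poly (A - {w}) x}"

definition tropical_variety ::
    "'j set \<Rightarrow> (('j \<Rightarrow>\<^sub>0 int) \<Rightarrow>\<^sub>0 complex) set \<Rightarrow> ('j \<Rightarrow> real) set" where
  "tropical_variety J I = (\<Inter>p\<in>I. tropical_hypersurface J (Poly_Mapping.keys p))"

end

theory Submission
  imports Defs "HOL-Library.Function_Algebras"
begin

hide_const (open) UnivPoly.coeff UnivPoly.monom Module.smult Polynomials.degree Polynomials.lead_coeff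

text \<open>
  If $x_n \in V'$ tends to infinity in the direction \<open>b\<close>, then in a relation \<open>p \<in> I\<close>, evaluated at $x_n$,
  no term may dominate all others; so \<open>b \<in> T(I)\<close>.

  Conversely let \<open>x \<in> T(I)\<close>. The weighted norm $\max_\omega e^{\langle x, \omega\rangle}$ over the exponents
  of a Laurent polynomial gives the class of \<open>1\<close> modulo \<open>I\<close> norm one, since no initial form of an element
  of \<open>I\<close> is a monomial. By Berkovich's argument (a minimal bounded seminorm is multiplicative) there is a
  valuation \<open>v\<close>, trivial on \<open>k\<close>, that vanishes on \<open>I\<close> and has $v(X_j) = e^{x_j}$. It remains to approximate
  \<open>v\<close> by complex points: we want points $P_m$ killing the kernel of \<open>v\<close> and $t_m \to \infty$ with
  $|g(P_m)|^{1/t_m} \to v(g)$ for all \<open>g\<close>. They are found one variable \<open>Y\<close> at a time. The sequences of complex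
  numbers with finite growth form a ring with the seminorm $\limsup |c_m|^{1/t_m}$; a Hahn--Banach argument
  (diagonal sequences replace spherical completeness, \<open>k\<close> being countable) shows that \<open>v\<close> and this
  seminorm have a common extension to polynomials in \<open>Y\<close> with such sequences as coefficients, and again
  Berkovich's argument makes it multiplicative. Over the complex numbers the polynomials in question split, so
  that the extension is determined on them by its values on the linear factors $Y - r$, and a suitable value
  of \<open>Y\<close> is a root, or a generic point at the right distance from the nearest root.
\<close>

section \<open>Multiplicative seminorms below a filtration\<close>

text \<open>The upper limit is not multiplicative: the indicators of two complementary infinite
  index sets have value 1 and product 0. Making the seminorm multiplicative therefore decides which
  index sets count, as an ultrafilter would, and this is why every new variable costs a passage to a
  subsequence. Sequences are needed as coefficients because the roots of a polynomial move with the
  index and do not lie in the ring already evaluated.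

  A minimal seminorm may lose values that have to be kept. For this reason seminorms carry a set
  \<open>S\<close> of pairs \<open>(s, r)\<close> on which \<open>N (s * a) = r * N a\<close> is
  imposed; monomials play this role for the Laurent ring, polynomials of positive value for
  sequences. What has to be proved each time is that the starting filtration does not already make
  some \<open>s\<close> too small: by the tropical condition in one case, by the Hahn--Banach
  extension in the other.

  Approximate zeros would not be enough, since the points must lie on the variety. So elements of
  value 0 are killed exactly at every index, and only the sizes of the others are
  approximated.\<close>

lemma le_mult_of_less:
  fixes a b c :: real
  assumes "\<And>s u. a < s \<Longrightarrow> b < u \<Longrightarrow> c \<le> s * u"
  shows "c \<le> a * b"
proof -
  have "((\<lambda>e. (a + e) * (b + e)) \<longlongrightarrow> (a + 0) * (b + 0)) (at_right 0)"
    by (intro tendsto_intros)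
  moreover have "\<forall>\<^sub>F e in at_right 0. c \<le> (a + e) * (b + e)"
    using assms by (auto simp: eventually_at_right_field intro: exI[of _ 1])
  ultimately show ?thesis
    by (intro tendsto_lowerbound[of _ _ "at_right 0"]) auto
qed

section \<open>Ultrametric seminorms with prescribed multipliers\<close>

locale scaled_ring =
  fixes B :: "'a::comm_ring_1 set" and S :: "('a \<times> real) set"
  assumes one_B: "1 \<in> B"
    and add_B: "a \<in> B \<Longrightarrow> b \<in> B \<Longrightarrow> a + b \<in> B"
    and mult_B: "a \<in> B \<Longrightarrow> b \<in> B \<Longrightarrow> a * b \<in> B"
    and S_B: "(s, r) \<in> S \<Longrightarrow> s \<in> B"
    and S_pos: "(s, r) \<in> S \<Longrightarrow> 0 < r"
begin

text \<open>Values off \<open>B\<close> are fixed to 0 so that the pointwise order compares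
  seminorms on \<open>B\<close> only and a minimal one is determined as a function. The last clause
  keeps every pair of \<open>S\<close> exact, and each construction of a smaller seminorm has to
  preserve it.\<close>

definition seminorms :: "('a \<Rightarrow> real) set" where
  "seminorms = {N. N 1 = 1 \<and> (\<forall>a. a \<notin> B \<longrightarrow> N a = 0) \<and> (\<forall>a. 0 \<le> N a) \<and>
     (\<forall>a\<in>B. \<forall>b\<in>B. N (a + b) \<le> max (N a) (N b) \<and> N (a * b) \<le> N a * N b) \<and>
     (\<forall>(s, r)\<in>S. \<forall>a\<in>B. N (s * a) = r * N a)}"

lemma seminormsD:
  assumes "N \<in> seminorms"
  shows "N 1 = 1" "a \<notin> B \<Longrightarrow> N a = 0" "0 \<le> N a"
    "a \<in> B \<Longrightarrow> b \<in> B \<Longrightarrow> N (a + b) \<le> max (N a) (N b)"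
    "a \<in> B \<Longrightarrow> b \<in> B \<Longrightarrow> N (a * b) \<le> N a * N b"
    "(s, r) \<in> S \<Longrightarrow> a \<in> B \<Longrightarrow> N (s * a) = r * N a"
  using assms unfolding seminorms_def by (auto simp del: max.bounded_iff)

lemma seminormsI:
  assumes "N 1 = 1" "\<And>a. a \<notin> B \<Longrightarrow> N a = 0" "\<And>a. 0 \<le> N a"
    "\<And>a b. a \<in> B \<Longrightarrow> b \<in> B \<Longrightarrow> N (a + b) \<le> max (N a) (N b)"
    "\<And>a b. a \<in> B \<Longrightarrow> b \<in> B \<Longrightarrow> N (a * b) \<le> N a * N b"
    "\<And>s r a. (s, r) \<in> S \<Longrightarrow> a \<in> B \<Longrightarrow> N (s * a) = r * N a"
  shows "N \<in> seminorms"
  using assms unfolding seminorms_def by (auto simp del: max.bounded_iff)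

lemma power_B: "a \<in> B \<Longrightarrow> a ^ n \<in> B"
  by (induction n) (auto intro: one_B mult_B)

lemma seminorm_power_le: "N \<in> seminorms \<Longrightarrow> a \<in> B \<Longrightarrow> N (a ^ n) \<le> N a ^ n"
proof (induction n)
  case (Suc n)
  have "N (a * a ^ n) \<le> N a * N (a ^ n)"
    by (intro seminormsD(5)[OF Suc(2)] Suc power_B)
  also have "\<dots> \<le> N a * N a ^ n"
    using Suc seminormsD(3) by (intro mult_left_mono) auto
  finally show ?case by simp
qed (simp add: seminormsD)

lemma seminorm_sum_le:
  assumes N: "N \<in> seminorms" and fin: "finite F" "F \<noteq> {}"
    and le: "\<And>i. i \<in> F \<Longrightarrow> f i \<in> B \<and> N (f i) \<le> K"
  shows "sum f F \<in> B \<and> N (sum f F) \<le> K"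
  using fin le
proof (induction F rule: finite_ne_induct)
  case (insert x F)
  then have "N (f x + sum f F) \<le> max (N (f x)) (N (sum f F))"
    by (intro seminormsD(4)[OF N]) auto
  moreover have "N (f x) \<le> K" "N (sum f F) \<le> K" "f x \<in> B" "sum f F \<in> B"
    using insert by auto
  moreover have "sum f (insert x F) = f x + sum f F" using insert by simp
  ultimately show ?case by (metis add_B max.bounded_iff max_def)
qed auto

text \<open>A multiple is a sum of equal terms, so the ultrametric inequality applies; binomial
  coefficients then cost nothing in the expansion of \<open>(a + b) ^ i\<close>. The case
  \<open>n = 0\<close> is excluded because \<open>0\<close> need not lie in
  \<open>B\<close>.\<close>

lemma seminorm_of_nat_le:
  assumes N: "N \<in> seminorms" and a: "a \<in> B" and n: "0 < n"
  shows "of_nat n * a \<in> B \<and> N (of_nat n * a) \<le> N a"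
proof -
  have "(\<Sum>i<n. a) \<in> B \<and> N (\<Sum>i<n. a) \<le> N a"
    using n a by (intro seminorm_sum_le[OF N]) auto
  then show ?thesis by simp
qed

text \<open>The spectral seminorm, that is the infimum of N(a^n)^(1/n) over n >= 1, written without
  roots.\<close>

definition spectral :: "('a \<Rightarrow> real) \<Rightarrow> 'a \<Rightarrow> real" where
  "spectral N a = (if a \<in> B then Inf {s. 0 \<le> s \<and> (\<exists>n\<ge>1. N (a ^ n) \<le> s ^ n)} else 0)"

lemma spectral_le:
  assumes "a \<in> B" "0 \<le> s" "1 \<le> n" "N (a ^ n) \<le> s ^ n"
  shows "spectral N a \<le> s"
  unfolding spectral_def using assms by (auto intro!: cInf_lower bdd_belowI[of _ 0])

lemma spectral_le_self:
  assumes "N \<in> seminorms"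
  shows "spectral N a \<le> N a"
  using spectral_le[of a "N a" 1 N] seminormsD(3)[OF assms, of a]
  by (cases "a \<in> B") (auto simp: spectral_def)

lemma spectral_nonneg:
  assumes "N \<in> seminorms"
  shows "0 \<le> spectral N a"
proof (cases "a \<in> B")
  case True
  have "N a \<in> {s. 0 \<le> s \<and> (\<exists>n\<ge>1. N (a ^ n) \<le> s ^ n)}"
    using seminormsD(3)[OF assms] by (auto intro: exI[of _ 1])
  then show ?thesis
    using True by (auto simp: spectral_def intro!: cInf_greatest)
qed (simp add: spectral_def)

lemma spectral_lessD:
  assumes N: "N \<in> seminorms" and a: "a \<in> B" and s: "spectral N a < s"
  shows "0 < s" "\<exists>n\<ge>1. N (a ^ n) \<le> s ^ n"
proof -
  show "0 < s" using s spectral_nonneg[OF N, of a] by simp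
  have ne: "N a \<in> {s. 0 \<le> s \<and> (\<exists>n\<ge>1. N (a ^ n) \<le> s ^ n)}"
    using seminormsD(3)[OF N] by (auto intro: exI[of _ 1])
  obtain s' n where "0 \<le> s'" "n \<ge> 1" "N (a ^ n) \<le> s' ^ n" "s' < s"
    using cInf_lessD[of "{s. 0 \<le> s \<and> (\<exists>n\<ge>1. N (a ^ n) \<le> s ^ n)}" s] ne s a
    by (auto simp: spectral_def)
  then show "\<exists>n\<ge>1. N (a ^ n) \<le> s ^ n"
    by (meson less_imp_le order_trans power_mono)
qed

text \<open>One good exponent \<open>n\<close> controls all powers: in \<open>i = n * q + r\<close>
  the remainder takes finitely many values, and \<open>C\<close> collects their
  contributions.\<close>

lemma spectral_power_bound:
  assumes N: "N \<in> seminorms" and a: "a \<in> B" and s: "spectral N a < s"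
  shows "\<exists>C>0. \<forall>i. N (a ^ i) \<le> C * s ^ i"
proof -
  obtain n where n: "n \<ge> 1" "N (a ^ n) \<le> s ^ n" and s0: "0 < s"
    using spectral_lessD[OF N a s] by blast
  define C where "C = 1 + (\<Sum>r<n. N (a ^ r) / s ^ r)"
  have C: "C > 0" unfolding C_def
    using s0 seminormsD(3)[OF N] by (intro add_pos_nonneg sum_nonneg) auto
  have "N (a ^ i) \<le> C * s ^ i" for i
  proof -
    define q r where "q = i div n" and "r = i mod n"
    have i: "i = n * q + r" and r: "r < n" using n by (auto simp: q_def r_def)
    have "N (a ^ i) \<le> N ((a ^ n) ^ q) * N (a ^ r)"
      unfolding i power_add power_mult by (intro seminormsD(5)[OF N] power_B a)
    also have "\<dots> \<le> (s ^ n) ^ q * N (a ^ r)"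
    proof (intro mult_right_mono seminormsD(3)[OF N])
      have "N ((a ^ n) ^ q) \<le> N (a ^ n) ^ q" by (intro seminorm_power_le N power_B a)
      also have "\<dots> \<le> (s ^ n) ^ q" using n seminormsD(3)[OF N] by (intro power_mono)
      finally show "N ((a ^ n) ^ q) \<le> (s ^ n) ^ q" .
    qed
    also have "N (a ^ r) = (N (a ^ r) / s ^ r) * s ^ r" using s0 by simp
    also have "N (a ^ r) / s ^ r \<le> C"
      unfolding C_def using r s0 seminormsD(3)[OF N]
      using member_le_sum[of r "{..<n}" "\<lambda>r. N (a ^ r) / s ^ r"] by auto
    finally show ?thesis using s0 by (simp add: i power_add power_mult mult_ac)
  qed
  with C show ?thesis by blast
qed

text \<open>A constant factor disappears on taking n-th roots. Together with
  \<open>spectral_power_bound\<close> this turns statements about \<open>spectral\<close> into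
  statements about the growth of powers, where sums and products can be expanded.\<close>

lemma spectral_le_of_power_bound:
  assumes N: "N \<in> seminorms" and a: "a \<in> B" and s: "0 < s" and C: "\<And>i. N (a ^ i) \<le> C * s ^ i"
  shows "spectral N a \<le> s"
proof (rule field_le_epsilon)
  fix e :: real assume e: "0 < e"
  have "1 < (s + e) / s" using s e by simp
  then obtain n where n: "C < ((s + e) / s) ^ n"
    using real_arch_pow by blast
  have "C * s ^ Suc n \<le> ((s + e) / s) ^ Suc n * s ^ Suc n"
  proof (intro mult_right_mono)
    have "((s + e) / s) ^ n \<le> ((s + e) / s) ^ Suc n"
      using \<open>1 < (s + e) / s\<close> by (intro power_increasing) auto
    then show "C \<le> ((s + e) / s) ^ Suc n" using n by linarith
  qed (use s in auto)
  also have "\<dots> = (s + e) ^ Suc n" using s by (simp add: power_mult_distrib[symmetric] del: power_Suc)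
  finally have "N (a ^ Suc n) \<le> (s + e) ^ Suc n" using C[of "Suc n"] by linarith
  then show "spectral N a \<le> s + e"
    using spectral_le[OF a, of "s + e" "Suc n" N] s e by auto
qed

lemma spectral_in_seminorms:
  assumes N: "N \<in> seminorms"
  shows "spectral N \<in> seminorms"
proof -
  have one: "spectral N 1 = 1"
  proof (rule antisym)
    show "spectral N 1 \<le> 1" using spectral_le_self[OF N, of 1] seminormsD(1)[OF N] by simp
    show "1 \<le> spectral N 1"
    proof (rule ccontr)
      assume "\<not> 1 \<le> spectral N 1"
      then obtain s where s: "spectral N 1 < s" "s < 1" by (meson dense not_le)
      then obtain n where "n \<ge> 1" "N (1 ^ n) \<le> s ^ n" "0 < s"
        using spectral_lessD[OF N one_B] by blast
      moreover have "s ^ n < 1" using s \<open>0 < s\<close> \<open>n \<ge> 1\<close> by (intro power_less_one_iff[THEN iffD2]) auto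
      ultimately show False using seminormsD(1)[OF N] by simp
    qed
  qed
  have add: "spectral N (a + b) \<le> max (spectral N a) (spectral N b)" if a: "a \<in> B" and b: "b \<in> B" for a b
  proof (rule dense_ge)
    fix s assume "max (spectral N a) (spectral N b) < s"
    then have s: "spectral N a < s" "spectral N b < s" by auto
    have s0: "0 < s" using spectral_lessD(1)[OF N a] s by blast
    obtain C where C: "C > 0" "\<And>i. N (a ^ i) \<le> C * s ^ i"
      using spectral_power_bound[OF N a s(1)] by blast
    obtain D where D: "D > 0" "\<And>i. N (b ^ i) \<le> D * s ^ i"
      using spectral_power_bound[OF N b s(2)] by blast
    have "N ((a + b) ^ i) \<le> C * D * s ^ i" for i
    proof -
      have "(\<Sum>k\<le>i. of_nat (i choose k) * a ^ k * b ^ (i - k)) \<in> B \<and>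
         N (\<Sum>k\<le>i. of_nat (i choose k) * a ^ k * b ^ (i - k)) \<le> C * D * s ^ i"
      proof (rule seminorm_sum_le[OF N])
        fix k assume k: "k \<in> {..i}"
        have m: "a ^ k * b ^ (i - k) \<in> B" by (intro mult_B power_B a b)
        have "N (a ^ k * b ^ (i - k)) \<le> N (a ^ k) * N (b ^ (i - k))"
          by (intro seminormsD(5)[OF N] power_B a b)
        also have "\<dots> \<le> (C * s ^ k) * (D * s ^ (i - k))"
          using C D seminormsD(3)[OF N] s0 by (intro mult_mono) auto
        also have "\<dots> = C * D * s ^ i" using k by (simp add: power_add[symmetric])
        finally have "N (a ^ k * b ^ (i - k)) \<le> C * D * s ^ i" .
        with seminorm_of_nat_le[OF N m, of "i choose k"] k
        show "of_nat (i choose k) * a ^ k * b ^ (i - k) \<in> B \<and>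
           N (of_nat (i choose k) * a ^ k * b ^ (i - k)) \<le> C * D * s ^ i"
          by (auto simp: mult.assoc)
      qed auto
      then show ?thesis by (simp add: binomial_ring)
    qed
    then show "spectral N (a + b) \<le> s"
      by (intro spectral_le_of_power_bound[OF N add_B[OF a b] s0])
  qed
  have mult: "spectral N (a * b) \<le> spectral N a * spectral N b" if a: "a \<in> B" and b: "b \<in> B" for a b
  proof -
    have *: "spectral N (a * b) \<le> s * u" if s: "spectral N a < s" and u: "spectral N b < u" for s u
    proof -
      have s0: "0 < s" "0 < u" using spectral_lessD(1)[OF N a s] spectral_lessD(1)[OF N b u] by auto
      obtain C where C: "C > 0" "\<And>i. N (a ^ i) \<le> C * s ^ i"
        using spectral_power_bound[OF N a s(1)] by blast
      obtain D where D: "D > 0" "\<And>i. N (b ^ i) \<le> D * u ^ i"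
        using spectral_power_bound[OF N b u] by blast
      have "N ((a * b) ^ i) \<le> C * D * (s * u) ^ i" for i
      proof -
        have "N ((a * b) ^ i) \<le> N (a ^ i) * N (b ^ i)"
          unfolding power_mult_distrib by (intro seminormsD(5)[OF N] power_B a b)
        also have "\<dots> \<le> (C * s ^ i) * (D * u ^ i)"
          using C D seminormsD(3)[OF N] s0 by (intro mult_mono) auto
        finally show ?thesis by (simp add: power_mult_distrib mult_ac)
      qed
      then show ?thesis
        using s0 by (intro spectral_le_of_power_bound[OF N mult_B[OF a b]]) auto
    qed
    show ?thesis by (rule le_mult_of_less) (rule *)
  qed
  have scale: "spectral N (s * a) = r * spectral N a" if S: "(s, r) \<in> S" and a: "a \<in> B" for s r a
  proof -
    have r: "r > 0" and sB: "s \<in> B" using S S_pos S_B by auto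
    have pw: "N (s ^ n * b) = r ^ n * N b" if "b \<in> B" for n b
    proof (induction n)
      case (Suc n)
      have "N (s * (s ^ n * b)) = r * N (s ^ n * b)"
        by (intro seminormsD(6)[OF N S] mult_B power_B sB that)
      with Suc show ?case by (simp add: mult_ac)
    qed simp
    have pw': "N ((s * a) ^ n) = r ^ n * N (a ^ n)" for n
      unfolding power_mult_distrib by (intro pw power_B a)
    show ?thesis
    proof (rule antisym)
      have "spectral N (s * a) / r \<le> spectral N a"
      proof (rule dense_ge)
        fix t assume "spectral N a < t"
        then obtain n where n: "n \<ge> 1" "N (a ^ n) \<le> t ^ n" "0 < t"
          using spectral_lessD[OF N a] by blast
        have "spectral N (s * a) \<le> r * t"
        proof (intro spectral_le[of _ _ n] mult_B sB a)
          show "N ((s * a) ^ n) \<le> (r * t) ^ n"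
            unfolding pw' using n r by (simp add: power_mult_distrib)
        qed (use n r in auto)
        then show "spectral N (s * a) / r \<le> t" using r by (simp add: field_simps)
      qed
      then show "spectral N (s * a) \<le> r * spectral N a" using r by (simp add: field_simps)
      show "r * spectral N a \<le> spectral N (s * a)"
      proof (rule dense_ge)
        fix t assume "spectral N (s * a) < t"
        then obtain n where n: "n \<ge> 1" "N ((s * a) ^ n) \<le> t ^ n" "0 < t"
          using spectral_lessD[OF N mult_B[OF sB a]] by blast
        have "spectral N a \<le> t / r"
        proof (intro spectral_le[of _ _ n] a)
          show "N (a ^ n) \<le> (t / r) ^ n"
            using n(2) r unfolding pw' by (simp add: power_divide pos_le_divide_eq mult.commute)
        qed (use n r in auto)
        then show "r * spectral N a \<le> t" using r by (simp add: field_simps)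
      qed
    qed
  qed
  show ?thesis
    using one _ spectral_nonneg[OF N] add mult scale by (rule seminormsI) (simp add: spectral_def)
qed

text \<open>The seminorm that \<open>b\<close> receives in the localization at \<open>a\<close>,
  with \<open>1 / a\<close> given the value \<open>1 / N a\<close>: the fraction
  \<open>b * a ^ n / a ^ n\<close> is measured for every \<open>n\<close>. Under the hypothesis
  \<open>pow\<close> these quotients are nonincreasing in \<open>n\<close>, so the infimum is a
  limit.\<close>

definition twist :: "('a \<Rightarrow> real) \<Rightarrow> 'a \<Rightarrow> 'a \<Rightarrow> real" where
  "twist N a b = (if b \<in> B then (INF n. N (b * a ^ n) / N a ^ n) else 0)"

context
  fixes N :: "'a \<Rightarrow> real" and a
  assumes N: "N \<in> seminorms" and a: "a \<in> B" and Na: "0 < N a" and pow: "\<And>n. N a ^ n = N (a ^ n)"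
begin

lemma twist_le: "b \<in> B \<Longrightarrow> twist N a b \<le> N (b * a ^ n) / N a ^ n"
  unfolding twist_def using seminormsD(3)[OF N] Na
  by (auto intro!: cINF_lower bdd_belowI[of _ 0])

lemma twist_quotient_antimono:
  assumes b: "b \<in> B" and mn: "m \<le> n"
  shows "N (b * a ^ n) / N a ^ n \<le> N (b * a ^ m) / N a ^ m"
proof -
  have "N (b * a ^ n) = N ((b * a ^ m) * a ^ (n - m))"
    using mn by (simp add: mult.assoc power_add[symmetric])
  also have "\<dots> \<le> N (b * a ^ m) * N (a ^ (n - m))"
    by (intro seminormsD(5)[OF N] mult_B power_B a b)
  also have "N (a ^ (n - m)) = N a ^ n / N a ^ m"
    using mn Na by (simp add: pow[symmetric] power_diff)
  finally show ?thesis using Na by (simp add: field_simps)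
qed

lemma twist_lessD:
  assumes b: "b \<in> B" and s: "twist N a b < s"
  shows "\<exists>n. \<forall>m\<ge>n. N (b * a ^ m) / N a ^ m < s"
proof -
  have "\<exists>n. N (b * a ^ n) / N a ^ n < s"
  proof -
    have "bdd_below (range (\<lambda>n. N (b * a ^ n) / N a ^ n))"
      using seminormsD(3)[OF N] Na by (auto intro!: bdd_belowI[of _ 0])
    with s b show ?thesis by (simp add: twist_def cINF_less_iff)
  qed
  then show ?thesis using twist_quotient_antimono[OF b] by (meson le_less_trans)
qed

lemma twist_nonneg: "0 \<le> twist N a b"
  unfolding twist_def using seminormsD(3)[OF N] Na by (auto intro!: cINF_greatest)

lemma twist_greatest: "b \<in> B \<Longrightarrow> (\<And>n. s \<le> N (b * a ^ n) / N a ^ n) \<Longrightarrow> s \<le> twist N a b"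
  unfolding twist_def by (auto intro!: cINF_greatest)

lemma twist_in_seminorms: "twist N a \<in> seminorms"
proof -
  have one: "twist N a 1 = 1"
  proof (rule antisym)
    show "twist N a 1 \<le> 1" using twist_le[OF one_B, of 0] seminormsD(1)[OF N] by simp
    show "1 \<le> twist N a 1" using Na by (intro twist_greatest one_B) (auto simp: pow[symmetric])
  qed
  have add: "twist N a (b + c) \<le> max (twist N a b) (twist N a c)" if b: "b \<in> B" and c: "c \<in> B" for b c
  proof (rule dense_ge)
    fix s assume s: "max (twist N a b) (twist N a c) < s"
    obtain n1 where n1: "\<forall>m\<ge>n1. N (b * a ^ m) / N a ^ m < s" using twist_lessD[OF b, of s] s by auto
    obtain n2 where n2: "\<forall>m\<ge>n2. N (c * a ^ m) / N a ^ m < s" using twist_lessD[OF c, of s] s by auto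
    define n where "n = max n1 n2"
    have "N (b * a ^ n + c * a ^ n) \<le> max (N (b * a ^ n)) (N (c * a ^ n))"
      by (intro seminormsD(4)[OF N] mult_B power_B a b c)
    also have "\<dots> \<le> s * N a ^ n"
      using n1[rule_format, of n] n2[rule_format, of n] Na by (auto simp: n_def field_simps)
    finally have "N ((b + c) * a ^ n) / N a ^ n \<le> s" using Na by (simp add: field_simps)
    then show "twist N a (b + c) \<le> s" using twist_le[OF add_B[OF b c], of n] by linarith
  qed
  have mult: "twist N a (b * c) \<le> twist N a b * twist N a c" if b: "b \<in> B" and c: "c \<in> B" for b c
  proof -
    have *: "twist N a (b * c) \<le> s * u" if s: "twist N a b < s" and u: "twist N a c < u" for s u
    proof -
      obtain n1 where n1: "\<forall>m\<ge>n1. N (b * a ^ m) / N a ^ m < s" using twist_lessD[OF b s] by auto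
      obtain n2 where n2: "\<forall>m\<ge>n2. N (c * a ^ m) / N a ^ m < u" using twist_lessD[OF c u] by auto
      define n where "n = max n1 n2"
      have "N ((b * c) * a ^ (n + n)) = N ((b * a ^ n) * (c * a ^ n))"
        by (simp add: power_add mult_ac)
      also have "\<dots> \<le> N (b * a ^ n) * N (c * a ^ n)"
        by (intro seminormsD(5)[OF N] mult_B power_B a b c)
      finally have "N ((b * c) * a ^ (n + n)) / N a ^ (n + n) \<le>
          (N (b * a ^ n) / N a ^ n) * (N (c * a ^ n) / N a ^ n)"
        using Na by (simp add: power_add field_simps)
      also have "\<dots> \<le> s * u"
        using n1[rule_format, of n] n2[rule_format, of n] seminormsD(3)[OF N] Na twist_nonneg[of b] s
        by (intro mult_mono) (auto simp: n_def)
      finally show ?thesis using twist_le[OF mult_B[OF b c], of "n + n"] by linarith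
    qed
    show ?thesis by (rule le_mult_of_less) (rule *)
  qed
  have scale: "twist N a (s * b) = r * twist N a b" if S: "(s, r) \<in> S" and b: "b \<in> B" for s r b
  proof -
    have r: "r > 0" and sB: "s \<in> B" using S S_pos S_B by auto
    have eq: "N (s * b * a ^ n) = r * N (b * a ^ n)" for n
      unfolding mult.assoc by (intro seminormsD(6)[OF N S] mult_B power_B b a)
    show ?thesis
    proof (rule antisym)
      have "twist N a (s * b) / r \<le> twist N a b"
      proof (rule twist_greatest[OF b])
        fix n
        show "twist N a (s * b) / r \<le> N (b * a ^ n) / N a ^ n"
          using twist_le[OF mult_B[OF sB b], of n] r unfolding eq
          by (simp add: pos_divide_le_eq mult.commute[of _ r])
      qed
      then show "twist N a (s * b) \<le> r * twist N a b" using r by (simp add: field_simps)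
      show "r * twist N a b \<le> twist N a (s * b)"
      proof (rule twist_greatest[OF mult_B[OF sB b]])
        fix n
        show "r * twist N a b \<le> N (s * b * a ^ n) / N a ^ n"
          using twist_le[OF b, of n] r unfolding eq by (simp flip: times_divide_eq_right)
      qed
    qed
  qed
  show ?thesis
    using one _ twist_nonneg add mult scale by (rule seminormsI) (simp add: twist_def)
qed

lemma twist_le_self: "twist N a b \<le> N b"
  using twist_le[of b 0] seminormsD(3)[OF N, of b] by (cases "b \<in> B") (auto simp: twist_def)

text \<open>Moving one factor \<open>a\<close> from the argument into the power shifts the index by
  one; this yields the inequality opposite to submultiplicativity.\<close>

lemma twist_mult_self:
  assumes b: "b \<in> B"
  shows "N a * twist N a b \<le> twist N a (a * b)"
proof (rule twist_greatest[OF mult_B[OF a b]])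
  fix n
  show "N a * twist N a b \<le> N (a * b * a ^ n) / N a ^ n"
    using twist_le[OF b, of "Suc n"] Na by (simp add: field_simps)
qed

end

text \<open>In a chain, two near-optimal seminorms, one for \<open>a\<close> and one for
  \<open>b\<close>, can be replaced by the smaller of them (\<open>less2\<close>); so the
  inequalities in two variables pass to the infimum.\<close>

lemma chain_Inf_in_seminorms:
  assumes C: "C \<subseteq> seminorms" "C \<noteq> {}" and chain: "\<And>N N'. N \<in> C \<Longrightarrow> N' \<in> C \<Longrightarrow> N \<le> N' \<or> N' \<le> N"
  defines "I \<equiv> \<lambda>a. INF N\<in>C. N a"
  shows "I \<in> seminorms" "\<And>N. N \<in> C \<Longrightarrow> I \<le> N"
proof -
  have nn: "0 \<le> N a" if "N \<in> C" for N a using that C seminormsD(3) by blast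
  have le: "I a \<le> N a" if "N \<in> C" for N a
    unfolding I_def using that nn by (auto intro!: cINF_lower bdd_belowI[of _ 0])
  then show "\<And>N. N \<in> C \<Longrightarrow> I \<le> N" by (auto simp: le_fun_def)
  have less: "\<exists>N\<in>C. N a < s" if "I a < s" for a s
  proof -
    have "bdd_below ((\<lambda>N. N a) ` C)" using nn by (auto intro!: bdd_belowI[of _ 0])
    with that C show ?thesis by (simp add: I_def cINF_less_iff)
  qed
  have ge: "s \<le> I a" if "\<And>N. N \<in> C \<Longrightarrow> s \<le> N a" for s a
    unfolding I_def using that C by (auto intro!: cINF_greatest)
  have less2: "\<exists>N\<in>C. N a < s \<and> N b < u" if "I a < s" "I b < u" for a b s u
    using less[OF that(1)] less[OF that(2)] chain by (metis le_fun_def le_less_trans)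
  have I0: "0 \<le> I a" for a using nn by (intro ge)
  have one: "I 1 = 1"
  proof -
    have "(\<lambda>N. N 1) ` C = {1}" using C by (auto simp: seminormsD(1) image_iff subset_iff)
    then show ?thesis by (simp add: I_def)
  qed
  have out: "I a = 0" if "a \<notin> B" for a
  proof -
    have "(\<lambda>N. N a) ` C = {0}" using C that by (auto simp: seminormsD(2) image_iff subset_iff)
    then show ?thesis by (simp add: I_def)
  qed
  have add: "I (a + b) \<le> max (I a) (I b)" if a: "a \<in> B" and b: "b \<in> B" for a b
  proof (rule dense_ge)
    fix s assume "max (I a) (I b) < s"
    then obtain N where N: "N \<in> C" "N a < s" "N b < s" using less2[of a s b s] by auto
    then show "I (a + b) \<le> s"
      using le[OF N(1), of "a + b"] seminormsD(4)[of N a b] a b C by fastforce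
  qed
  have mult: "I (a * b) \<le> I a * I b" if a: "a \<in> B" and b: "b \<in> B" for a b
  proof -
    have *: "I (a * b) \<le> s * u" if s: "I a < s" and u: "I b < u" for s u
    proof -
      obtain N where N: "N \<in> C" "N a < s" "N b < u" using less2 s u by blast
      have "I (a * b) \<le> N a * N b"
        using le[OF N(1), of "a * b"] seminormsD(5)[of N a b] a b C N(1) by fastforce
      also have "\<dots> \<le> s * u" using N nn I0[of a] s by (intro mult_mono) auto
      finally show ?thesis .
    qed
    show ?thesis by (rule le_mult_of_less) (rule *)
  qed
  have scale: "I (s * a) = r * I a" if S: "(s, r) \<in> S" and a: "a \<in> B" for s r a
  proof -
    have r: "r > 0" using S S_pos by auto
    have eq: "N (s * a) = r * N a" if "N \<in> C" for N using that C seminormsD(6)[OF _ S a] by blast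
    show ?thesis
    proof (rule antisym)
      have "I (s * a) / r \<le> I a"
      proof (rule ge)
        fix N assume "N \<in> C"
        then have "I (s * a) \<le> r * N a" using le[of N "s * a"] eq by simp
        then show "I (s * a) / r \<le> N a" using r by (simp add: pos_divide_le_eq mult.commute)
      qed
      then show "I (s * a) \<le> r * I a" using r by (simp add: field_simps)
      show "r * I a \<le> I (s * a)"
      proof (rule ge)
        fix N assume "N \<in> C"
        then show "r * I a \<le> N (s * a)" using le[of N a] r by (simp add: eq)
      qed
    qed
  qed
  show "I \<in> seminorms" using one out I0 add mult scale by (rule seminormsI)
qed

text \<open>A minimal \<open>w\<close> is fixed by every construction that yields a smaller
  seminorm. From \<open>spectral w = w\<close> follows \<open>w (a ^ n) = w a ^ n\<close>, which is
  what \<open>twist\<close> requires; from \<open>twist w a = w\<close> follows that multiplication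
  by \<open>a\<close> is exact.\<close>

theorem multiplicative_seminorm_below:
  assumes N0: "N0 \<in> seminorms"
  shows "\<exists>w\<in>seminorms. w \<le> N0 \<and> (\<forall>a\<in>B. \<forall>b\<in>B. w (a * b) = w a * w b)"
proof -
  define A where "A = {N \<in> seminorms. N \<le> N0}"
  have "\<exists>m\<in>A. \<forall>N\<in>A. N \<le> m \<longrightarrow> N = m"
  proof (rule predicate_Zorn)
    \<comment> \<open>The order is reversed, so that Zorn's lemma yields a minimal element.\<close>
    show "partial_order_on A (relation_of (\<lambda>x y. y \<le> x) A)"
      by (rule partial_order_on_relation_ofI) auto
    fix C assume "C \<in> Chains (relation_of (\<lambda>x y. y \<le> x) A)"
    then have C: "C \<subseteq> A" "\<And>N N'. N \<in> C \<Longrightarrow> N' \<in> C \<Longrightarrow> N \<le> N' \<or> N' \<le> N"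
      unfolding Chains_def relation_of_def by auto
    show "\<exists>u\<in>A. \<forall>a\<in>C. u \<le> a"
    proof (cases "C = {}")
      case True
      then show ?thesis using N0 by (auto simp: A_def)
    next
      case False
      have "C \<subseteq> seminorms" using C by (auto simp: A_def)
      note inf = chain_Inf_in_seminorms[OF this False C(2)]
      obtain N where "N \<in> C" using False by blast
      then have "(\<lambda>a. INF N\<in>C. N a) \<in> A"
        using inf C(1) unfolding A_def by (blast intro: order_trans)
      then show ?thesis using inf(2) by blast
    qed
  qed
  then obtain w where w: "w \<in> seminorms" "w \<le> N0" and
    min: "\<And>N. N \<in> seminorms \<Longrightarrow> N \<le> w \<Longrightarrow> N = w"
    unfolding A_def by (blast intro: order_trans)
  have "spectral w = w"
    by (intro min spectral_in_seminorms w) (auto simp: le_fun_def spectral_le_self w)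
  have pow: "w a ^ n = w (a ^ n)" if a: "a \<in> B" for a n
  proof (cases "n = 0")
    case False
    have "w a \<le> root n (w (a ^ n))"
    proof -
      have "spectral w a \<le> root n (w (a ^ n))"
        using False seminormsD(3)[OF w(1)] by (intro spectral_le[OF a, of _ n]) auto
      then show ?thesis by (simp add: \<open>spectral w = w\<close>)
    qed
    then have "w a ^ n \<le> root n (w (a ^ n)) ^ n"
      by (intro power_mono seminormsD(3)[OF w(1)])
    also have "\<dots> = w (a ^ n)" using False seminormsD(3)[OF w(1)] by simp
    finally show ?thesis using seminorm_power_le[OF w(1) a, of n] by linarith
  qed (simp add: seminormsD(1)[OF w(1)])
  have "w (a * b) = w a * w b" if a: "a \<in> B" and b: "b \<in> B" for a b
  proof (cases "w a = 0")
    case True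
    then show ?thesis
      using seminormsD(5)[OF w(1) a b] seminormsD(3)[OF w(1), of "a * b"] by simp
  next
    case False
    then have wa: "0 < w a" using seminormsD(3)[OF w(1), of a] by linarith
    have "twist w a = w"
      by (intro min twist_in_seminorms[OF w(1) a wa pow[OF a]])
        (auto simp: le_fun_def twist_le_self[OF w(1) a wa pow[OF a]])
    then show ?thesis
      using twist_mult_self[OF w(1) a wa pow[OF a] b] seminormsD(5)[OF w(1) a b] by simp
  qed
  with w show ?thesis by blast
qed

end

section \<open>Multiplicative seminorms bounded by a filtration\<close>

locale filtered_ring =
  fixes M :: "real \<Rightarrow> 'a::comm_ring_1 set" and S :: "('a \<times> real) set"
  assumes zero_M: "0 \<le> q \<Longrightarrow> 0 \<in> M q"
    and one_M: "1 \<in> M 1"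
    and mono_M: "0 \<le> q \<Longrightarrow> q \<le> q' \<Longrightarrow> M q \<subseteq> M q'"
    and add_M: "0 \<le> q \<Longrightarrow> a \<in> M q \<Longrightarrow> b \<in> M q \<Longrightarrow> a + b \<in> M q"
    and mult_M: "0 \<le> q \<Longrightarrow> 0 \<le> q' \<Longrightarrow> a \<in> M q \<Longrightarrow> b \<in> M q' \<Longrightarrow> a * b \<in> M (q * q')"
    and S_M: "(s, r) \<in> S \<Longrightarrow> 0 < r \<and> s \<in> M r"
    and S_one: "(1, 1) \<in> S"
    and S_mult: "(s, r) \<in> S \<Longrightarrow> (s', r') \<in> S \<Longrightarrow> (s * s', r * r') \<in> S"
    and sep: "(s, r) \<in> S \<Longrightarrow> 0 \<le> q \<Longrightarrow> s \<in> M q \<Longrightarrow> r \<le> q"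
begin

definition B :: "'a set" where "B = (\<Union>q\<in>{0..}. M q)"

lemma B_E:
  assumes "a \<in> B"
  obtains q where "0 \<le> q" "a \<in> M q"
  using assms by (auto simp: B_def)

sublocale scaled_ring B S
proof
  show "1 \<in> B" using one_M by (auto simp: B_def intro: bexI[of _ 1])
  show "a + b \<in> B" if ab: "a \<in> B" "b \<in> B" for a b
  proof -
    obtain q where qa: "0 \<le> q" "a \<in> M q" by (rule B_E[OF ab(1)])
    obtain q' where qb: "0 \<le> q'" "b \<in> M q'" by (rule B_E[OF ab(2)])
    note q = qa qb
    have "a \<in> M (max q q')" "b \<in> M (max q q')"
      using q mono_M[of q "max q q'"] mono_M[of q' "max q q'"] by auto
    then have "a + b \<in> M (max q q')" using q by (intro add_M) auto
    then show ?thesis using q by (auto simp: B_def intro!: bexI[of _ "max q q'"])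
  qed
  show "a * b \<in> B" if ab: "a \<in> B" "b \<in> B" for a b
  proof -
    obtain q where qa: "0 \<le> q" "a \<in> M q" by (rule B_E[OF ab(1)])
    obtain q' where qb: "0 \<le> q'" "b \<in> M q'" by (rule B_E[OF ab(2)])
    note q = qa qb
    have "a * b \<in> M (q * q')" using q by (intro mult_M)
    then show ?thesis using q by (auto simp: B_def intro!: bexI[of _ "q * q'"])
  qed
  show "s \<in> B" if "(s, r) \<in> S" for s r
    using S_M[OF that] by (auto simp: B_def intro!: bexI[of _ r])
  show "0 < r" if "(s, r) \<in> S" for s r using S_M[OF that] by simp
qed

text \<open>\<open>M q\<close> is thought of as the ball of radius \<open>q\<close>. The value of
  \<open>a\<close> may be read off from any multiple \<open>s * a\<close>, divided by the value
  \<open>r\<close> of \<open>s\<close>: without these quotients one would only have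
  \<open>norm0 (s * a) \<le> r * norm0 a\<close>, while \<open>seminorms\<close> asks for
  equality.\<close>

definition quotients :: "'a \<Rightarrow> real set" where
  "quotients a = {q / r | q r s. (s, r) \<in> S \<and> 0 \<le> q \<and> s * a \<in> M q}"

definition norm0 :: "'a \<Rightarrow> real" where
  "norm0 a = (if a \<in> B then Inf (quotients a) else 0)"

lemma M_subset_B: "0 \<le> q \<Longrightarrow> a \<in> M q \<Longrightarrow> a \<in> B"
  by (auto simp: B_def)

lemma quotients_nonneg: "x \<in> quotients a \<Longrightarrow> 0 \<le> x"
proof -
  assume "x \<in> quotients a"
  then obtain q r s where *: "x = q / r" "(s, r) \<in> S" "0 \<le> q" unfolding quotients_def by blast
  then show "0 \<le> x" using S_M[OF *(2)] by simp
qed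

lemma norm0_le: "a \<in> B \<Longrightarrow> (s, r) \<in> S \<Longrightarrow> 0 \<le> q \<Longrightarrow> s * a \<in> M q \<Longrightarrow> norm0 a \<le> q / r"
proof -
  assume *: "a \<in> B" "(s, r) \<in> S" "0 \<le> q" "s * a \<in> M q"
  then have "q / r \<in> quotients a" unfolding quotients_def by blast
  moreover have "bdd_below (quotients a)" using quotients_nonneg by (rule bdd_belowI)
  ultimately show "norm0 a \<le> q / r" using * by (simp add: norm0_def cInf_lower)
qed

lemma norm0_le_M: "0 \<le> q \<Longrightarrow> a \<in> M q \<Longrightarrow> norm0 a \<le> q"
  using norm0_le[OF _ S_one, of a q] M_subset_B[of q a] by simp

lemma quotients_nonempty: "a \<in> B \<Longrightarrow> quotients a \<noteq> {}"
proof -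
  assume "a \<in> B"
  then obtain q where "0 \<le> q" "a \<in> M q" by (rule B_E)
  then have "q / 1 \<in> quotients a"
    unfolding quotients_def using S_one by (intro CollectI exI[of _ q] exI[of _ 1]) auto
  then show "quotients a \<noteq> {}" by blast
qed

lemma norm0_lessD:
  assumes a: "a \<in> B" and u: "norm0 a < u"
  shows "\<exists>s r q. (s, r) \<in> S \<and> 0 \<le> q \<and> s * a \<in> M q \<and> q < u * r"
proof -
  obtain x where "x \<in> quotients a" "x < u"
    using cInf_lessD[OF quotients_nonempty[OF a], of u] u a by (auto simp: norm0_def)
  then obtain s r q where *: "(s, r) \<in> S" "0 \<le> q" "s * a \<in> M q" "q / r < u" by (auto simp: quotients_def)
  moreover have "0 < r" using S_M[OF *(1)] by simp
  ultimately have "q < u * r" by (simp add: pos_divide_less_eq)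
  with * show ?thesis by blast
qed

lemma norm0_nonneg: "0 \<le> norm0 a"
  unfolding norm0_def using quotients_nonneg quotients_nonempty by (auto intro!: cInf_greatest)

lemma norm0_in_seminorms: "norm0 \<in> seminorms"
proof -
  have one: "norm0 1 = 1"
  proof (rule antisym)
    show "norm0 1 \<le> 1" using one_M by (intro norm0_le_M) auto
    \<comment> \<open>This is where \<open>sep\<close> enters: a value below 1 would put some
      \<open>s\<close> into a ball smaller than its prescribed value.\<close>
    show "1 \<le> norm0 1"
    proof (rule ccontr)
      assume "\<not> 1 \<le> norm0 1"
      then obtain s r q where *: "(s, r) \<in> S" "0 \<le> q" "s * 1 \<in> M q" "q < 1 * r"
        using norm0_lessD[OF one_B, of 1] by auto
      then show False using sep[OF *(1,2)] by simp
    qed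
  qed
  have add: "norm0 (a + b) \<le> max (norm0 a) (norm0 b)" if a: "a \<in> B" and b: "b \<in> B" for a b
  proof (rule dense_ge)
    fix u assume u: "max (norm0 a) (norm0 b) < u"
    obtain s r q where 1: "(s, r) \<in> S" "0 \<le> q" "s * a \<in> M q" "q < u * r"
      using norm0_lessD[OF a, of u] u by auto
    obtain s' r' q' where 2: "(s', r') \<in> S" "0 \<le> q'" "s' * b \<in> M q'" "q' < u * r'"
      using norm0_lessD[OF b, of u] u by auto
    have r: "0 < r" "s \<in> M r" "0 < r'" "s' \<in> M r'" using S_M 1 2 by auto
    define p where "p = u * (r * r')"
    have pos: "0 \<le> p" using u norm0_nonneg[of a] r by (auto simp: p_def)
    have "s' * (s * a) \<in> M (r' * q)" "s * (s' * b) \<in> M (r * q')"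
      using r 1 2 by (auto intro!: mult_M)
    moreover have "r' * q \<le> p" "r * q' \<le> p" using r 1 2 by (auto simp: p_def mult_ac)
    ultimately have "s' * (s * a) \<in> M p" "s * (s' * b) \<in> M p"
      using mono_M[of "r' * q" p] mono_M[of "r * q'" p] r 1 2 by auto
    then have "s' * (s * a) + s * (s' * b) \<in> M p" using pos by (intro add_M)
    then have "(s * s') * (a + b) \<in> M p" by (simp add: algebra_simps)
    then have "norm0 (a + b) \<le> p / (r * r')"
      using pos by (intro norm0_le[OF add_B[OF a b] S_mult[OF 1(1) 2(1)]])
    then show "norm0 (a + b) \<le> u" using r by (simp add: p_def)
  qed
  have mult: "norm0 (a * b) \<le> norm0 a * norm0 b" if a: "a \<in> B" and b: "b \<in> B" for a b
  proof -
    have *: "norm0 (a * b) \<le> u * u'" if u: "norm0 a < u" and u': "norm0 b < u'" for u u'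
    proof -
      obtain s r q where 1: "(s, r) \<in> S" "0 \<le> q" "s * a \<in> M q" "q < u * r"
        using norm0_lessD[OF a u] by auto
      obtain s' r' q' where 2: "(s', r') \<in> S" "0 \<le> q'" "s' * b \<in> M q'" "q' < u' * r'"
        using norm0_lessD[OF b u'] by auto
      have r: "0 < r" "0 < r'" using S_M 1 2 by auto
      have "(s * a) * (s' * b) \<in> M (q * q')" using 1 2 by (intro mult_M)
      then have "(s * s') * (a * b) \<in> M (q * q')" by (simp add: mult_ac)
      then have "norm0 (a * b) \<le> (q * q') / (r * r')"
        using 1 2 by (intro norm0_le[OF mult_B[OF a b] S_mult[OF 1(1) 2(1)]]) auto
      also have "\<dots> \<le> (u * r) * (u' * r') / (r * r')"
        using 1 2 r by (intro divide_right_mono mult_mono) auto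
      finally show ?thesis using r by (simp add: field_simps)
    qed
    show ?thesis by (rule le_mult_of_less) (rule *)
  qed
  have scale: "norm0 (s * a) = r * norm0 a" if S: "(s, r) \<in> S" and a: "a \<in> B" for s r a
  proof -
    have r: "r > 0" "s \<in> M r" and sB: "s \<in> B" using S S_M S_B by auto
    show ?thesis
    proof (rule antisym)
      have "norm0 s \<le> r" using r by (intro norm0_le_M) auto
      then show "norm0 (s * a) \<le> r * norm0 a"
        using mult[OF sB a] mult_right_mono[OF _ norm0_nonneg] by (meson order_trans)
      show "r * norm0 a \<le> norm0 (s * a)"
      proof (rule dense_ge)
        fix u assume "norm0 (s * a) < u"
        then obtain s' r' q where *: "(s', r') \<in> S" "0 \<le> q" "s' * (s * a) \<in> M q" "q < u * r'"
          using norm0_lessD[OF mult_B[OF sB a]] by blast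
        have r': "0 < r'" using S_M[OF *(1)] by simp
        have "norm0 a \<le> q / (r' * r)"
          using * by (intro norm0_le[OF a S_mult[OF *(1) S]]) (auto simp: mult_ac)
        then have "norm0 a * (r' * r) \<le> q" using r r' by (simp add: pos_le_divide_eq)
          also have "q < u * r'" by (rule *)
          finally have "r' * (r * norm0 a) < r' * u" by (simp add: mult_ac)
          then show "r * norm0 a \<le> u" using r' by simp
      qed
    qed
  qed
  show ?thesis
    using one _ norm0_nonneg add mult scale by (rule seminormsI) (simp add: norm0_def)
qed

theorem multiplicative_seminorm:
  obtains w :: "'a \<Rightarrow> real" where "\<And>a. 0 \<le> w a"
    and "\<And>a b. a \<in> B \<Longrightarrow> b \<in> B \<Longrightarrow> w (a + b) \<le> max (w a) (w b)"
    and "\<And>a b. a \<in> B \<Longrightarrow> b \<in> B \<Longrightarrow> w (a * b) = w a * w b"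
    and "\<And>a q. 0 \<le> q \<Longrightarrow> a \<in> M q \<Longrightarrow> w a \<le> q"
    and "\<And>s r. (s, r) \<in> S \<Longrightarrow> w s = r"
proof -
  obtain w where w: "w \<in> seminorms" "w \<le> norm0" "\<forall>a\<in>B. \<forall>b\<in>B. w (a * b) = w a * w b"
    using multiplicative_seminorm_below[OF norm0_in_seminorms] by blast
  show ?thesis
  proof (rule that)
    show "w a \<le> q" if "0 \<le> q" "a \<in> M q" for a q
      using norm0_le_M[OF that] w(2) by (meson le_funD order_trans)
    show "w s = r" if "(s, r) \<in> S" for s r
      using seminormsD(6)[OF w(1) that one_B] seminormsD(1)[OF w(1)] by simp
  qed (use w seminormsD in auto)
qed

end

section \<open>Growth of complex sequences\<close>

text \<open>Index \<open>m\<close> receives a witness for the strictest condition known to be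
  solvable there, at level \<open>k m\<close>. The clause \<open>n \<le> m\<close> bounds the
  levels, so that a greatest one exists, and every fixed level is eventually surpassed.\<close>

lemma diagonal_choice:
  assumes ex: "\<And>n. \<forall>\<^sub>F m in sequentially. \<exists>z. Q n m z"
    and anti: "\<And>n m z. Q (Suc n) m z \<Longrightarrow> Q n m z"
  shows "\<exists>z. \<forall>n. \<forall>\<^sub>F m in sequentially. Q n m (z m)"
proof -
  have anti': "Q n m z" if "n \<le> n'" "Q n' m z" for n n' m z
    using that by (induction rule: dec_induct) (auto intro: anti)
  have "\<forall>n. \<exists>N. \<forall>m\<ge>N. \<exists>z. Q n m z"
    using ex by (simp add: eventually_sequentially)
  then obtain N where N: "\<And>n m. N n \<le> m \<Longrightarrow> \<exists>z. Q n m z" by metis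
  define k where "k m = (GREATEST n. n \<le> m \<and> N n \<le> m)" for m
  define z where "z m = (SOME z. Q (k m) m z)" for m
  have "\<forall>\<^sub>F m in sequentially. Q n m (z m)" for n
    using eventually_ge_at_top[of "max n (N n)"]
  proof eventually_elim
    case (elim m)
    then have nm: "n \<le> m \<and> N n \<le> m" by simp
    have km: "k m \<le> m \<and> N (k m) \<le> m"
      unfolding k_def using nm by (rule GreatestI_nat[where b = m]) auto
    have "n \<le> k m"
      unfolding k_def using nm by (rule Greatest_le_nat[where b = m]) auto
    moreover have "Q (k m) m (z m)"
      unfolding z_def using km by (intro someI_ex[OF N]) simp
    ultimately show ?case by (rule anti')
  qed
  then show ?thesis by (intro exI[of _ z] allI)
qed

lemma subsequence_choice:
  assumes "\<And>n::nat. \<exists>\<^sub>F m in sequentially. \<exists>z. Q n m z"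
  shows "\<exists>\<sigma> z. strict_mono (\<sigma> :: nat \<Rightarrow> nat) \<and> (\<forall>n. Q n (\<sigma> n) (z n))"
proof -
  have "\<exists>\<sigma>. \<forall>n. (\<exists>z. Q n (\<sigma> n) z) \<and> \<sigma> n < \<sigma> (Suc n)"
  proof (rule dependent_nat_choice)
    show "\<exists>m. \<exists>z. Q 0 m z" using assms[of 0] by (auto dest: frequently_ex)
    fix m n
    show "\<exists>m'. (\<exists>z. Q (Suc n) m' z) \<and> m < m'"
      using assms[of "Suc n"] unfolding frequently_sequentially
      by (metis Suc_le_lessD)
  qed
  then obtain \<sigma> where "\<forall>n. (\<exists>z. Q n (\<sigma> n) z) \<and> \<sigma> n < \<sigma> (Suc n)" by blast
  then show ?thesis
    by (intro exI[of _ \<sigma>] exI[of _ "\<lambda>n. SOME z. Q n (\<sigma> n) z"])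
      (auto simp: strict_mono_Suc_iff intro: someI_ex)
qed

locale growth =
  fixes t :: "nat \<Rightarrow> real"
  assumes t_pos: "0 < t m"
    and t_top: "filterlim t at_top sequentially"
begin

text \<open>The two conditions say that the upper, respectively the lower, limit of
  $|c_m|^{1/t_m}$ is at most, respectively at least, \<open>r\<close>.\<close>

definition gr :: "(nat \<Rightarrow> complex) \<Rightarrow> real \<Rightarrow> bool" where
  "gr c r \<longleftrightarrow> (\<forall>s>r. \<forall>\<^sub>F m in sequentially. cmod (c m) \<le> s powr t m)"

definition lower :: "(nat \<Rightarrow> complex) \<Rightarrow> real \<Rightarrow> bool" where
  "lower c r \<longleftrightarrow> (\<forall>s. 0 < s \<longrightarrow> s < r \<longrightarrow> (\<forall>\<^sub>F m in sequentially. s powr t m \<le> cmod (c m)))"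

text \<open>Precision up to the factor \<open>\<delta>\<close> for the root |c|^(1/t_m).\<close>

abbreviation near :: "real \<Rightarrow> real \<Rightarrow> nat \<Rightarrow> complex \<Rightarrow> bool" where
  "near \<delta> r m c \<equiv> (r / \<delta>) powr t m \<le> cmod c \<and> cmod c \<le> (r * \<delta>) powr t m"

lemma grD: "gr c r \<Longrightarrow> r < s \<Longrightarrow> \<forall>\<^sub>F m in sequentially. cmod (c m) \<le> s powr t m"
  by (simp add: gr_def)

lemma lowerD: "lower c r \<Longrightarrow> 0 < s \<Longrightarrow> s < r \<Longrightarrow> \<forall>\<^sub>F m in sequentially. s powr t m \<le> cmod (c m)"
  by (simp add: lower_def)

lemma powr_t_mono: "0 \<le> s \<Longrightarrow> s \<le> u \<Longrightarrow> s powr t m \<le> u powr t m"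
  using t_pos[of m] by (intro powr_mono2) auto

text \<open>The quotient (u/s)^(t_m) tends to infinity and absorbs any constant. Hence adding two
  sequences does not raise the growth rate, and the rate is ultrametric.\<close>

lemma powr_dominates:
  assumes s: "0 \<le> s" "s < u"
  shows "\<forall>\<^sub>F m in sequentially. C * s powr t m \<le> u powr t m"
proof (cases "s = 0")
  case False
  then have s0: "0 < s" "0 < u" using s by auto
  have "filterlim (\<lambda>m. t m * ln (u / s)) at_top sequentially"
    using s0 s t_top by (intro filterlim_at_top_mult_tendsto_pos[OF tendsto_const]) auto
  then have "\<forall>\<^sub>F m in sequentially. ln (max C 1) \<le> t m * ln (u / s)"
    by (simp add: filterlim_at_top)
  then show ?thesis
  proof eventually_elim
    case (elim m)
    have "C \<le> max C 1" by simp
    also have "\<dots> = exp (ln (max C 1))" by simp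
    also have "\<dots> \<le> exp (t m * ln (u / s))" using elim by (simp only: exp_le_cancel_iff)
    also have "\<dots> = u powr t m / s powr t m"
      using s0 by (simp add: powr_def ln_div algebra_simps exp_diff)
    finally show ?case using s0 by (simp add: pos_le_divide_eq)
  qed
qed auto

lemma gr_mono: "gr c r \<Longrightarrow> r \<le> q \<Longrightarrow> gr c q"
  by (auto simp: gr_def)

lemma gr_eventually_le:
  assumes "gr c r" "\<forall>\<^sub>F m in sequentially. cmod (d m) \<le> cmod (c m)"
  shows "gr d r"
  unfolding gr_def
proof (intro allI impI)
  fix s assume "r < s"
  show "\<forall>\<^sub>F m in sequentially. cmod (d m) \<le> s powr t m"
    using grD[OF assms(1) \<open>r < s\<close>] assms(2) by eventually_elim simp
qed

lemma gr_cong: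
  assumes "gr c r" "\<forall>\<^sub>F m in sequentially. d m = c m"
  shows "gr d r"
  using assms(1) by (rule gr_eventually_le) (use assms(2) in eventually_elim, simp)

lemma gr_zero: "0 \<le> r \<Longrightarrow> gr (\<lambda>m. 0) r"
  by (auto simp: gr_def)

lemma gr_eventually_zero: "\<forall>\<^sub>F m in sequentially. c m = 0 \<Longrightarrow> 0 \<le> r \<Longrightarrow> gr c r"
  by (rule gr_cong[OF gr_zero])

lemma gr_add:
  assumes r: "0 \<le> r" and c: "gr c r" and d: "gr d r"
  shows "gr (\<lambda>m. c m + d m) r"
  unfolding gr_def
proof (intro allI impI)
  fix s assume "r < s"
  then obtain u where u: "r < u" "u < s" using dense by blast
  have "\<forall>\<^sub>F m in sequentially. 2 * u powr t m \<le> s powr t m"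
    using u r by (intro powr_dominates) auto
  with grD[OF c u(1)] grD[OF d u(1)]
  show "\<forall>\<^sub>F m in sequentially. cmod (c m + d m) \<le> s powr t m"
  proof eventually_elim
    case (elim m)
    then show ?case using norm_triangle_ineq[of "c m" "d m"] by linarith
  qed
qed

lemma gr_minus: "gr c r \<Longrightarrow> gr (\<lambda>m. - c m) r"
  by (simp add: gr_def)

lemma product_gap:
  fixes r q s :: real
  assumes "r * q < s"
  obtains r' q' where "r < r'" "q < q'" "r' * q' < s"
  using le_mult_of_less[of r q s] assms by (meson not_le)

lemma gr_mult:
  assumes "0 \<le> r" "0 \<le> q" and c: "gr c r" and d: "gr d q"
  shows "gr (\<lambda>m. c m * d m) (r * q)"
  unfolding gr_def
proof (intro allI impI)
  fix s assume "r * q < s"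
  then obtain r' q' where *: "r < r'" "q < q'" "r' * q' < s"
    using product_gap assms by blast
  show "\<forall>\<^sub>F m in sequentially. cmod (c m * d m) \<le> s powr t m"
    using grD[OF c *(1)] grD[OF d *(2)]
  proof eventually_elim
    case (elim m)
    have "cmod (c m * d m) \<le> r' powr t m * q' powr t m"
      unfolding norm_mult using elim by (intro mult_mono) auto
    also have "\<dots> = (r' * q') powr t m" using * assms by (simp add: powr_mult)
    also have "\<dots> \<le> s powr t m" using * assms by (intro powr_t_mono) auto
    finally show ?case .
  qed
qed

lemma gr_const: "gr (\<lambda>m. c) 1"
  unfolding gr_def
proof (intro allI impI)
  fix s :: real assume "1 < s"
  then show "\<forall>\<^sub>F m in sequentially. cmod c \<le> s powr t m"
    using powr_dominates[of 1 s "cmod c"] by simp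
qed

lemma gr_bounded: "(\<And>m. cmod (c m) \<le> 1) \<Longrightarrow> gr c 1"
  using gr_eventually_le[OF gr_const[of 1], of c] by simp

lemma lower_const:
  assumes "c \<noteq> 0"
  shows "lower (\<lambda>m. c) 1"
  unfolding lower_def
proof (intro allI impI)
  fix s :: real assume "0 < s" "s < 1"
  have "\<forall>\<^sub>F m in sequentially. (1 / cmod c) * s powr t m \<le> 1 powr t m"
    using \<open>0 < s\<close> \<open>s < 1\<close> by (intro powr_dominates) auto
  then show "\<forall>\<^sub>F m in sequentially. s powr t m \<le> cmod c"
    by eventually_elim (use assms in \<open>simp add: field_simps\<close>)
qed

lemma gr_powr: "0 \<le> r \<Longrightarrow> gr (\<lambda>m. of_real (r powr t m)) r"
  unfolding gr_def by (auto intro!: always_eventually powr_t_mono)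

lemma lower_powr: "lower (\<lambda>m. of_real (r powr t m)) r"
  unfolding lower_def by (auto intro!: always_eventually powr_t_mono)

lemma lower_nonzero:
  assumes "lower c r" "0 < r"
  shows "\<forall>\<^sub>F m in sequentially. c m \<noteq> 0"
proof -
  have "\<forall>\<^sub>F m in sequentially. (r / 2) powr t m \<le> cmod (c m)"
    using assms by (intro lowerD) auto
  then show ?thesis
  proof eventually_elim
    case (elim m)
    have "0 < (r / 2) powr t m" using assms by simp
    with elim show ?case by auto
  qed
qed

lemma lower_le_gr:
  assumes l: "lower c r" and g: "gr c q" and q: "0 \<le> q"
  shows "r \<le> q"
proof (rule ccontr)
  assume "\<not> r \<le> q"
  then obtain u where u: "q < u" "u < r" by (meson dense not_le)
  obtain s where s: "q < s" "s < u" using dense u by blast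
  have "\<forall>\<^sub>F m in sequentially. 2 * s powr t m \<le> u powr t m"
    using s q by (intro powr_dominates) auto
  moreover have "\<forall>\<^sub>F m in sequentially. u powr t m \<le> cmod (c m)"
    using u s q by (intro lowerD[OF l]) auto
  ultimately have "\<forall>\<^sub>F m in sequentially. False"
    using grD[OF g s(1)]
  proof eventually_elim
    case (elim m)
    have "0 < s powr t m" using s q by simp
    with elim show ?case by linarith
  qed
  then show False by simp
qed

lemma gr_divide:
  assumes l: "lower a r" and r: "0 < r" and q: "0 \<le> q" and g: "gr (\<lambda>m. a m * c m) q"
  shows "gr c (q / r)"
  unfolding gr_def
proof (intro allI impI)
  fix s assume s: "q / r < s"
  then have s0: "0 < s" using q r by (meson divide_nonneg_pos le_less_trans)
  have "q / s < r" using s r s0 by (simp add: field_simps)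
  then obtain r' where r': "q / s < r'" "r' < r" using dense by blast
  have r'0: "0 < r'" using r' q s0 by (meson divide_nonneg_pos le_less_trans)
  have "q < r' * s" using r' s0 by (simp add: field_simps)
  show "\<forall>\<^sub>F m in sequentially. cmod (c m) \<le> s powr t m"
    using grD[OF g \<open>q < r' * s\<close>] lowerD[OF l r'0 r'(2)]
  proof eventually_elim
    case (elim m)
    have "r' powr t m * cmod (c m) \<le> cmod (a m) * cmod (c m)"
      using elim by (intro mult_right_mono) auto
    also have "\<dots> \<le> r' powr t m * s powr t m"
      using elim r'0 s0 by (simp add: norm_mult powr_mult)
    finally show ?case using r'0 by simp
  qed
qed

lemma lower_perturb:
  assumes l: "lower c r" and g: "gr d q" and q: "0 \<le> q" "q < r"
  shows "lower (\<lambda>m. c m + d m) r"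
  unfolding lower_def
proof (intro allI impI)
  fix s assume s: "0 < s" "s < r"
  \<comment> \<open>A base at least \<open>s\<close> and above \<open>q\<close>, but still below
    \<open>r\<close>.\<close>
  define s' where "s' = max s ((q + r) / 2)"
  have s': "s \<le> s'" "q < s'" "s' < r" "0 < s'"
    using s q by (auto simp: s'_def less_max_iff_disj)
  obtain u where u: "s' < u" "u < r" using dense s' by blast
  have "\<forall>\<^sub>F m in sequentially. 2 * s' powr t m \<le> u powr t m"
    using s' u by (intro powr_dominates) auto
  moreover have "\<forall>\<^sub>F m in sequentially. u powr t m \<le> cmod (c m)"
    using u s' by (intro lowerD[OF l]) auto
  moreover note grD[OF g s'(2)]
  ultimately show "\<forall>\<^sub>F m in sequentially. s powr t m \<le> cmod (c m + d m)"
  proof eventually_elim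
    case (elim m)
    have "s powr t m \<le> s' powr t m" using s s' by (intro powr_t_mono) auto
    moreover have "cmod (c m) \<le> cmod (c m + d m) + cmod (d m)"
      by (metis add_diff_cancel_right' norm_triangle_ineq4)
    ultimately show ?case using elim by linarith
  qed
qed

end

section \<open>Extending a functional along a valuation\<close>

text \<open>One variable \<open>Y\<close> is adjoined. \<open>e m\<close> evaluates the coefficient
  ring \<open>R\<close> at the m-th point found so far, and \<open>W\<close> is the valuation of
  polynomials in \<open>Y\<close> over \<open>R\<close>, possibly with a kernel. On constants the
  value is both an upper and a lower growth rate of the evaluations, and value 0 means exact
  vanishing at every index.\<close>

locale tower_step = growth t for t :: "nat \<Rightarrow> real" +
  fixes R :: "'a::comm_ring_1 set" and e :: "nat \<Rightarrow> 'a \<Rightarrow> complex" and W :: "'a poly \<Rightarrow> real"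
  assumes R_countable: "countable R"
    and R_0: "0 \<in> R" and R_1: "1 \<in> R"
    and R_add: "a \<in> R \<Longrightarrow> b \<in> R \<Longrightarrow> a + b \<in> R"
    and R_mult: "a \<in> R \<Longrightarrow> b \<in> R \<Longrightarrow> a * b \<in> R"
    and R_uminus: "a \<in> R \<Longrightarrow> - a \<in> R"
    and e_0: "e m 0 = 0" and e_1: "e m 1 = 1"
    and e_add: "a \<in> R \<Longrightarrow> b \<in> R \<Longrightarrow> e m (a + b) = e m a + e m b"
    and e_mult: "a \<in> R \<Longrightarrow> b \<in> R \<Longrightarrow> e m (a * b) = e m a * e m b"
    and W_nonneg: "0 \<le> W g" and W_0: "W 0 = 0" and W_1: "W 1 = 1"
    and W_add': "\<forall>i. coeff g i \<in> R \<Longrightarrow> \<forall>i. coeff h i \<in> R \<Longrightarrow> W (g + h) \<le> max (W g) (W h)"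
    and W_mult': "\<forall>i. coeff g i \<in> R \<Longrightarrow> \<forall>i. coeff h i \<in> R \<Longrightarrow> W (g * h) = W g * W h"
    and e_gr: "a \<in> R \<Longrightarrow> gr (\<lambda>m. e m a) (W [:a:])"
    and e_lower: "a \<in> R \<Longrightarrow> lower (\<lambda>m. e m a) (W [:a:])"
    and e_null: "a \<in> R \<Longrightarrow> W [:a:] = 0 \<Longrightarrow> e m a = 0"
begin

definition RP :: "'a poly set" where "RP = {g. \<forall>i. coeff g i \<in> R}"

lemma RP_coeff: "g \<in> RP \<Longrightarrow> coeff g i \<in> R" by (simp add: RP_def)

lemma R_sum: "(\<And>i. i \<in> F \<Longrightarrow> f i \<in> R) \<Longrightarrow> sum f F \<in> R"
  by (induction F rule: infinite_finite_induct) (auto intro: R_0 R_add)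

lemma R_diff: "a \<in> R \<Longrightarrow> b \<in> R \<Longrightarrow> a - b \<in> R"
  using R_add[of a "- b"] R_uminus[of b] by simp

lemma R_power: "a \<in> R \<Longrightarrow> a ^ n \<in> R"
  by (induction n) (auto intro: R_1 R_mult)

lemma e_uminus: "a \<in> R \<Longrightarrow> e m (- a) = - e m a"
  using e_add[of a "- a" m] R_uminus[of a] e_0[of m] by (simp add: eq_neg_iff_add_eq_0 add.commute)

lemma e_diff: "a \<in> R \<Longrightarrow> b \<in> R \<Longrightarrow> e m (a - b) = e m a - e m b"
  using e_add[of a "- b" m] R_uminus[of b] e_uminus[of b m] by simp

lemma e_power: "a \<in> R \<Longrightarrow> e m (a ^ n) = e m a ^ n"
  by (induction n) (auto simp: e_1 e_mult R_power)

lemma e_sum: "(\<And>i. i \<in> F \<Longrightarrow> f i \<in> R) \<Longrightarrow> e m (sum f F) = (\<Sum>i\<in>F. e m (f i))"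
  by (induction F rule: infinite_finite_induct) (auto simp: e_0 e_add R_sum)

lemma RP_0: "0 \<in> RP" and RP_1: "1 \<in> RP"
  by (auto simp: RP_def R_0 R_1 coeff_1)

lemma RP_add: "g \<in> RP \<Longrightarrow> h \<in> RP \<Longrightarrow> g + h \<in> RP"
  by (auto simp: RP_def R_add)

lemma RP_uminus: "g \<in> RP \<Longrightarrow> - g \<in> RP"
  by (auto simp: RP_def R_uminus)

lemma RP_diff: "g \<in> RP \<Longrightarrow> h \<in> RP \<Longrightarrow> g - h \<in> RP"
  by (auto simp: RP_def R_diff)

lemma RP_mult: "g \<in> RP \<Longrightarrow> h \<in> RP \<Longrightarrow> g * h \<in> RP"
  by (auto simp: RP_def coeff_mult intro!: R_sum R_mult)

lemma RP_smult: "a \<in> R \<Longrightarrow> g \<in> RP \<Longrightarrow> smult a g \<in> RP"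
  by (auto simp: RP_def R_mult)

lemma RP_monom: "a \<in> R \<Longrightarrow> monom a n \<in> RP"
  by (auto simp: RP_def R_0)

lemma RP_const: "a \<in> R \<Longrightarrow> [:a:] \<in> RP"
  using RP_monom[of a 0] by (simp add: monom_0)

lemma RP_X: "[:0, 1:] \<in> RP"
  using RP_monom[OF R_1, of 1] by (simp add: monom_Suc monom_0)

lemma RP_pCons_iff: "pCons a p \<in> RP \<longleftrightarrow> a \<in> R \<and> p \<in> RP"
  by (auto simp: RP_def coeff_pCons split: nat.splits)

lemma RP_countable: "countable RP"
proof -
  have "RP \<subseteq> Poly ` lists R"
  proof
    fix g assume g: "g \<in> RP"
    have "coeffs g \<in> lists R"
      using RP_coeff[OF g] by (auto simp: coeffs_def)
    then show "g \<in> Poly ` lists R" by (intro image_eqI[of _ _ "coeffs g"]) auto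
  qed
  then show ?thesis using R_countable by (meson countable_image countable_lists countable_subset)
qed

lemma W_add: "g \<in> RP \<Longrightarrow> h \<in> RP \<Longrightarrow> W (g + h) \<le> max (W g) (W h)"
  using W_add' by (simp add: RP_def)

lemma W_mult: "g \<in> RP \<Longrightarrow> h \<in> RP \<Longrightarrow> W (g * h) = W g * W h"
  using W_mult' by (simp add: RP_def)

lemma W_minus1: "W (- 1) = 1"
proof -
  have "W (- 1) * W (- 1) = 1"
    using W_mult[OF RP_uminus[OF RP_1] RP_uminus[OF RP_1]] W_1 by simp
  then have "(W (- 1))\<^sup>2 = 1" by (simp add: power2_eq_square)
  then show ?thesis using W_nonneg[of "- 1"] by (simp add: power2_eq_1_iff)
qed

lemma W_uminus: "g \<in> RP \<Longrightarrow> W (- g) = W g"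
  using W_mult[OF RP_uminus[OF RP_1], of g] W_minus1 by simp

lemma W_diff: "g \<in> RP \<Longrightarrow> h \<in> RP \<Longrightarrow> W (g - h) \<le> max (W g) (W h)"
  using W_add[of g "- h"] RP_uminus[of h] W_uminus[of h] by simp

lemma W_smult: "a \<in> R \<Longrightarrow> g \<in> RP \<Longrightarrow> W (smult a g) = W [:a:] * W g"
  using W_mult[OF RP_const, of a g] by simp

lemma W_power: "g \<in> RP \<Longrightarrow> g ^ n \<in> RP \<and> W (g ^ n) = W g ^ n"
  by (induction n) (auto simp: W_1 W_mult RP_1 RP_mult)

lemma W_eq_0I:
  assumes "g \<in> RP" "\<And>i. W [:coeff g i:] = 0"
  shows "W g = 0"
  using assms
proof (induction g)
  case (pCons a p)
  then have a: "a \<in> R" and p: "p \<in> RP" by (auto simp: RP_pCons_iff)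
  have eq: "pCons a p = [:a:] + [:0, 1:] * p" by simp
  have "W (pCons a p) \<le> max (W [:a:]) (W ([:0, 1:] * p))"
    unfolding eq by (intro W_add RP_const RP_mult RP_X a p)
  also have "W [:a:] = 0" using pCons.prems(2)[of 0] by simp
  also have "W p = 0"
    using pCons.IH[OF p] pCons.prems(2)[of "Suc i" for i] by simp
  then have "W ([:0, 1:] * p) = 0" using W_mult[OF RP_X p] by simp
  finally show ?case using W_nonneg[of "pCons a p"] by simp
qed (simp add: W_0)

definition \<phi> :: "nat \<Rightarrow> 'a poly \<Rightarrow> complex poly" where "\<phi> m g = map_poly (e m) g"

lemma coeff_\<phi> [simp]: "coeff (\<phi> m g) i = e m (coeff g i)"
  by (simp add: \<phi>_def coeff_map_poly e_0)

lemma \<phi>_0 [simp]: "\<phi> m 0 = 0" by (simp add: poly_eq_iff e_0)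

lemma \<phi>_1 [simp]: "\<phi> m 1 = 1" by (simp add: poly_eq_iff coeff_1 e_0 e_1)

lemma \<phi>_const: "\<phi> m [:a:] = [:e m a:]"
  by (auto simp: poly_eq_iff coeff_pCons e_0 split: nat.splits)

lemma \<phi>_X: "\<phi> m [:0, 1:] = [:0, 1:]"
  by (auto simp: poly_eq_iff coeff_pCons e_0 e_1 split: nat.splits)

lemma \<phi>_add: "g \<in> RP \<Longrightarrow> h \<in> RP \<Longrightarrow> \<phi> m (g + h) = \<phi> m g + \<phi> m h"
  by (simp add: poly_eq_iff e_add RP_coeff)

lemma \<phi>_diff: "g \<in> RP \<Longrightarrow> h \<in> RP \<Longrightarrow> \<phi> m (g - h) = \<phi> m g - \<phi> m h"
  by (simp add: poly_eq_iff e_diff RP_coeff)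

lemma \<phi>_mult: "g \<in> RP \<Longrightarrow> h \<in> RP \<Longrightarrow> \<phi> m (g * h) = \<phi> m g * \<phi> m h"
  by (simp add: poly_eq_iff coeff_mult e_sum e_mult R_mult RP_coeff)

lemma \<phi>_smult: "a \<in> R \<Longrightarrow> g \<in> RP \<Longrightarrow> \<phi> m (smult a g) = smult (e m a) (\<phi> m g)"
  by (simp add: poly_eq_iff e_mult RP_coeff)

text \<open>Stage \<open>n\<close> of a Hahn--Banach extension: \<open>l i\<close> is the value at $Y^i$ of a functional of norm
  at most one sending \<open>G\<close> to the sequence \<open>\<sigma>\<close>, defined so far on the span of \<open>G\<close> and
  $1, \dots, Y^{n-1}$.\<close>

definition stage :: "'a poly \<Rightarrow> (nat \<Rightarrow> complex) \<Rightarrow> nat \<Rightarrow> (nat \<Rightarrow> nat \<Rightarrow> complex) \<Rightarrow> bool" where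
  "stage G \<sigma> n l \<longleftrightarrow> (\<forall>c\<in>R. \<forall>h\<in>RP. (\<forall>i\<ge>n. coeff h i = 0) \<longrightarrow>
     gr (\<lambda>m. e m c * \<sigma> m + (\<Sum>i<n. e m (coeff h i) * l i m)) (W (smult c G + h)))"

lemma stageD: "stage G \<sigma> n l \<Longrightarrow> c \<in> R \<Longrightarrow> h \<in> RP \<Longrightarrow> (\<And>i. n \<le> i \<Longrightarrow> coeff h i = 0) \<Longrightarrow>
    gr (\<lambda>m. e m c * \<sigma> m + (\<Sum>i<n. e m (coeff h i) * l i m)) (W (smult c G + h))"
  by (simp add: stage_def)

text \<open>Each triple of \<open>T\<close> asks that the new value \<open>z\<close>, at Y^n, lie in
  a ball with centre \<open>- A \<tau> m / e m (b \<tau>)\<close> and radius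
  \<open>W (E \<tau>) / W [:b \<tau>:]\<close>, distances being growth rates. Any two of these balls
  meet by the bound at stage \<open>n\<close>; finitely many then share the centre of the smallest
  one, the distance being ultrametric. The intersection of countably many is reached by a diagonal
  sequence.\<close>

lemma stage_Suc:
  assumes G: "G \<in> RP" and l: "stage G \<sigma> n l"
  shows "\<exists>l'. stage G \<sigma> (Suc n) l'"
proof -
  define T where "T = {(c, h, b). c \<in> R \<and> h \<in> RP \<and> (\<forall>i\<ge>n. coeff h i = 0) \<and> b \<in> R \<and> 0 < W [:b:]}"
  define E where "E = (\<lambda>(c, h, b). smult c G + h + monom b n)"
  define A where "A = (\<lambda>(c, h, b :: 'a) m. e m c * \<sigma> m + (\<Sum>i<n. e m (coeff h i) * l i m))"
  define b where "b = (\<lambda>(c :: 'a, h :: 'a poly, b :: 'a). b)"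
  have ERP: "E \<tau> \<in> RP" if "\<tau> \<in> T" for \<tau>
    using that G by (auto simp: T_def E_def intro!: RP_add RP_smult RP_monom)
  have bR: "b \<tau> \<in> R" "0 < W [:b \<tau>:]" if "\<tau> \<in> T" for \<tau>
    using that by (auto simp: T_def b_def)
  \<comment> \<open>Cross-multiplying by \<open>b \<tau>0\<close> and \<open>b \<tau>\<close>
    cancels the monomial in Y^n, so that stage \<open>n\<close> applies to the difference.\<close>
  have pair: "gr (\<lambda>m. e m (b \<tau>0) * A \<tau> m - e m (b \<tau>) * A \<tau>0 m) (W (smult (b \<tau>0) (E \<tau>) - smult (b \<tau>) (E \<tau>0)))"
    if "\<tau> \<in> T" "\<tau>0 \<in> T" for \<tau> \<tau>0
  proof -
    obtain c h d where \<tau>: "\<tau> = (c, h, d)" by (metis prod_cases3)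
    obtain c0 h0 d0 where \<tau>0: "\<tau>0 = (c0, h0, d0)" by (metis prod_cases3)
    have *: "c \<in> R" "h \<in> RP" "d \<in> R" "c0 \<in> R" "h0 \<in> RP" "d0 \<in> R"
      "\<forall>i\<ge>n. coeff h i = 0" "\<forall>i\<ge>n. coeff h0 i = 0" using that by (auto simp: T_def \<tau> \<tau>0)
    have eq: "smult (b \<tau>0) (E \<tau>) - smult (b \<tau>) (E \<tau>0) =
        smult (d0 * c - d * c0) G + (smult d0 h - smult d h0)"
      by (simp add: E_def b_def \<tau> \<tau>0 poly_eq_iff algebra_simps)
    have "gr (\<lambda>m. e m (d0 * c - d * c0) * \<sigma> m + (\<Sum>i<n. e m (coeff (smult d0 h - smult d h0) i) * l i m))
        (W (smult (d0 * c - d * c0) G + (smult d0 h - smult d h0)))"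
      using * by (intro stageD[OF l] R_diff R_mult RP_diff RP_smult) auto
    moreover have "e m (d0 * c - d * c0) * \<sigma> m + (\<Sum>i<n. e m (coeff (smult d0 h - smult d h0) i) * l i m)
        = e m (b \<tau>0) * A \<tau> m - e m (b \<tau>) * A \<tau>0 m" for m
      using * by (simp add: A_def b_def \<tau> \<tau>0 e_diff e_mult R_mult RP_coeff algebra_simps
          sum_distrib_left sum_subtractf)
    ultimately show ?thesis by (simp add: eq)
  qed
  have finite_case: "\<exists>z. \<forall>\<tau>\<in>F. gr (\<lambda>m. A \<tau> m + e m (b \<tau>) * z m) (W (E \<tau>))"
    if F: "finite F" "F \<subseteq> T" for F
  proof (cases "F = {}")
    case False
    \<comment> \<open>The ball of least radius; its centre will be the common point.\<close>
    define \<tau>0 where "\<tau>0 = arg_min_on (\<lambda>\<tau>. W (E \<tau>) / W [:b \<tau>:]) F"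
    have \<tau>0: "\<tau>0 \<in> F" unfolding \<tau>0_def using F False by (intro arg_min_if_finite(1))
    then have \<tau>0T: "\<tau>0 \<in> T" using F by blast
    define z where "z m = - A \<tau>0 m / e m (b \<tau>0)" for m
    have nz: "\<forall>\<^sub>F m in sequentially. e m (b \<tau>0) \<noteq> 0"
      using bR[OF \<tau>0T] e_lower by (intro lower_nonzero) auto
    have "gr (\<lambda>m. A \<tau> m + e m (b \<tau>) * z m) (W (E \<tau>))" if "\<tau> \<in> F" for \<tau>
    proof -
      have \<tau>: "\<tau> \<in> T" using that F by blast
      have "W (E \<tau>0) / W [:b \<tau>0:] \<le> W (E \<tau>) / W [:b \<tau>:]"
        unfolding \<tau>0_def using F False that by (intro arg_min_least)
      then have le: "W [:b \<tau>:] * W (E \<tau>0) \<le> W [:b \<tau>0:] * W (E \<tau>)"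
        using bR[OF \<tau>] bR[OF \<tau>0T] by (simp add: field_simps)
      have "W (smult (b \<tau>0) (E \<tau>) - smult (b \<tau>) (E \<tau>0)) \<le>
          max (W (smult (b \<tau>0) (E \<tau>))) (W (smult (b \<tau>) (E \<tau>0)))"
        using \<tau> \<tau>0T by (intro W_diff RP_smult ERP bR)
      also have "\<dots> = W [:b \<tau>0:] * W (E \<tau>)"
        using le \<tau> \<tau>0T by (simp add: W_smult ERP bR)
      finally have "gr (\<lambda>m. e m (b \<tau>0) * A \<tau> m - e m (b \<tau>) * A \<tau>0 m) (W [:b \<tau>0:] * W (E \<tau>))"
        using gr_mono pair \<tau> \<tau>0T by blast
      then have "gr (\<lambda>m. e m (b \<tau>0) * (A \<tau> m + e m (b \<tau>) * z m)) (W [:b \<tau>0:] * W (E \<tau>))"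
        by (rule gr_cong) (use nz in eventually_elim, simp add: z_def field_simps)
      then have "gr (\<lambda>m. A \<tau> m + e m (b \<tau>) * z m) (W [:b \<tau>0:] * W (E \<tau>) / W [:b \<tau>0:])"
        using bR[OF \<tau>0T] W_nonneg by (intro gr_divide[OF e_lower]) auto
      then show ?thesis using bR[OF \<tau>0T] by simp
    qed
    then show ?thesis by blast
  qed auto
  have "(0, 0, 1) \<in> T" by (auto simp: T_def R_0 R_1 RP_0 W_1 one_pCons[symmetric])
  then have Tne: "T \<noteq> {}" by blast
  have "T \<subseteq> R \<times> RP \<times> R" by (auto simp: T_def)
  then have Tc: "countable T"
    using R_countable RP_countable by (meson countable_SIGMA countable_subset)
  define \<tau> where "\<tau> = from_nat_into T"
  have \<tau>T: "\<tau> i \<in> T" for i unfolding \<tau>_def by (intro from_nat_into Tne)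
  \<comment> \<open>At level \<open>n\<close> the first \<open>n + 1\<close> constraints are
    required, with slack \<open>1 / real (Suc n)\<close>; both tighten with \<open>n\<close>, as the
    diagonal choice demands.\<close>
  define Q where "Q n m z \<longleftrightarrow> (\<forall>i\<le>n. cmod (A (\<tau> i) m + e m (b (\<tau> i)) * z) \<le>
      (W (E (\<tau> i)) + 1 / real (Suc n)) powr t m)" for n m z
  have "\<exists>z. \<forall>n. \<forall>\<^sub>F m in sequentially. Q n m (z m)"
  proof (rule diagonal_choice)
    fix n
    obtain z where z: "\<forall>\<tau>\<in>\<tau> ` {..n}. gr (\<lambda>m. A \<tau> m + e m (b \<tau>) * z m) (W (E \<tau>))"
      using finite_case[of "\<tau> ` {..n}"] \<tau>T by auto
    have "\<forall>\<^sub>F m in sequentially. \<forall>i\<in>{..n}.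
        cmod (A (\<tau> i) m + e m (b (\<tau> i)) * z m) \<le> (W (E (\<tau> i)) + 1 / real (Suc n)) powr t m"
      by (intro eventually_ball_finite) (use z in \<open>auto intro!: grD\<close>)
    then show "\<forall>\<^sub>F m in sequentially. \<exists>z. Q n m z"
      by eventually_elim (auto simp: Q_def)
  next
    fix n m z assume Q: "Q (Suc n) m z"
    show "Q n m z"
      unfolding Q_def
    proof (intro allI impI)
      fix i assume "i \<le> n"
      then have "cmod (A (\<tau> i) m + e m (b (\<tau> i)) * z) \<le> (W (E (\<tau> i)) + 1 / real (Suc (Suc n))) powr t m"
        using Q by (simp add: Q_def)
      also have "\<dots> \<le> (W (E (\<tau> i)) + 1 / real (Suc n)) powr t m"
        using W_nonneg by (intro powr_t_mono add_nonneg_nonneg add_left_mono divide_left_mono) auto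
      finally show "cmod (A (\<tau> i) m + e m (b (\<tau> i)) * z) \<le> (W (E (\<tau> i)) + 1 / real (Suc n)) powr t m" .
    qed
  qed
  then obtain z where z: "\<And>n. \<forall>\<^sub>F m in sequentially. Q n m (z m)" by blast
  have zT: "gr (\<lambda>m. A x m + e m (b x) * z m) (W (E x))" if xT: "x \<in> T" for x
    unfolding gr_def
  proof (intro allI impI)
    fix s assume s: "W (E x) < s"
    obtain i where i: "\<tau> i = x"
      unfolding \<tau>_def using from_nat_into_surj[OF Tc xT] by blast
    obtain n where n: "1 / real (Suc n) < s - W (E x)"
      using s nat_approx_posE[of "s - W (E x)"] by auto
    show "\<forall>\<^sub>F m in sequentially. cmod (A x m + e m (b x) * z m) \<le> s powr t m"
      using z[of "max i n"]
    proof eventually_elim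
      case (elim m)
      then have "cmod (A x m + e m (b x) * z m) \<le> (W (E x) + 1 / real (Suc (max i n))) powr t m"
        using i by (auto simp: Q_def)
      also have "\<dots> \<le> s powr t m"
      proof (intro powr_t_mono)
        have "1 / real (Suc (max i n)) \<le> 1 / real (Suc n)" by (intro divide_left_mono) auto
        then show "W (E x) + 1 / real (Suc (max i n)) \<le> s" using n by linarith
      qed (use W_nonneg in auto)
      finally show ?case .
    qed
  qed
  have "stage G \<sigma> (Suc n) (l(n := z))"
    unfolding stage_def
  proof (intro ballI impI)
    fix c h assume c: "c \<in> R" and h: "h \<in> RP" "\<forall>i\<ge>Suc n. coeff h i = 0"
    define d where "d = coeff h n"
    define h' where "h' = h - monom d n"
    have d: "d \<in> R" using h by (simp add: d_def RP_coeff)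
    have h': "h' \<in> RP" "\<forall>i\<ge>n. coeff h' i = 0"
      using h d by (auto simp: h'_def d_def intro!: RP_diff RP_monom)
    have hh: "h = h' + monom d n" by (simp add: h'_def)
    have sum_eq: "(\<Sum>i<Suc n. e m (coeff h i) * (l(n := z)) i m) =
        (\<Sum>i<n. e m (coeff h' i) * l i m) + e m d * z m" for m
      by (simp add: h'_def d_def)
    show "gr (\<lambda>m. e m c * \<sigma> m + (\<Sum>i<Suc n. e m (coeff h i) * (l(n := z)) i m)) (W (smult c G + h))"
    proof (cases "W [:d:] = 0")
      case False
      then have "(c, h', d) \<in> T" using c d h' W_nonneg[of "[:d:]"] by (auto simp: T_def)
      from zT[OF this] show ?thesis
        unfolding sum_eq by (simp add: A_def E_def b_def hh add.assoc)
    next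
      \<comment> \<open>A coefficient of value 0 puts no condition on \<open>z\<close>, since
        \<open>e m d = 0\<close>; and removing its monomial does not increase the value of the
        polynomial.\<close>
      case True
      have m0: "W (monom d n) = 0"
      proof -
        have "monom d n = smult d ([:0, 1:] ^ n)" by (simp add: monom_altdef)
        then show ?thesis using True d W_power[OF RP_X, of n] by (simp add: W_smult)
      qed
      have h1: "smult c G + h' = (smult c G + h) - monom d n" by (simp add: hh)
      have "W (smult c G + h') \<le> max (W (smult c G + h)) (W (monom d n))"
        unfolding h1 using c G h d by (intro W_diff RP_add RP_smult RP_monom)
      also have "\<dots> = W (smult c G + h)" using m0 W_nonneg by simp
      finally have "W (smult c G + h') \<le> W (smult c G + h)" .
      moreover have "gr (\<lambda>m. e m c * \<sigma> m + (\<Sum>i<n. e m (coeff h' i) * l i m)) (W (smult c G + h'))"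
        using c h' by (intro stageD[OF l]) auto
      ultimately show ?thesis
        unfolding sum_eq using e_null[OF d True] gr_mono by simp
    qed
  qed
  then show ?thesis by blast
qed

text \<open>The image of \<open>G\<close> is given the growth rate \<open>W G\<close> exactly. At
  stage 0 only the multiples of \<open>G\<close> have to be bounded, which multiplicativity of
  \<open>W\<close> on constants does.\<close>

lemma stage_exists:
  assumes G: "G \<in> RP"
  shows "\<exists>l. stage G (\<lambda>m. of_real (W G powr t m)) n l"
proof (induction n)
  case 0
  have "stage G (\<lambda>m. of_real (W G powr t m)) 0 l" for l
    unfolding stage_def
  proof (intro ballI impI)
    fix c h assume c: "c \<in> R" and "h \<in> RP" "\<forall>i\<ge>0. coeff h i = 0"
    then have "h = 0" by (simp add: poly_eq_iff)
    moreover have "gr (\<lambda>m. e m c * of_real (W G powr t m)) (W [:c:] * W G)"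
      by (intro gr_mult e_gr c gr_powr W_nonneg)
    ultimately show "gr (\<lambda>m. e m c * of_real (W G powr t m) +
        (\<Sum>i<0. e m (coeff h i) * l i m)) (W (smult c G + h))"
      using W_smult[OF c G] by simp
  qed
  then show ?case by blast
next
  case (Suc n)
  then show ?case using stage_Suc[OF G] by blast
qed

text \<open>The ball of radius \<open>q\<close> in the tensor product of sequences of finite growth
  with the polynomials over \<open>R\<close>, taken as its image among sequences of complex
  polynomials. A sum belongs to it as soon as the product of the values is at most \<open>q\<close>
  in every term, as for the ultrametric tensor norm.\<close>

inductive_set span :: "real \<Rightarrow> (nat \<Rightarrow> complex poly) set" for q where
  span_zero: "(\<lambda>m. 0) \<in> span q"
| span_add: "h \<in> span q \<Longrightarrow> gr c r \<Longrightarrow> 0 \<le> r \<Longrightarrow> g \<in> RP \<Longrightarrow> r * W g \<le> q \<Longrightarrow>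
    (\<lambda>m. h m + smult (c m) (\<phi> m g)) \<in> span q"

lemma span_term: "gr c r \<Longrightarrow> 0 \<le> r \<Longrightarrow> g \<in> RP \<Longrightarrow> r * W g \<le> q \<Longrightarrow> (\<lambda>m. smult (c m) (\<phi> m g)) \<in> span q"
  using span_add[OF span_zero, of c r g q] by simp

lemma span_mono: "h \<in> span q \<Longrightarrow> q \<le> q' \<Longrightarrow> h \<in> span q'"
  by (induction rule: span.induct) (auto intro: span.intros)

lemma span_plus: "h' \<in> span q \<Longrightarrow> h \<in> span q \<Longrightarrow> (\<lambda>m. h m + h' m) \<in> span q"
proof (induction rule: span.induct)
  case (span_add h' c r g)
  then show ?case using span.span_add[of "\<lambda>m. h m + h' m" q c r g] by (simp add: add.assoc)
qed simp

lemma span_term_mult: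
  assumes h: "h \<in> span q" and c: "gr c r" "0 \<le> r" "g \<in> RP" "r * W g \<le> q'" and q: "0 \<le> q" "0 \<le> q'"
  shows "(\<lambda>m. smult (c m) (\<phi> m g) * h m) \<in> span (q' * q)"
  using h
proof (induction rule: span.induct)
  case span_zero
  show ?case using span.span_zero by simp
next
  case (span_add h c' r' g')
  have "(\<lambda>m. smult (c m) (\<phi> m g) * h m + smult (c m * c' m) (\<phi> m (g * g'))) \<in> span (q' * q)"
  proof (rule span.span_add[where r = "r * r'"])
    show "gr (\<lambda>m. c m * c' m) (r * r')" by (intro gr_mult c span_add)
    have "r * r' * W (g * g') = (r * W g) * (r' * W g')"
      using W_mult[OF c(3) span_add(4)] by simp
    also have "\<dots> \<le> q' * q"
      using span_add c q W_nonneg by (intro mult_mono) auto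
    finally show "r * r' * W (g * g') \<le> q' * q" .
  qed (use span_add c in \<open>auto intro: RP_mult\<close>)
  then show ?case
    using \<phi>_mult[OF c(3) span_add(4)] by (simp add: algebra_simps)
qed

lemma span_mult:
  assumes h': "h' \<in> span q'" and h: "h \<in> span q" and q: "0 \<le> q" "0 \<le> q'"
  shows "(\<lambda>m. h' m * h m) \<in> span (q' * q)"
  using h'
proof (induction rule: span.induct)
  case span_zero
  show ?case using span.span_zero by simp
next
  case (span_add h' c r g)
  have "(\<lambda>m. smult (c m) (\<phi> m g) * h m) \<in> span (q' * q)"
    using span_add by (intro span_term_mult[OF h] q)
  from span_plus[OF this, of "\<lambda>m. h' m * h m"] show ?case
    using span_add by (simp add: algebra_simps)
qed

text \<open>A functional of norm at most one, extended linearly over sequences, keeps the radius. A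
  stage sees only degrees below \<open>n\<close>, so \<open>n\<close> has to exceed the degrees of
  all polynomials in the sum.\<close>

lemma span_functional:
  assumes "h \<in> span q" and q: "0 \<le> q"
  shows "\<exists>n0. \<forall>n\<ge>n0. \<forall>l. stage G \<sigma> n l \<longrightarrow> gr (\<lambda>m. \<Sum>i<n. coeff (h m) i * l i m) q"
  using assms(1)
proof (induction rule: span.induct)
  case span_zero
  show ?case using q by (auto intro: gr_zero)
next
  case (span_add h c r g)
  then obtain n0 where n0: "\<And>n l. n \<ge> n0 \<Longrightarrow> stage G \<sigma> n l \<Longrightarrow> gr (\<lambda>m. \<Sum>i<n. coeff (h m) i * l i m) q"
    by blast
  show ?case
  proof (intro exI[of _ "max n0 (Suc (degree g))"] allI impI)
    fix n l assume n: "max n0 (Suc (degree g)) \<le> n" and l: "stage G \<sigma> n l"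
    have "\<forall>i\<ge>n. coeff g i = 0" using n by (auto intro: coeff_eq_0)
    then have "gr (\<lambda>m. e m 0 * \<sigma> m + (\<Sum>i<n. e m (coeff g i) * l i m)) (W (smult 0 G + g))"
      using R_0 span_add(4) by (intro stageD[OF l]) auto
    then have "gr (\<lambda>m. c m * (\<Sum>i<n. e m (coeff g i) * l i m)) (r * W g)"
      using span_add W_nonneg by (intro gr_mult) (auto simp: e_0)
    then have "gr (\<lambda>m. (\<Sum>i<n. coeff (h m) i * l i m) + c m * (\<Sum>i<n. e m (coeff g i) * l i m)) q"
      using span_add n0 n l q by (intro gr_add) (auto intro: gr_mono)
    then show "gr (\<lambda>m. \<Sum>i<n. coeff (h m + smult (c m) (\<phi> m g)) i * l i m) q"
      by (simp add: algebra_simps sum.distrib sum_distrib_left)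
  qed
qed

text \<open>The tensor norm does not shrink \<open>W\<close>: a functional of norm at most one whose
  value at \<open>G\<close> has growth rate \<open>W G\<close> detects this. It is the purpose of
  the Hahn--Banach extension.\<close>

lemma span_separates:
  assumes G: "G \<in> RP" "0 < W G" and q: "0 \<le> q" and h: "(\<lambda>m. \<phi> m G) \<in> span q"
  shows "W G \<le> q"
proof -
  define \<sigma> where "\<sigma> = (\<lambda>m. complex_of_real (W G powr t m))"
  obtain n0 where n0: "\<And>n l. n \<ge> n0 \<Longrightarrow> stage G \<sigma> n l \<Longrightarrow> gr (\<lambda>m. \<Sum>i<n. coeff (\<phi> m G) i * l i m) q"
    using span_functional[OF h q] by blast
  define n where "n = max n0 (Suc (degree G))"
  obtain l where l: "stage G \<sigma> n l" using stage_exists[OF G(1)] unfolding \<sigma>_def by blast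
  have "\<forall>i\<ge>n. coeff G i = 0" by (auto simp: n_def intro: coeff_eq_0)
  \<comment> \<open>For \<open>c = - 1\<close> and \<open>h = G\<close> the bound is
    \<open>W 0 = 0\<close>: the value computed from the coefficients of \<open>G\<close> differs
    from \<open>\<sigma>\<close> by growth rate 0.\<close>
  then have "gr (\<lambda>m. e m (- 1) * \<sigma> m + (\<Sum>i<n. e m (coeff G i) * l i m)) (W (smult (- 1) G + G))"
    using R_uminus[OF R_1] G(1) by (intro stageD[OF l]) auto
  then have "gr (\<lambda>m. - \<sigma> m + (\<Sum>i<n. e m (coeff G i) * l i m)) 0"
    using e_uminus[OF R_1] e_1 W_0 by simp
  then have "lower (\<lambda>m. \<sigma> m + (- \<sigma> m + (\<Sum>i<n. e m (coeff G i) * l i m))) (W G)"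
    unfolding \<sigma>_def using G(2) by (intro lower_perturb[OF lower_powr]) auto
  then have "lower (\<lambda>m. \<Sum>i<n. e m (coeff G i) * l i m) (W G)" by simp
  moreover have "gr (\<lambda>m. \<Sum>i<n. e m (coeff G i) * l i m) q"
    using n0[OF _ l] by (simp add: n_def)
  ultimately show ?thesis using q by (rule lower_le_gr)
qed

end

section \<open>A multiplicative seminorm on sequences of polynomials\<close>

lemma complex_poly_factor:
  fixes p :: "complex poly"
  shows "\<exists>\<rho>. p = smult (lead_coeff p) (\<Prod>l<degree p. [:- \<rho> l, 1:])"
proof (cases "p = 0")
  case False
  then obtain A where A: "size A = degree p" "smult (lead_coeff p) (\<Prod>a\<in>#A. [:- a, 1:]) = p"
    using alg_closed_imp_factorization by metis
  obtain xs where xs: "mset xs = A" using ex_mset by blast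
  have len: "length xs = degree p" using A xs by (metis size_mset)
  have "(\<Prod>a\<in>#A. [:- a, 1:]) = (\<Prod>x\<leftarrow>xs. [:- x, 1:])"
    using xs by (metis mset_map prod_mset_prod_list)
  also have "\<dots> = (\<Prod>l<degree p. [:- (xs ! l), 1:])"
    unfolding len[symmetric] by (simp add: prod.list_conv_set_nth atLeast0LessThan)
  finally show ?thesis using A by (intro exI[of _ "\<lambda>l. xs ! l"]) simp
qed simp

text \<open>When \<open>cmod z\<close> exceeds 1, isolate the leading term and divide by z^(d-1).
  The bound is a sum of absolute values of quotients of coefficients, so finite growth passes from
  these to the roots.\<close>

lemma complex_root_bound:
  fixes p :: "complex poly"
  assumes z: "poly p z = 0" and p: "p \<noteq> 0"
  shows "cmod z \<le> 1 + (\<Sum>i<degree p. cmod (coeff p i / lead_coeff p))"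
proof (cases "cmod z \<le> 1")
  case True
  then show ?thesis by (intro order_trans[OF True]) (simp add: sum_nonneg)
next
  case False
  define d where "d = degree p"
  have lc: "lead_coeff p \<noteq> 0" using p by simp
  have "d \<noteq> 0"
  proof
    assume "d = 0"
    then obtain c where "p = [:c:]" unfolding d_def by (metis degree_eq_zeroE)
    then show False using z p by auto
  qed
  then obtain d' where d': "d = Suc d'" by (cases d) auto
  have "0 = (\<Sum>i\<le>d. coeff p i * z ^ i)" using z by (simp add: poly_altdef d_def)
  also have "\<dots> = (\<Sum>i<d. coeff p i * z ^ i) + lead_coeff p * z ^ d"
    by (simp add: d_def lessThan_Suc_atMost[symmetric])
  finally have "z ^ d = - (\<Sum>i<d. coeff p i / lead_coeff p * z ^ i)"
    using lc by (simp add: sum_divide_distrib[symmetric] field_simps eq_neg_iff_add_eq_0)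
  then have "cmod z ^ d = cmod (\<Sum>i<d. coeff p i / lead_coeff p * z ^ i)"
    by (metis norm_minus_cancel norm_power)
  also have "\<dots> \<le> (\<Sum>i<d. cmod (coeff p i / lead_coeff p) * cmod z ^ d')"
  proof (intro order_trans[OF norm_sum] sum_mono)
    fix i assume "i \<in> {..<d}"
    then have "cmod z ^ i \<le> cmod z ^ d'" using False d' by (intro power_increasing) auto
    then show "cmod (coeff p i / lead_coeff p * z ^ i) \<le> cmod (coeff p i / lead_coeff p) * cmod z ^ d'"
      unfolding norm_mult norm_power by (intro mult_left_mono) auto
  qed
  also have "\<dots> = (\<Sum>i<d. cmod (coeff p i / lead_coeff p)) * cmod z ^ d'"
    by (simp add: sum_distrib_right)
  finally have "cmod z * cmod z ^ d' \<le> (\<Sum>i<d. cmod (coeff p i / lead_coeff p)) * cmod z ^ d'"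
    by (simp add: d')
  moreover have "0 < cmod z ^ d'" using False by (intro zero_less_power) linarith
  ultimately have "cmod z \<le> (\<Sum>i<d. cmod (coeff p i / lead_coeff p))"
    by (rule mult_right_le_imp_le)
  then show ?thesis by (simp add: d_def)
qed

locale tower_norm = tower_step t R e W
  for t :: "nat \<Rightarrow> real" and R :: "'a::comm_ring_1 set" and e W +
  fixes w :: "(nat \<Rightarrow> complex poly) \<Rightarrow> real"
  assumes w_nonneg: "0 \<le> w a"
    and w_add': "(\<exists>q\<ge>0. a \<in> span q) \<Longrightarrow> (\<exists>q\<ge>0. b \<in> span q) \<Longrightarrow> w (\<lambda>m. a m + b m) \<le> max (w a) (w b)"
    and w_mult': "(\<exists>q\<ge>0. a \<in> span q) \<Longrightarrow> (\<exists>q\<ge>0. b \<in> span q) \<Longrightarrow> w (\<lambda>m. a m * b m) = w a * w b"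
    and w_le: "0 \<le> q \<Longrightarrow> a \<in> span q \<Longrightarrow> w a \<le> q"
    and w_\<phi>: "g \<in> RP \<Longrightarrow> w (\<lambda>m. \<phi> m g) = W g"

text \<open>Polynomials of positive value are the multipliers, so their values survive minimization;
  value 0 is kept by the upper bound alone.\<close>

lemma (in tower_step) tower_norm_exists: "\<exists>w. tower_norm t R e W w"
proof -
  define S where "S = {(\<lambda>m. \<phi> m g, W g) | g. g \<in> RP \<and> 0 < W g}"
  have \<phi>_span: "(\<lambda>m. \<phi> m g) \<in> span (W g)" if "g \<in> RP" for g
    using span_term[OF gr_const[of 1] _ that, of "W g"] by simp
  interpret filtered_ring span S
  proof
    show "0 \<in> span q" for q using span_zero by (simp add: zero_fun_def)
    show "1 \<in> span 1" using \<phi>_span[OF RP_1] by (simp add: one_fun_def W_1)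
    show "span q \<subseteq> span q'" if "0 \<le> q" "q \<le> q'" for q q' using that span_mono by blast
    show "a + b \<in> span q" if "0 \<le> q" "a \<in> span q" "b \<in> span q" for a b q
      using span_plus[OF that(3,2)] by (simp add: plus_fun_def)
    show "a * b \<in> span (q * q')" if "0 \<le> q" "0 \<le> q'" "a \<in> span q" "b \<in> span q'" for a b q q'
      using span_mult[OF that(3,4,2,1)] by (simp add: times_fun_def)
    show "0 < r \<and> s \<in> span r" if "(s, r) \<in> S" for s r
      using that \<phi>_span by (auto simp: S_def)
    show "(1, 1) \<in> S" using RP_1 W_1 by (auto simp: S_def one_fun_def intro!: exI[of _ 1])
    show "(s * s', r * r') \<in> S" if "(s, r) \<in> S" "(s', r') \<in> S" for s r s' r'
    proof -
      obtain g g' where "s = (\<lambda>m. \<phi> m g)" "r = W g" "g \<in> RP" "0 < W g"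
        "s' = (\<lambda>m. \<phi> m g')" "r' = W g'" "g' \<in> RP" "0 < W g'"
        using \<open>(s, r) \<in> S\<close> \<open>(s', r') \<in> S\<close> by (auto simp: S_def)
      then show ?thesis
        by (auto simp: S_def times_fun_def \<phi>_mult W_mult RP_mult intro!: exI[of _ "g * g'"])
    qed
    show "r \<le> q" if "(s, r) \<in> S" "0 \<le> q" "s \<in> span q" for s r q
      using that span_separates by (auto simp: S_def)
  qed
  obtain w where w: "\<And>a. 0 \<le> w a"
    "\<And>a b. a \<in> B \<Longrightarrow> b \<in> B \<Longrightarrow> w (a + b) \<le> max (w a) (w b)"
    "\<And>a b. a \<in> B \<Longrightarrow> b \<in> B \<Longrightarrow> w (a * b) = w a * w b"
    "\<And>a q. 0 \<le> q \<Longrightarrow> a \<in> span q \<Longrightarrow> w a \<le> q"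
    "\<And>s r. (s, r) \<in> S \<Longrightarrow> w s = r"
    by (rule multiplicative_seminorm) (rule that, assumption+)
  have "tower_norm t R e W w"
  proof
    show "0 \<le> w a" for a by (rule w)
    show "w (\<lambda>m. a m + b m) \<le> max (w a) (w b)"
      if "\<exists>q\<ge>0. a \<in> span q" "\<exists>q\<ge>0. b \<in> span q" for a b
      using w(2)[of a b] that by (auto simp: B_def plus_fun_def)
    show "w (\<lambda>m. a m * b m) = w a * w b"
      if "\<exists>q\<ge>0. a \<in> span q" "\<exists>q\<ge>0. b \<in> span q" for a b
      using w(3)[of a b] that by (auto simp: B_def times_fun_def)
    show "w a \<le> q" if "0 \<le> q" "a \<in> span q" for a q using w(4) that by blast
    show "w (\<lambda>m. \<phi> m g) = W g" if g: "g \<in> RP" for g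
    proof (cases "W g = 0")
      case True
      then show ?thesis using w(4)[of 0 "\<lambda>m. \<phi> m g"] w(1)[of "\<lambda>m. \<phi> m g"] \<phi>_span[OF g] by simp
    next
      case False
      then have "(\<lambda>m. \<phi> m g, W g) \<in> S" using g W_nonneg[of g] unfolding S_def by auto
      then show ?thesis by (rule w(5))
    qed
  qed
  then show ?thesis by blast
qed

section \<open>Sequences of finite growth\<close>

context growth
begin

definition fin :: "(nat \<Rightarrow> complex) \<Rightarrow> bool" where "fin c \<longleftrightarrow> (\<exists>r\<ge>0. gr c r)"

lemma finI: "gr c r \<Longrightarrow> 0 \<le> r \<Longrightarrow> fin c" by (auto simp: fin_def)

lemma fin_add: assumes "fin c" "fin d" shows "fin (\<lambda>m. c m + d m)"
proof -
  obtain r q where "0 \<le> r" "gr c r" "0 \<le> q" "gr d q" using assms by (auto simp: fin_def)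
  then have "gr (\<lambda>m. c m + d m) (max r q)"
    by (intro gr_add gr_mono[of c r "max r q"] gr_mono[of d q "max r q"]) auto
  then show ?thesis using \<open>0 \<le> r\<close> by (rule finI[OF _ max.coboundedI1])
qed

lemma fin_const: "fin (\<lambda>m. c)"
  using gr_const by (rule finI) simp

lemma fin_minus: "fin c \<Longrightarrow> fin (\<lambda>m. - c m)"
  using gr_minus by (auto simp: fin_def)

lemma fin_diff: "fin c \<Longrightarrow> fin d \<Longrightarrow> fin (\<lambda>m. c m - d m)"
  using fin_add[of c "\<lambda>m. - d m"] fin_minus by simp

lemma fin_sum: "(\<And>i. i \<in> F \<Longrightarrow> fin (c i)) \<Longrightarrow> fin (\<lambda>m. \<Sum>i\<in>F. c i m)"
proof (induction F rule: infinite_finite_induct)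
  case (insert x F)
  then have "fin (\<lambda>m. c x m + (\<Sum>i\<in>F. c i m))" by (intro fin_add) auto
  with insert show ?case by simp
qed (simp_all add: fin_const)

lemma fin_le: "fin c \<Longrightarrow> (\<And>m. cmod (d m) \<le> cmod (c m)) \<Longrightarrow> fin d"
  using gr_eventually_le[of c _ d] by (auto simp: fin_def)

end

context tower_norm
begin

definition BB :: "(nat \<Rightarrow> complex poly) set" where "BB = {a. \<exists>q\<ge>0. a \<in> span q}"

lemma w_add: "a \<in> BB \<Longrightarrow> b \<in> BB \<Longrightarrow> w (\<lambda>m. a m + b m) \<le> max (w a) (w b)"
  using w_add' by (simp add: BB_def)

lemma w_mult: "a \<in> BB \<Longrightarrow> b \<in> BB \<Longrightarrow> w (\<lambda>m. a m * b m) = w a * w b"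
  using w_mult' by (simp add: BB_def)

lemma BB_\<phi>: "g \<in> RP \<Longrightarrow> (\<lambda>m. \<phi> m g) \<in> BB"
  using span_term[OF gr_const[of 1] _ , of g "W g"] W_nonneg by (auto simp: BB_def)

lemma const_in_span: "gr c r \<Longrightarrow> 0 \<le> r \<Longrightarrow> (\<lambda>m. [:c m:]) \<in> span r"
  using span_term[OF _ _ RP_1, of c r r] by (simp add: W_1)

lemma BB_const: "fin c \<Longrightarrow> (\<lambda>m. [:c m:]) \<in> BB"
  using const_in_span by (auto simp: BB_def fin_def)

lemma BB_add: assumes "a \<in> BB" "b \<in> BB" shows "(\<lambda>m. a m + b m) \<in> BB"
proof -
  obtain q q' where "0 \<le> q" "a \<in> span q" "0 \<le> q'" "b \<in> span q'" using assms by (auto simp: BB_def)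
  then have "(\<lambda>m. a m + b m) \<in> span (max q q')"
    by (intro span_plus span_mono[of a q "max q q'"] span_mono[of b q' "max q q'"]) auto
  then show ?thesis using \<open>0 \<le> q\<close> by (auto simp: BB_def intro!: exI[of _ "max q q'"])
qed

lemma BB_mult: assumes "a \<in> BB" "b \<in> BB" shows "(\<lambda>m. a m * b m) \<in> BB"
proof -
  obtain q q' where "0 \<le> q" "a \<in> span q" "0 \<le> q'" "b \<in> span q'" using assms by (auto simp: BB_def)
  then have "(\<lambda>m. a m * b m) \<in> span (q * q')" by (intro span_mult)
  then show ?thesis using \<open>0 \<le> q\<close> \<open>0 \<le> q'\<close> by (auto simp: BB_def intro!: exI[of _ "q * q'"])
qed

text \<open>The seminorm on coefficient sequences. It is bounded by the upper growth rate but,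
  unlike that rate, multiplicative.\<close>

definition wc :: "(nat \<Rightarrow> complex) \<Rightarrow> real" where "wc c = w (\<lambda>m. [:c m:])"

lemma wc_nonneg: "0 \<le> wc c" by (simp add: wc_def w_nonneg)

lemma wc_le: "gr c r \<Longrightarrow> 0 \<le> r \<Longrightarrow> wc c \<le> r"
  unfolding wc_def by (intro w_le const_in_span)

lemma wc_mult: "fin c \<Longrightarrow> fin d \<Longrightarrow> wc (\<lambda>m. c m * d m) = wc c * wc d"
  unfolding wc_def using w_mult[OF BB_const BB_const, of c d] by (simp add: mult.commute)

lemma wc_add: "fin c \<Longrightarrow> fin d \<Longrightarrow> wc (\<lambda>m. c m + d m) \<le> max (wc c) (wc d)"
  unfolding wc_def using w_add[OF BB_const BB_const, of c d] by simp

lemma wc_e: "a \<in> R \<Longrightarrow> wc (\<lambda>m. e m a) = W [:a:]"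
  unfolding wc_def using w_\<phi>[OF RP_const, of a] by (simp add: \<phi>_const)

lemma wc_1: "wc (\<lambda>m. 1) = 1"
  using wc_e[OF R_1] W_1 by (simp add: e_1 one_pCons)

lemma w_minus: assumes "a \<in> BB" shows "w (\<lambda>m. - a m) = w a"
proof -
  have "wc (\<lambda>m. (- 1) * (- 1)) = wc (\<lambda>m. - 1) * wc (\<lambda>m. - 1)"
    by (intro wc_mult fin_const)
  then have "(wc (\<lambda>m. - 1))\<^sup>2 = 1" by (simp add: wc_1 power2_eq_square)
  then have "wc (\<lambda>m. - 1) = 1" using wc_nonneg[of "\<lambda>m. - 1"] by (simp add: power2_eq_1_iff)
  then show ?thesis
    using w_mult[OF BB_const[OF fin_const[of "- 1"]] assms] by (simp add: wc_def)
qed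

lemma BB_minus: "a \<in> BB \<Longrightarrow> (\<lambda>m. - a m) \<in> BB"
  using BB_mult[OF BB_const[OF fin_const[of "- 1"]], of a] by simp

lemma w_diff: "a \<in> BB \<Longrightarrow> b \<in> BB \<Longrightarrow> w (\<lambda>m. a m - b m) \<le> max (w a) (w b)"
  using w_add[of a "\<lambda>m. - b m"] BB_minus[of b] w_minus[of b] by simp

definition ind :: "nat set \<Rightarrow> nat \<Rightarrow> complex" where "ind E m = (if m \<in> E then 1 else 0)"

text \<open>An index set that \<open>w\<close> ignores. Indicators are idempotent, so their value is
  0 or 1. The null sets form a proper ideal containing the finite sets, so the complement of a null
  set is infinite.\<close>

definition null :: "nat set \<Rightarrow> bool" where "null E \<longleftrightarrow> wc (ind E) = 0"

lemma gr_ind: "gr (ind E) 1"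
  by (rule gr_bounded) (simp add: ind_def)

lemma fin_ind: "fin (ind E)"
  using gr_ind by (rule finI) simp

lemma wc_ind_mult: "wc (\<lambda>m. ind E m * ind F m) = wc (ind E) * wc (ind F)"
  by (intro wc_mult fin_ind)

lemma nullI: assumes "wc (ind E) < 1" shows "null E"
proof -
  have "(\<lambda>m. ind E m * ind E m) = ind E" by (auto simp: ind_def)
  then have "wc (ind E) = wc (ind E) * wc (ind E)" using wc_ind_mult[of E E] by simp
  then show ?thesis using assms by (simp add: null_def)
qed

lemma null_Un: assumes "null E" "null F" shows "null (E \<union> F)"
proof -
  have eq: "ind (E \<union> F) = (\<lambda>m. ind E m + ind F m * ind (- E) m)" by (auto simp: ind_def)
  have "fin (\<lambda>m. ind F m * ind (- E) m)"
    by (rule fin_le[OF fin_ind[of F]]) (simp add: ind_def)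
  then have "wc (ind (E \<union> F)) \<le> max (wc (ind E)) (wc (\<lambda>m. ind F m * ind (- E) m))"
    unfolding eq by (intro wc_add fin_ind)
  also have "\<dots> = 0" using assms by (simp add: wc_ind_mult null_def)
  finally show ?thesis using wc_nonneg[of "ind (E \<union> F)"] by (simp add: null_def)
qed

lemma null_empty: "null {}"
  using wc_le[OF gr_zero[of 0]] wc_nonneg[of "ind {}"] by (simp add: null_def ind_def[abs_def])

lemma null_UN: "finite I \<Longrightarrow> (\<And>i. i \<in> I \<Longrightarrow> null (E i)) \<Longrightarrow> null (\<Union>i\<in>I. E i)"
  by (induction I rule: finite_induct) (auto intro: null_Un null_empty)

lemma null_eventually: assumes "\<forall>\<^sub>F m in sequentially. m \<notin> E" shows "null E"
proof -
  have "gr (ind E) 0"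
    by (rule gr_eventually_zero) (use assms in eventually_elim, auto simp: ind_def)
  then show ?thesis using wc_le[of "ind E" 0] by (intro nullI) auto
qed

lemma not_null_UNIV: "\<not> null UNIV"
  using wc_1 by (simp add: null_def ind_def[abs_def])

text \<open>The indices at which some sequence misses its prescribed size form a null set, and a
  null set is never cofinite. For sequences of value 0, where relative precision has no meaning,
  \<open>\<eta>\<close> takes its place.\<close>

lemma joint_approximation:
  assumes C: "finite C" "\<And>c. c \<in> C \<Longrightarrow> fin c" and \<delta>: "1 < \<delta>" and \<eta>: "0 < \<eta>"
  shows "\<exists>\<^sub>F m in sequentially. \<forall>c\<in>C.
    (0 < wc c \<longrightarrow> near \<delta> (wc c) m (c m)) \<and>
    (wc c = 0 \<longrightarrow> cmod (c m) \<le> \<eta> powr t m)"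
proof -
  define u where "u c = (if wc c = 0 then \<eta> else wc c * \<delta>)" for c
  define Hi where "Hi c = {m. u c powr t m < cmod (c m)}" for c
  define Lo where "Lo c = {m. 0 < wc c \<and> cmod (c m) < (wc c / \<delta>) powr t m}" for c
  have u: "0 < u c" "wc c < u c" for c
    using \<delta> \<eta> wc_nonneg[of c] by (auto simp: u_def)
  have Hi: "null (Hi c)" if "c \<in> C" for c
  proof -
    \<comment> \<open>On \<open>Hi c\<close> the inverse of \<open>c\<close> has growth rate at most
      \<open>1 / u c\<close>, and \<open>c * d\<close> is the indicator of \<open>Hi c\<close>;
      multiplicativity gives this indicator a value below 1.\<close>
    define d where "d m = ind (Hi c) m / c m" for m
    have le: "cmod (d m) \<le> (1 / u c) powr t m" for m
    proof (cases "m \<in> Hi c")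
      case True
      then have "u c powr t m < cmod (c m)" by (simp add: Hi_def)
      moreover have "0 < u c powr t m" using u[of c] by simp
      ultimately have "1 / cmod (c m) \<le> 1 / (u c powr t m)"
        by (intro divide_left_mono mult_pos_pos) linarith+
      then show ?thesis using True u[of c] by (simp add: d_def ind_def norm_divide powr_divide)
    qed (simp add: d_def ind_def)
    have gr: "gr d (1 / u c)"
      by (rule gr_eventually_le[OF gr_powr[of "1 / u c"]]) (use u[of c] le in auto)
    have cd: "(\<lambda>m. c m * d m) = ind (Hi c)"
    proof
      fix m
      show "c m * d m = ind (Hi c) m"
        by (cases "c m = 0") (auto simp: d_def ind_def Hi_def not_less)
    qed
    have "fin d" using gr u[of c] by (intro finI) auto
    then have "wc (ind (Hi c)) = wc c * wc d"
      using wc_mult[OF C(2)[OF that], of d] cd by simp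
    also have "\<dots> \<le> wc c * (1 / u c)"
      using wc_le[OF gr] u[of c] wc_nonneg[of c] by (intro mult_left_mono) auto
    also have "\<dots> < 1" using u[of c] by simp
    finally show ?thesis by (rule nullI)
  qed
  have Lo: "null (Lo c)" if "c \<in> C" for c
  proof (cases "0 < wc c")
    case True
    \<comment> \<open>Restricted to \<open>Lo c\<close>, the sequence has at most the value
      \<open>wc c / \<delta>\<close>, so the indicator has value at most
      \<open>1 / \<delta>\<close>.\<close>
    have "gr (\<lambda>m. c m * ind (Lo c) m) (wc c / \<delta>)"
      by (rule gr_eventually_le[OF gr_powr[of "wc c / \<delta>"]])
        (use True \<delta> in \<open>auto simp: ind_def Lo_def\<close>)
    then have "wc (\<lambda>m. c m * ind (Lo c) m) \<le> wc c / \<delta>"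
      using True \<delta> by (intro wc_le) auto
    then have "wc c * wc (ind (Lo c)) \<le> wc c / \<delta>"
      using wc_mult[OF C(2)[OF that] fin_ind] by simp
    then have "wc (ind (Lo c)) \<le> 1 / \<delta>" using True \<delta> by (simp add: pos_le_divide_eq mult.assoc)
    also have "\<dots> < 1" using \<delta> by simp
    finally show ?thesis by (rule nullI)
  next
    case False
    then have "Lo c = {}" by (auto simp: Lo_def)
    then show ?thesis by (simp add: null_empty)
  qed
  show ?thesis
  proof (rule ccontr)
    assume "\<not> ?thesis"
    then have "\<forall>\<^sub>F m in sequentially. \<not> (\<forall>c\<in>C.
      (0 < wc c \<longrightarrow> near \<delta> (wc c) m (c m)) \<and>
      (wc c = 0 \<longrightarrow> cmod (c m) \<le> \<eta> powr t m))"
      by (simp add: not_frequently)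
    then have "\<forall>\<^sub>F m in sequentially. m \<notin> - (\<Union>c\<in>C. Hi c \<union> Lo c)"
    proof eventually_elim
      case (elim m)
      then obtain c where "c \<in> C" "m \<in> Hi c \<or> m \<in> Lo c"
        by (auto simp: Hi_def Lo_def u_def not_le)
      then show ?case by blast
    qed
    then have "null (- (\<Union>c\<in>C. Hi c \<union> Lo c))" by (rule null_eventually)
    moreover have "null (\<Union>c\<in>C. Hi c \<union> Lo c)"
      using C(1) Hi Lo by (intro null_UN null_Un)
    ultimately have "null ((\<Union>c\<in>C. Hi c \<union> Lo c) \<union> - (\<Union>c\<in>C. Hi c \<union> Lo c))" by (intro null_Un)
    then show False using not_null_UNIV by (simp only: Compl_partition)
  qed
qed

text \<open>Split \<open>b\<close> along the set of agreement: on it \<open>b\<close> equals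
  \<open>a\<close>, and the remaining part carries the indicator of a null set.\<close>

lemma w_cong_le:
  assumes a: "a \<in> BB" and b: "b \<in> BB" and ev: "\<forall>\<^sub>F m in sequentially. a m = b m"
  shows "w b \<le> w a"
proof -
  define E where "E = {m. a m = b m}"
  have eq: "b = (\<lambda>m. [:ind E m:] * a m + [:ind (- E) m:] * b m)"
    by (auto simp: ind_def E_def)
  have null: "null (- E)" by (rule null_eventually) (use ev in \<open>simp add: E_def\<close>)
  have i: "(\<lambda>m. [:ind E m:]) \<in> BB" for E by (intro BB_const fin_ind)
  have "w b \<le> max (w (\<lambda>m. [:ind E m:] * a m)) (w (\<lambda>m. [:ind (- E) m:] * b m))"
    by (subst eq) (intro w_add BB_mult i a b)
  also have "w (\<lambda>m. [:ind E m:] * a m) = wc (ind E) * w a"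
    using w_mult[OF i a] by (simp add: wc_def)
  also have "\<dots> \<le> 1 * w a" by (intro mult_right_mono wc_le gr_ind w_nonneg) auto
  also have "w (\<lambda>m. [:ind (- E) m:] * b m) = wc (ind (- E)) * w b"
    using w_mult[OF i b] by (simp add: wc_def)
  also have "\<dots> = 0" using null by (simp add: null_def)
  finally show ?thesis using w_nonneg[of a] by simp
qed

lemma w_cong:
  assumes "a \<in> BB" "b \<in> BB" "\<forall>\<^sub>F m in sequentially. a m = b m"
  shows "w a = w b"
  using w_cong_le[OF assms] w_cong_le[OF assms(2,1)] assms(3) by (simp add: eq_commute)

text \<open>The distance from \<open>Y\<close> to the sequence \<open>r\<close>. Together with
  \<open>wc\<close> of differences it satisfies the ultrametric triangle inequality, in the forms
  \<open>wc_diff_le\<close> and \<open>wr_le\<close>.\<close>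

definition wr :: "(nat \<Rightarrow> complex) \<Rightarrow> real" where "wr r = w (\<lambda>m. [:- r m, 1:])"

lemma BB_linear: "fin r \<Longrightarrow> (\<lambda>m. [:- r m, 1:]) \<in> BB"
  using BB_add[OF BB_const[OF fin_minus] BB_\<phi>[OF RP_X], of r] by (simp add: \<phi>_X)

lemma wr_nonneg: "0 \<le> wr r" by (simp add: wr_def w_nonneg)

lemma wc_diff_le: assumes "fin r" "fin s" shows "wc (\<lambda>m. r m - s m) \<le> max (wr r) (wr s)"
  using w_diff[OF BB_linear BB_linear, of s r] assms by (simp add: wc_def wr_def max.commute)

lemma wr_le: assumes "fin r" "fin s" shows "wr r \<le> max (wr s) (wc (\<lambda>m. r m - s m))"
  using w_diff[OF BB_linear BB_const, of s "\<lambda>m. r m - s m"] assms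
  by (simp add: wc_def wr_def fin_diff)

lemma w_prod:
  "(\<And>l. l \<in> I \<Longrightarrow> fin (r l)) \<Longrightarrow>
     (\<lambda>m. \<Prod>l\<in>I. [:- r l m, 1:]) \<in> BB \<and> w (\<lambda>m. \<Prod>l\<in>I. [:- r l m, 1:]) = (\<Prod>l\<in>I. wr (r l))"
proof (induction I rule: infinite_finite_induct)
  case (insert x F)
  then show ?case
    using BB_mult[OF BB_linear[of "r x"], of "\<lambda>m. \<Prod>l\<in>F. [:- r l m, 1:]"]
      w_mult[OF BB_linear[of "r x"], of "\<lambda>m. \<Prod>l\<in>F. [:- r l m, 1:]"]
    by (simp add: wr_def)
qed (use BB_const[OF fin_const[of 1]] wc_1 in \<open>auto simp: wc_def one_pCons\<close>)

end

section \<open>Choosing values of one more variable\<close>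

context tower_step
begin

text \<open>The degree of \<open>g\<close> as a polynomial over the residue ring of \<open>R\<close> modulo the kernel of \<open>W\<close>.\<close>

definition top :: "'a poly \<Rightarrow> nat \<Rightarrow> bool" where
  "top g d \<longleftrightarrow> 0 < W [:coeff g d:] \<and> (\<forall>i>d. W [:coeff g i:] = 0)"

lemma top_exists:
  assumes "W [:coeff g i:] \<noteq> 0"
  shows "\<exists>d. top g d"
proof -
  define A where "A = {i. W [:coeff g i:] \<noteq> 0}"
  have "A \<subseteq> {..degree g}" using W_0 by (auto simp: A_def intro: le_degree)
  then have fin: "finite A" by (rule finite_subset) simp
  have ne: "A \<noteq> {}" using assms by (auto simp: A_def)
  have "Max A \<in> A" using fin ne by simp
  moreover have "i \<notin> A" if "i > Max A" for i using Max_ge[OF fin, of i] that by (auto simp del: Max_ge)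
  ultimately have "W [:coeff g (Max A):] \<noteq> 0" "\<forall>i>Max A. W [:coeff g i:] = 0"
    unfolding A_def by blast+
  then have "top g (Max A)"
    using W_nonneg[of "[:coeff g (Max A):]"] by (simp add: top_def)
  then show ?thesis by blast
qed

lemma top_exists_pos: "g \<in> RP \<Longrightarrow> 0 < W g \<Longrightarrow> \<exists>d. top g d"
  using W_eq_0I[of g] top_exists by force

lemma top_degree:
  assumes g: "g \<in> RP" and d: "top g d"
  shows "\<forall>\<^sub>F m in sequentially. degree (\<phi> m g) = d \<and> e m (coeff g d) \<noteq> 0"
proof -
  have "\<forall>\<^sub>F m in sequentially. e m (coeff g d) \<noteq> 0"
    using d by (intro lower_nonzero[OF e_lower[OF RP_coeff[OF g]]]) (auto simp: top_def)
  then show ?thesis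
  proof eventually_elim
    case (elim m)
    have "e m (coeff g i) = 0" if "i > d" for i
      using d that by (intro e_null RP_coeff[OF g]) (auto simp: top_def)
    then have "degree (\<phi> m g) \<le> d" by (intro degree_le) auto
    moreover have "d \<le> degree (\<phi> m g)" using elim by (intro le_degree) simp
    ultimately show ?case using elim by auto
  qed
qed

text \<open>The leading coefficient has a positive lower growth rate, so the quotients in the root
  bound have finite growth, and hence so do the roots.\<close>

lemma root_sequences:
  assumes g: "g \<in> RP" and d: "top g d"
  shows "\<exists>r. (\<forall>l. fin (r l)) \<and>
    (\<forall>\<^sub>F m in sequentially. \<phi> m g = smult (e m (coeff g d)) (\<Prod>l<d. [:- r l m, 1:]))"
proof -
  define ok where "ok m \<longleftrightarrow> degree (\<phi> m g) = d \<and> e m (coeff g d) \<noteq> 0" for m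
  have ok: "\<forall>\<^sub>F m in sequentially. ok m" using top_degree[OF g d] by (simp add: ok_def)
  have "\<forall>m. \<exists>\<rho>. \<phi> m g = smult (lead_coeff (\<phi> m g)) (\<Prod>l<degree (\<phi> m g). [:- \<rho> l, 1:])"
    using complex_poly_factor by blast
  then obtain \<rho> where \<rho>: "\<And>m. \<phi> m g = smult (lead_coeff (\<phi> m g)) (\<Prod>l<degree (\<phi> m g). [:- \<rho> m l, 1:])"
    by metis
  \<comment> \<open>The default 0 makes the bound by \<open>K\<close> hold at every index, also at
    the finitely many where the degree is wrong.\<close>
  define r where "r l m = (if l < d \<and> ok m then \<rho> m l else 0)" for l m
  define K where "K m = 1 + (\<Sum>i<d. cmod (e m (coeff g i) / e m (coeff g d)))" for m
  have Wd: "0 < W [:coeff g d:]" using d by (simp add: top_def)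
  have finK: "fin (\<lambda>m. complex_of_real (K m))"
  proof -
    have quot: "fin (\<lambda>m. e m (coeff g i) / e m (coeff g d))" for i
    proof -
      have "gr (\<lambda>m. e m (coeff g d) * (e m (coeff g i) / e m (coeff g d))) (W [:coeff g i:])"
        by (rule gr_cong[OF e_gr[OF RP_coeff[OF g]]])
          (use ok in eventually_elim, simp add: ok_def)
      then have "gr (\<lambda>m. e m (coeff g i) / e m (coeff g d)) (W [:coeff g i:] / W [:coeff g d:])"
        by (rule gr_divide[OF e_lower[OF RP_coeff[OF g]] Wd W_nonneg])
      then show ?thesis using Wd W_nonneg by (intro finI) auto
    qed
    have "fin (\<lambda>m. of_real (cmod (e m (coeff g i) / e m (coeff g d))))" for i
      by (rule fin_le[OF quot[of i]]) simp
    then have "fin (\<lambda>m. 1 + (\<Sum>i<d. of_real (cmod (e m (coeff g i) / e m (coeff g d)))))"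
      by (intro fin_add fin_sum fin_const)
    then show ?thesis by (simp add: K_def)
  qed
  have "fin (r l)" for l
  proof (rule fin_le[OF finK])
    fix m
    have K0: "0 \<le> K m" by (simp add: K_def sum_nonneg)
    show "cmod (r l m) \<le> cmod (complex_of_real (K m))"
    proof (cases "l < d \<and> ok m")
      case True
      then have nz: "\<phi> m g \<noteq> 0" and deg: "degree (\<phi> m g) = d" by (auto simp: ok_def)
      have "poly (\<Prod>l<degree (\<phi> m g). [:- \<rho> m l, 1:]) (\<rho> m l) = 0"
        using True by (auto simp: poly_prod ok_def)
      then have "poly (\<phi> m g) (\<rho> m l) = 0" by (subst \<rho>) simp
      from complex_root_bound[OF this nz] have "cmod (\<rho> m l) \<le> K m"
        unfolding K_def deg by simp
      then show ?thesis using True K0 by (simp add: r_def)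
    next
      case False
      then have "r l m = 0" by (auto simp: r_def)
      with K0 show ?thesis by simp
    qed
  qed
  moreover have "\<forall>\<^sub>F m in sequentially. \<phi> m g = smult (e m (coeff g d)) (\<Prod>l<d. [:- r l m, 1:])"
    using ok
  proof eventually_elim
    case (elim m)
    then have deg: "degree (\<phi> m g) = d" by (simp add: ok_def)
    have "\<phi> m g = smult (e m (coeff g d)) (\<Prod>l<d. [:- \<rho> m l, 1:])"
      using \<rho>[of m] unfolding deg coeff_\<phi> .
    also have "(\<Prod>l<d. [:- \<rho> m l, 1:]) = (\<Prod>l<d. [:- r l m, 1:])"
      using elim by (intro prod.cong) (auto simp: r_def)
    finally show ?case .
  qed
  ultimately show ?thesis by blast
qed

lemma pseudo_division:
  assumes \<mu>: "\<mu> \<in> RP" "top \<mu> d"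
  shows "g \<in> RP \<Longrightarrow> (\<And>i. n + d \<le> i \<Longrightarrow> W [:coeff g i:] = 0) \<Longrightarrow>
    \<exists>N. \<exists>q\<in>RP. \<exists>\<rho>\<in>RP. smult (coeff \<mu> d ^ N) g = q * \<mu> + \<rho> \<and> (\<forall>i\<ge>d. W [:coeff \<rho> i:] = 0)"
proof (induction n arbitrary: g)
  case 0
  then show ?case using RP_0 by (intro exI[of _ 0] bexI[of _ 0] bexI[of _ g]) auto
next
  case (Suc n)
  define u where "u = coeff \<mu> d"
  define b where "b = coeff g (n + d)"
  define g1 where "g1 = smult u g - monom b n * \<mu>"
  have uR: "u \<in> R" and bR: "b \<in> R" using \<mu> Suc.prems by (auto simp: u_def b_def RP_coeff)
  have g1: "g1 \<in> RP"
    unfolding g1_def by (intro RP_diff RP_smult RP_mult RP_monom uR bR \<mu> Suc.prems)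
  have "W [:coeff g1 i:] = 0" if i: "n + d \<le> i" for i
  proof -
    have ci: "coeff g1 i = u * coeff g i - b * coeff \<mu> (i - n)"
      using i by (simp add: g1_def coeff_monom_mult)
    show ?thesis
    proof (cases "i = n + d")
      case True
      then show ?thesis unfolding ci by (simp add: u_def b_def mult.commute W_0)
    next
      case False
      then have gi: "W [:coeff g i:] = 0" and mi: "W [:coeff \<mu> (i - n):] = 0"
        using Suc.prems(2)[of i] i \<mu>(2) by (auto simp: top_def)
      have "[:coeff g1 i:] = smult u [:coeff g i:] - smult b [:coeff \<mu> (i - n):]"
        unfolding ci by simp
      then have "W [:coeff g1 i:] \<le> max (W (smult u [:coeff g i:])) (W (smult b [:coeff \<mu> (i - n):]))"
        using uR bR \<mu> Suc.prems(1) by (simp only:) (intro W_diff RP_smult RP_const RP_coeff)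
      also have "\<dots> = 0"
        using gi mi uR bR W_smult RP_const RP_coeff \<mu> Suc.prems(1) by (simp del: smult_pCons)
      finally show ?thesis using W_nonneg by (simp add: antisym)
    qed
  qed
  from Suc.IH[OF g1 this] obtain N q \<rho> where *: "q \<in> RP" "\<rho> \<in> RP"
    "smult (u ^ N) g1 = q * \<mu> + \<rho>" "\<forall>i\<ge>d. W [:coeff \<rho> i:] = 0" unfolding u_def by blast
  have "smult (u ^ Suc N) g = smult (u ^ N) g1 + smult (u ^ N) (monom b n) * \<mu>"
    by (simp add: g1_def smult_diff_right mult.commute)
  also have "\<dots> = (q + smult (u ^ N) (monom b n)) * \<mu> + \<rho>"
    using * by (simp add: algebra_simps)
  finally show ?case
    using * uR bR unfolding u_def
    by (intro exI[of _ "Suc N"] bexI[of _ "q + smult (u ^ N) (monom b n)"] bexI[of _ \<rho>])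
      (auto simp: u_def intro!: RP_add RP_smult RP_monom R_power)
qed

text \<open>The common zeros, at index \<open>m\<close>, of the kernel of \<open>W\<close>.
  Substituting one for \<open>Y\<close> carries the exact vanishing over to the enlarged
  ring.\<close>

definition kernel_root :: "nat \<Rightarrow> complex \<Rightarrow> bool" where
  "kernel_root m z \<longleftrightarrow> (\<forall>g\<in>RP. W g = 0 \<longrightarrow> poly (\<phi> m g) z = 0)"

end

context tower_norm
begin

text \<open>The factorization holds at almost all indices only, which suffices by
  \<open>w_cong\<close>; then \<open>w\<close> is multiplicative on the factors.\<close>

lemma W_root_product:
  assumes g: "g \<in> RP" and d: "top g d" and r: "\<And>l. fin (r l)"
    and ev: "\<forall>\<^sub>F m in sequentially. \<phi> m g = smult (e m (coeff g d)) (\<Prod>l<d. [:- r l m, 1:])"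
  shows "W g = W [:coeff g d:] * (\<Prod>l<d. wr (r l))"
proof -
  have prod: "(\<lambda>m. \<Prod>l<d. [:- r l m, 1:]) \<in> BB" "w (\<lambda>m. \<Prod>l<d. [:- r l m, 1:]) = (\<Prod>l<d. wr (r l))"
    using w_prod[of "{..<d}" r] r by auto
  have c: "(\<lambda>m. [:e m (coeff g d):]) \<in> BB"
    using BB_\<phi>[OF RP_const[OF RP_coeff[OF g]], of d] by (simp add: \<phi>_const)
  have "W g = w (\<lambda>m. \<phi> m g)" using w_\<phi>[OF g] by simp
  also have "\<dots> = w (\<lambda>m. [:e m (coeff g d):] * (\<Prod>l<d. [:- r l m, 1:]))"
    by (intro w_cong BB_\<phi> g BB_mult c prod) (use ev in \<open>simp\<close>)
  also have "\<dots> = W [:coeff g d:] * (\<Prod>l<d. wr (r l))"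
    using w_mult[OF c prod(1)] prod(2) wc_e[OF RP_coeff[OF g]] by (simp add: wc_def)
  finally show ?thesis .
qed

text \<open>\<open>Y\<close> is either transcendental or algebraic over the residue ring. In the
  algebraic case take \<open>\<mu>\<close> of least degree in the kernel: its value is a product of
  root distances, so some root sequence has distance 0 from \<open>Y\<close>; by pseudo-division
  this root kills the whole kernel.\<close>

lemma kernel_root_cases:
  "(\<forall>m z. kernel_root m z) \<or> (\<exists>a. fin a \<and> wr a = 0 \<and> (\<forall>\<^sub>F m in sequentially. kernel_root m (a m)))"
proof (cases "\<exists>d. \<exists>\<mu>\<in>RP. W \<mu> = 0 \<and> top \<mu> d")
  case False
  have "kernel_root m z" for m z
    unfolding kernel_root_def
  proof (intro ballI impI)
    fix g assume g: "g \<in> RP" "W g = 0"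
    then have "W [:coeff g i:] = 0" for i using False top_exists by blast
    then have "\<phi> m g = 0" using g by (simp add: poly_eq_iff e_null RP_coeff)
    then show "poly (\<phi> m g) z = 0" by simp
  qed
  then show ?thesis by blast
next
  case True
  define d where "d = (LEAST d. \<exists>\<mu>\<in>RP. W \<mu> = 0 \<and> top \<mu> d)"
  have "\<exists>\<mu>\<in>RP. W \<mu> = 0 \<and> top \<mu> d"
    unfolding d_def using True by (rule LeastI_ex)
  then obtain \<mu> where \<mu>: "\<mu> \<in> RP" "W \<mu> = 0" "top \<mu> d" by blast
  have least: "d \<le> d'" if "g \<in> RP" "W g = 0" "top g d'" for g d'
    unfolding d_def using that by (intro Least_le) blast
  obtain r where r: "\<And>l. fin (r l)"
    "\<forall>\<^sub>F m in sequentially. \<phi> m \<mu> = smult (e m (coeff \<mu> d)) (\<Prod>l<d. [:- r l m, 1:])"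
    using root_sequences[OF \<mu>(1,3)] by blast
  have "W [:coeff \<mu> d:] * (\<Prod>l<d. wr (r l)) = 0"
    using W_root_product[OF \<mu>(1,3) r] \<mu>(2) by simp
  then obtain l where l: "l < d" "wr (r l) = 0"
    using \<mu>(3) by (auto simp: top_def)
  have "\<forall>\<^sub>F m in sequentially. kernel_root m (r l m)"
    using r(2) top_degree[OF \<mu>(1,3)]
  proof eventually_elim
    case (elim m)
    have root: "poly (\<phi> m \<mu>) (r l m) = 0"
      using l by (subst elim(1)) (auto simp: poly_prod)
    show ?case
      unfolding kernel_root_def
    proof (intro ballI impI)
      fix g assume g: "g \<in> RP" "W g = 0"
      have "\<And>i. Suc (degree g) + d \<le> i \<Longrightarrow> W [:coeff g i:] = 0"
        using W_0 by (simp add: coeff_eq_0)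
      from pseudo_division[OF \<mu>(1,3) g(1) this] obtain N q \<rho> where *: "q \<in> RP" "\<rho> \<in> RP"
        "smult (coeff \<mu> d ^ N) g = q * \<mu> + \<rho>" "\<forall>i\<ge>d. W [:coeff \<rho> i:] = 0" by blast
      have u: "coeff \<mu> d ^ N \<in> R" by (intro R_power RP_coeff \<mu>)
      have "\<rho> = smult (coeff \<mu> d ^ N) g - q * \<mu>" using *(3) by simp
      then have "W \<rho> \<le> max (W (smult (coeff \<mu> d ^ N) g)) (W (q * \<mu>))"
        using u g * \<mu> by (subst \<open>\<rho> = _\<close>) (intro W_diff RP_smult RP_mult)
      also have "\<dots> = 0" using u g *(1,2) \<mu> by (simp add: W_smult W_mult)
      finally have "W \<rho> = 0" using W_nonneg by (simp add: antisym)
      \<comment> \<open>A coefficient of nonzero value would give the remainder, which lies in the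
        kernel, a degree below the minimal \<open>d\<close>.\<close>
      have "W [:coeff \<rho> i:] = 0" for i
      proof (rule ccontr)
        assume "W [:coeff \<rho> i:] \<noteq> 0"
        then obtain d' where d': "top \<rho> d'" using top_exists by blast
        then have "d \<le> d'" using least * \<open>W \<rho> = 0\<close> by blast
        then show False using d' *(4) by (auto simp: top_def)
      qed
      then have \<rho>0: "\<phi> m \<rho> = 0" using * by (simp add: poly_eq_iff e_null RP_coeff)
      have "\<phi> m (smult (coeff \<mu> d ^ N) g) = \<phi> m q * \<phi> m \<mu> + \<phi> m \<rho>"
        unfolding *(3) using * \<mu> by (simp add: \<phi>_add \<phi>_mult RP_mult)
      then have "poly (smult (e m (coeff \<mu> d) ^ N) (\<phi> m g)) (r l m) = 0"
        using u g \<rho>0 root by (simp add: \<phi>_smult e_power RP_coeff \<mu>)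
      then show "poly (\<phi> m g) (r l m) = 0" using elim by simp
    qed
  qed
  with l r(1) show ?thesis by blast
qed

text \<open>Let \<open>r0\<close> be the root sequence nearest to \<open>Y\<close>, at distance
  \<open>\<rho>\<close>. A point displaced from \<open>r0\<close> by a bounded multiple of
  \<rho>^(t_m), and not too close to any root, has the right distance to all of them; for roots
  farther than \<open>\<rho>\<close> the distance to \<open>r0\<close> decides, and
  \<open>joint_approximation\<close> provides it.\<close>

lemma generic_root_selection:
  assumes Z: "finite Z" "\<And>r. r \<in> Z \<Longrightarrow> fin r \<and> 0 < wr r" and \<delta>: "1 < \<delta>"
  shows "\<exists>\<^sub>F m in sequentially. \<exists>z. \<forall>r\<in>Z. near \<delta> (wr r) m (z - r m)"
proof (cases "Z = {}")
  case True
  then show ?thesis by simp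
next
  case False
  define r0 where "r0 = arg_min_on wr Z"
  have r0: "r0 \<in> Z" unfolding r0_def using Z False by (intro arg_min_if_finite(1))
  have r0_le: "wr r0 \<le> wr r" if "r \<in> Z" for r
    unfolding r0_def by (rule arg_min_least[where f = wr, OF Z(1) False that])
  define \<rho> where "\<rho> = wr r0"
  define N where "N = card Z"
  have \<rho>: "0 < \<rho>" using Z(2)[OF r0] by (simp add: \<rho>_def)
  \<comment> \<open>A precision finer than \<open>\<delta>\<close> that still separates
    \<open>\<rho>\<close> from every larger distance; the room between \<open>\<epsilon>\<close> and
    \<open>\<delta>\<close> absorbs constant factors.\<close>
  obtain \<epsilon> where \<epsilon>: "1 < \<epsilon>" "\<epsilon> < \<delta>" "\<And>r. r \<in> Z \<Longrightarrow> \<rho> < wr r \<Longrightarrow> \<rho> * \<epsilon> < wr r"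
  proof -
    have "\<forall>\<^sub>F \<epsilon> in at_right 1. \<forall>r\<in>{r\<in>Z. \<rho> < wr r}. \<rho> * \<epsilon> < wr r"
    proof (intro eventually_ball_finite ballI)
      fix r assume "r \<in> {r\<in>Z. \<rho> < wr r}"
      have "((\<lambda>\<epsilon>. \<rho> * \<epsilon>) \<longlongrightarrow> \<rho> * 1) (at_right 1)" by (intro tendsto_intros)
      then show "\<forall>\<^sub>F \<epsilon> in at_right 1. \<rho> * \<epsilon> < wr r"
        using \<open>r \<in> _\<close> by (intro order_tendstoD(2)) auto
    qed (use Z in auto)
    moreover have "\<forall>\<^sub>F \<epsilon> in at_right 1. \<epsilon> \<in> {1<..<\<delta>}"
      using \<delta> by (rule eventually_at_right_real)
    ultimately have "\<forall>\<^sub>F \<epsilon> in at_right (1::real). 1 < \<epsilon> \<and> \<epsilon> < \<delta> \<and> (\<forall>r\<in>Z. \<rho> < wr r \<longrightarrow> \<rho> * \<epsilon> < wr r)"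
      by eventually_elim auto
    then have "\<exists>\<epsilon>. 1 < \<epsilon> \<and> \<epsilon> < \<delta> \<and> (\<forall>r\<in>Z. \<rho> < wr r \<longrightarrow> \<rho> * \<epsilon> < wr r)"
      by (rule eventually_happens'[rotated]) simp
    then show ?thesis using that by blast
  qed
  define C where "C = (\<lambda>r m. r m - r0 m) ` Z"
  have wcC: "wc (\<lambda>m. r m - r0 m) \<le> wr r" "\<rho> < wr r \<Longrightarrow> wc (\<lambda>m. r m - r0 m) = wr r" if r: "r \<in> Z" for r
  proof -
    have fins: "fin r" "fin r0" using Z(2) r r0 by auto
    show 1: "wc (\<lambda>m. r m - r0 m) \<le> wr r"
      using wc_diff_le[OF fins] r0_le[OF r] by simp
    assume "\<rho> < wr r"
    then have "wr r \<le> wc (\<lambda>m. r m - r0 m)"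
      using wr_le[OF fins] by (auto simp: \<rho>_def max_def split: if_splits)
    with 1 show "wc (\<lambda>m. r m - r0 m) = wr r" by simp
  qed
  have joint: "\<exists>\<^sub>F m in sequentially. \<forall>c\<in>C.
    (0 < wc c \<longrightarrow> near \<epsilon> (wc c) m (c m)) \<and>
    (wc c = 0 \<longrightarrow> cmod (c m) \<le> \<rho> powr t m)"
    using Z r0 by (intro joint_approximation \<epsilon> \<rho>) (auto simp: C_def intro: fin_diff)
  \<comment> \<open>The factor \<open>N + 2\<close> counts at most \<open>N + 1\<close> steps of
    length \<open>p\<close> from \<open>r0\<close>, plus one for the distance between
    \<open>r0\<close> and \<open>r\<close>.\<close>
  have ev1: "\<forall>\<^sub>F m in sequentially. \<forall>r\<in>Z. (real N + 2) * (wr r * \<epsilon>) powr t m \<le> (wr r * \<delta>) powr t m"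
  proof (intro eventually_ball_finite ballI powr_dominates)
    fix r assume "r \<in> Z"
    then show "wr r * \<epsilon> < wr r * \<delta>" using \<epsilon> Z(2) by simp
  qed (use Z \<epsilon> wr_nonneg in auto)
  have ev2: "\<forall>\<^sub>F m in sequentially. 2 * (\<rho> / \<delta>) powr t m \<le> \<rho> powr t m"
    using \<rho> \<delta> by (intro powr_dominates) (auto simp: field_simps)
  have ev3: "\<forall>\<^sub>F m in sequentially. \<forall>r\<in>{r\<in>Z. \<rho> < wr r}. 2 * (wr r / \<delta>) powr t m \<le> (wr r / \<epsilon>) powr t m"
  proof (intro eventually_ball_finite ballI powr_dominates)
    fix r assume "r \<in> {r\<in>Z. \<rho> < wr r}"
    then show "wr r / \<delta> < wr r / \<epsilon>" using \<epsilon> \<delta> \<rho> by (intro divide_strict_left_mono) auto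
  qed (use Z \<delta> wr_nonneg in auto)
  \<comment> \<open>For the farther roots, half of the distance to \<open>r0\<close> has to cover
    the displacement by at most \<open>N + 1\<close> steps.\<close>
  have ev4: "\<forall>\<^sub>F m in sequentially. \<forall>r\<in>{r\<in>Z. \<rho> < wr r}. (2 * (real N + 1)) * \<rho> powr t m \<le> (wr r / \<epsilon>) powr t m"
  proof (intro eventually_ball_finite ballI powr_dominates)
    fix r assume "r \<in> {r\<in>Z. \<rho> < wr r}"
    then show "\<rho> < wr r / \<epsilon>" using \<epsilon> by (auto simp: pos_less_divide_eq)
  qed (use Z \<rho> in auto)
  note ev = eventually_conj[OF ev1 eventually_conj[OF ev2 eventually_conj[OF ev3 ev4]]]
  show ?thesis
  proof (rule frequently_rev_mp[OF joint], rule eventually_mono[OF ev], intro impI)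
    fix m
    assume A: "(\<forall>r\<in>Z. (real N + 2) * (wr r * \<epsilon>) powr t m \<le> (wr r * \<delta>) powr t m) \<and>
      2 * (\<rho> / \<delta>) powr t m \<le> \<rho> powr t m \<and>
      (\<forall>r\<in>{r\<in>Z. \<rho> < wr r}. 2 * (wr r / \<delta>) powr t m \<le> (wr r / \<epsilon>) powr t m) \<and>
      (\<forall>r\<in>{r\<in>Z. \<rho> < wr r}. (2 * (real N + 1)) * \<rho> powr t m \<le> (wr r / \<epsilon>) powr t m)"
    assume J: "\<forall>c\<in>C.
      (0 < wc c \<longrightarrow> near \<epsilon> (wc c) m (c m)) \<and>
      (wc c = 0 \<longrightarrow> cmod (c m) \<le> \<rho> powr t m)"
    define p where "p = \<rho> powr t m"
    have p: "0 < p" using \<rho> by (simp add: p_def)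
    define z where "z l = r0 m + of_nat l * of_real p" for l :: nat
    \<comment> \<open>Pigeonhole: the candidates are at least \<open>p\<close> apart, so each of the
      \<open>N\<close> roots is closer than \<open>p / 2\<close> to at most one of the
      \<open>N + 1\<close> candidates.\<close>
    have "\<exists>l\<in>{1..Suc N}. \<forall>r\<in>Z. p / 2 \<le> cmod (z l - r m)"
    proof (rule ccontr)
      assume "\<not> ?thesis"
      then have "\<forall>l\<in>{1..Suc N}. \<exists>r\<in>Z. cmod (z l - r m) < p / 2" by (auto simp: not_le)
      then obtain s where s: "\<And>l. l \<in> {1..Suc N} \<Longrightarrow> s l \<in> Z \<and> cmod (z l - s l m) < p / 2" by metis
      have "inj_on s {1..Suc N}"
      proof
        fix l l' assume l: "l \<in> {1..Suc N}" "l' \<in> {1..Suc N}" "s l = s l'"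
        have "cmod (z l - z l') < p"
          using s[OF l(1)] s[OF l(2)] l(3) norm_triangle_ineq4[of "z l - s l m" "z l' - s l' m"] by simp
        moreover have "z l - z l' = of_real ((real l - real l') * p)"
          by (simp add: z_def algebra_simps)
        ultimately have "\<bar>real l - real l'\<bar> * p < 1 * p"
          using p by (simp only: norm_of_real abs_mult)
        then have "\<bar>real l - real l'\<bar> < 1" using p by (simp only: mult_less_cancel_right_pos)
        then show "l = l'" by linarith
      qed
      then have "card {1..Suc N} \<le> card Z"
        using s Z(1) by (intro card_inj_on_le[of s]) auto
      then show False by (simp add: N_def)
    qed
    then obtain l where l: "1 \<le> l" "l \<le> Suc N" "\<And>r. r \<in> Z \<Longrightarrow> p / 2 \<le> cmod (z l - r m)" by auto
    have zr0: "cmod (z l - r0 m) \<le> (real N + 1) * p"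
      using l(2) p by (simp add: z_def norm_mult)
    show "\<exists>z. \<forall>r\<in>Z. near \<delta> (wr r) m (z - r m)"
    proof (intro exI[of _ "z l"] ballI conjI)
      fix r assume r: "r \<in> Z"
      let ?c = "\<lambda>m. r m - r0 m"
      have cC: "?c \<in> C" using r by (auto simp: C_def)
      have wrr: "0 < wr r" "\<rho> \<le> wr r" using Z(2)[OF r] r0_le[OF r] by (auto simp: \<rho>_def)
      have tri: "cmod (z l - r m) \<le> cmod (z l - r0 m) + cmod (?c m)"
        "cmod (?c m) \<le> cmod (z l - r m) + cmod (z l - r0 m)"
        using norm_triangle_ineq4[of "z l - r0 m" "r m - r0 m"]
          norm_triangle_ineq4[of "z l - r0 m" "z l - r m"] by simp_all
      have pe: "p \<le> (wr r * \<epsilon>) powr t m"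
        unfolding p_def using \<rho> wrr \<epsilon>(1) mult_mono[of \<rho> "wr r" 1 \<epsilon>] by (intro powr_t_mono) auto
      have ce: "cmod (?c m) \<le> (wr r * \<epsilon>) powr t m"
      proof (cases "wc ?c = 0")
        case True
        then have "cmod (?c m) \<le> p" using bspec[OF J cC] by (simp add: p_def)
        with pe show ?thesis by linarith
      next
        case False
        then have "0 < wc ?c" using wc_nonneg[of ?c] by simp
        then have "cmod (?c m) \<le> (wc ?c * \<epsilon>) powr t m" using bspec[OF J cC] by blast
        also have "\<dots> \<le> (wr r * \<epsilon>) powr t m"
          using wcC(1)[OF r] wc_nonneg[of ?c] \<epsilon>(1) by (intro powr_t_mono mult_right_mono) auto
        finally show ?thesis .
      qed
      have "cmod (z l - r m) \<le> (real N + 1) * p + (wr r * \<epsilon>) powr t m"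
        using tri zr0 ce by linarith
      also have "\<dots> \<le> (real N + 1) * (wr r * \<epsilon>) powr t m + (wr r * \<epsilon>) powr t m"
        using pe by (intro add_right_mono mult_left_mono) auto
      also have "\<dots> = (real N + 2) * (wr r * \<epsilon>) powr t m" by (simp add: algebra_simps)
      also have "\<dots> \<le> (wr r * \<delta>) powr t m" using A r by blast
      finally show "cmod (z l - r m) \<le> (wr r * \<delta>) powr t m" .
      show "(wr r / \<delta>) powr t m \<le> cmod (z l - r m)"
      proof (cases "\<rho> < wr r")
        case False
        then have "wr r = \<rho>" using wrr by simp
        then show ?thesis using A l(3)[OF r] by (simp add: p_def)
      next
        case True
        then have "(wr r / \<epsilon>) powr t m \<le> cmod (?c m)"
          using bspec[OF J cC] wcC(2)[OF r True] wrr by simp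
        moreover have "2 * (wr r / \<delta>) powr t m \<le> (wr r / \<epsilon>) powr t m"
          "(2 * (real N + 1)) * p \<le> (wr r / \<epsilon>) powr t m"
          using A r True unfolding p_def by blast+
        ultimately show ?thesis using tri(2) zr0 by linarith
      qed
    qed
  qed
qed

text \<open>If the kernel forces a root \<open>a\<close>, that root is the value of
  \<open>Y\<close>: since \<open>a\<close> has distance 0 from \<open>Y\<close>, its distance to any
  \<open>r\<close> equals that of \<open>Y\<close>. Otherwise the generic choice is
  available.\<close>

lemma root_selection:
  assumes Z: "finite Z" "\<And>r. r \<in> Z \<Longrightarrow> fin r \<and> 0 < wr r" and \<delta>: "1 < \<delta>"
  shows "\<exists>\<^sub>F m in sequentially. \<exists>z. kernel_root m z \<and> (\<forall>r\<in>Z. near \<delta> (wr r) m (z - r m))"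
  using kernel_root_cases
proof (elim disjE exE conjE)
  assume "\<forall>m z. kernel_root m z"
  then show ?thesis using generic_root_selection[OF assms] by simp
next
  fix a assume a: "fin a" "wr a = 0" and ev: "\<forall>\<^sub>F m in sequentially. kernel_root m (a m)"
  define C where "C = (\<lambda>r m. a m - r m) ` Z"
  have wcC: "wc (\<lambda>m. a m - r m) = wr r" if r: "r \<in> Z" for r
  proof (rule antisym)
    show "wc (\<lambda>m. a m - r m) \<le> wr r"
      using wc_diff_le[of a r] Z(2)[OF r] a wr_nonneg[of r] by simp
    have "wr r \<le> max (wr a) (wc (\<lambda>m. r m - a m))" using wr_le[of r a] Z(2)[OF r] a by simp
    also have "wc (\<lambda>m. r m - a m) = wc (\<lambda>m. a m - r m)"
      using w_minus[OF BB_const[OF fin_diff[of a r]]] Z(2)[OF r] a by (simp add: wc_def)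
    finally show "wr r \<le> wc (\<lambda>m. a m - r m)" using a wc_nonneg by simp
  qed
  have "\<exists>\<^sub>F m in sequentially. \<forall>c\<in>C.
    (0 < wc c \<longrightarrow> near \<delta> (wc c) m (c m)) \<and>
    (wc c = 0 \<longrightarrow> cmod (c m) \<le> 1 powr t m)"
    using Z a by (intro joint_approximation \<delta>) (auto simp: C_def intro: fin_diff)
  then show ?thesis
  proof (rule frequently_rev_mp, intro eventually_mono[OF ev] impI)
    fix m assume k: "kernel_root m (a m)" and J: "\<forall>c\<in>C.
      (0 < wc c \<longrightarrow> near \<delta> (wc c) m (c m)) \<and>
      (wc c = 0 \<longrightarrow> cmod (c m) \<le> 1 powr t m)"
    have "near \<delta> (wr r) m (a m - r m)"
      if r: "r \<in> Z" for r
      using J Z(2)[OF r] wcC[OF r] r by (force simp: C_def)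
    with k show "\<exists>z. kernel_root m z \<and> (\<forall>r\<in>Z. near \<delta> (wr r) m (z - r m))" by blast
  qed
qed

end

context tower_norm
begin

text \<open>Each \<open>g\<close> is its leading coefficient times linear factors, so it suffices to
  place the value of \<open>Y\<close> correctly relative to the finitely many roots of all
  \<open>g\<close> in \<open>G\<close>. These have positive distance from \<open>Y\<close> because
  \<open>W g\<close> is positive.\<close>

lemma value_selection:
  assumes G: "finite G" "\<And>g. g \<in> G \<Longrightarrow> g \<in> RP \<and> 0 < W g" and \<delta>: "1 < \<delta>"
  shows "\<exists>\<^sub>F m in sequentially. \<exists>z. kernel_root m z \<and>
    (\<forall>g\<in>G. near \<delta> (W g) m (poly (\<phi> m g) z))"
proof -
  have "\<forall>g\<in>G. \<exists>d r. top g d \<and> (\<forall>l. fin (r l)) \<and>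
      (\<forall>\<^sub>F m in sequentially. \<phi> m g = smult (e m (coeff g d)) (\<Prod>l<d. [:- r l m, 1:]))"
  proof
    fix g assume "g \<in> G"
    then have g: "g \<in> RP" "0 < W g" using G(2) by auto
    obtain d where d: "top g d" using top_exists_pos[OF g] by blast
    show "\<exists>d r. top g d \<and> (\<forall>l. fin (r l)) \<and>
      (\<forall>\<^sub>F m in sequentially. \<phi> m g = smult (e m (coeff g d)) (\<Prod>l<d. [:- r l m, 1:]))"
      using d root_sequences[OF g(1) d] by blast
  qed
  from bchoice[OF this] obtain d where "\<forall>g\<in>G. \<exists>r. top g (d g) \<and> (\<forall>l. fin (r l)) \<and>
      (\<forall>\<^sub>F m in sequentially. \<phi> m g = smult (e m (coeff g (d g))) (\<Prod>l<d g. [:- r l m, 1:]))" ..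
  from bchoice[OF this] obtain r where "\<forall>g\<in>G. top g (d g) \<and> (\<forall>l. fin (r g l)) \<and>
      (\<forall>\<^sub>F m in sequentially. \<phi> m g = smult (e m (coeff g (d g))) (\<Prod>l<d g. [:- r g l m, 1:]))" ..
  then have dr: "\<And>g. g \<in> G \<Longrightarrow> top g (d g)" "\<And>g l. g \<in> G \<Longrightarrow> fin (r g l)"
    "\<And>g. g \<in> G \<Longrightarrow> \<forall>\<^sub>F m in sequentially. \<phi> m g = smult (e m (coeff g (d g))) (\<Prod>l<d g. [:- r g l m, 1:])"
    by blast+
  define Z where "Z = (\<Union>g\<in>G. r g ` {..<d g})"
  define u where "u g = W [:coeff g (d g):]" for g
  have u: "0 < u g" if "g \<in> G" for g using dr(1)[OF that] by (simp add: top_def u_def)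
  have Wg: "W g = u g * (\<Prod>l<d g. wr (r g l))" if "g \<in> G" for g
    unfolding u_def using that G(2) by (intro W_root_product dr) auto
  have wr_pos: "0 < wr (r g l)" if "g \<in> G" "l < d g" for g l
  proof -
    have "(\<Prod>l<d g. wr (r g l)) \<noteq> 0"
    proof
      assume "(\<Prod>l<d g. wr (r g l)) = 0"
      then have "W g = 0" using Wg[OF that(1)] by (simp only: mult_zero_right)
      then show False using G(2)[OF that(1)] by simp
    qed
    then have "wr (r g l) \<noteq> 0" using that(2) by simp
    then show ?thesis using wr_nonneg[of "r g l"] by simp
  qed
  define D where "D = Max (insert 0 (d ` G))"
  have D: "d g \<le> D" if "g \<in> G" for g using G(1) that by (simp add: D_def)
  \<comment> \<open>The leading coefficient and at most \<open>D\<close> roots each contribute one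
    factor \<open>\<epsilon>\<close>, whence the root of order \<open>Suc D\<close>.\<close>
  define \<epsilon> where "\<epsilon> = root (Suc D) \<delta>"
  have \<epsilon>: "1 < \<epsilon>" using \<delta> by (simp add: \<epsilon>_def)
  have \<epsilon>_le: "\<epsilon> ^ Suc (d g) \<le> \<delta>" if "g \<in> G" for g
  proof -
    have "\<epsilon> ^ Suc (d g) \<le> \<epsilon> ^ Suc D" using \<epsilon> D[OF that] by (intro power_increasing) auto
    also have "\<dots> = \<delta>" unfolding \<epsilon>_def using \<delta> by (intro real_root_pow_pos2) auto
    finally show ?thesis .
  qed
  have ev1: "\<forall>\<^sub>F m in sequentially. \<forall>g\<in>G. \<phi> m g = smult (e m (coeff g (d g))) (\<Prod>l<d g. [:- r g l m, 1:])"
    using G(1) dr(3) by (intro eventually_ball_finite) auto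
  have ev2: "\<forall>\<^sub>F m in sequentially. \<forall>g\<in>G. cmod (e m (coeff g (d g))) \<le> (u g * \<epsilon>) powr t m"
  proof (intro eventually_ball_finite ballI)
    fix g assume g: "g \<in> G"
    then have "coeff g (d g) \<in> R" using G(2) RP_coeff by blast
    from grD[OF e_gr[OF this], of "u g * \<epsilon>"]
    show "\<forall>\<^sub>F m in sequentially. cmod (e m (coeff g (d g))) \<le> (u g * \<epsilon>) powr t m"
      using u[OF g] \<epsilon> by (simp add: u_def)
  qed (use G in auto)
  have ev3: "\<forall>\<^sub>F m in sequentially. \<forall>g\<in>G. (u g / \<epsilon>) powr t m \<le> cmod (e m (coeff g (d g)))"
  proof (intro eventually_ball_finite ballI)
    fix g assume g: "g \<in> G"
    then have "coeff g (d g) \<in> R" using G(2) RP_coeff by blast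
    from lowerD[OF e_lower[OF this], of "u g / \<epsilon>"]
    show "\<forall>\<^sub>F m in sequentially. (u g / \<epsilon>) powr t m \<le> cmod (e m (coeff g (d g)))"
      using u[OF g] \<epsilon> by (simp add: u_def pos_divide_less_eq)
  qed (use G in auto)
  have sel: "\<exists>\<^sub>F m in sequentially. \<exists>z. kernel_root m z \<and> (\<forall>r\<in>Z. near \<epsilon> (wr r) m (z - r m))"
    using G(1) dr(2) wr_pos \<epsilon> by (intro root_selection) (auto simp: Z_def)
  note ev = eventually_conj[OF ev1 eventually_conj[OF ev2 ev3]]
  show ?thesis
  proof (rule frequently_rev_mp[OF sel], rule eventually_mono[OF ev], intro impI, elim exE conjE)
    fix m z
    assume A: "\<forall>g\<in>G. \<phi> m g = smult (e m (coeff g (d g))) (\<Prod>l<d g. [:- r g l m, 1:])"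
      "\<forall>g\<in>G. cmod (e m (coeff g (d g))) \<le> (u g * \<epsilon>) powr t m"
      "\<forall>g\<in>G. (u g / \<epsilon>) powr t m \<le> cmod (e m (coeff g (d g)))"
      and k: "kernel_root m z"
      and B: "\<forall>r\<in>Z. near \<epsilon> (wr r) m (z - r m)"
    have "near \<delta> (W g) m (poly (\<phi> m g) z)"
      if g: "g \<in> G" for g
    proof -
      have val: "cmod (poly (\<phi> m g) z) = cmod (e m (coeff g (d g))) * (\<Prod>l<d g. cmod (z - r g l m))"
        by (subst bspec[OF A(1) g]) (simp add: poly_prod norm_mult prod_norm)
      have rZ: "r g l \<in> Z" if "l < d g" for l using g that by (auto simp: Z_def)
      have Wpos: "0 < W g" using G(2)[OF g] by simp
      have "cmod (poly (\<phi> m g) z) \<le> (u g * \<epsilon>) powr t m * (\<Prod>l<d g. (wr (r g l) * \<epsilon>) powr t m)"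
        unfolding val using bspec[OF A(2) g] bspec[OF B rZ]
        by (intro mult_mono prod_mono prod_nonneg) auto
      also have "\<dots> = (u g * \<epsilon> * (\<Prod>l<d g. wr (r g l) * \<epsilon>)) powr t m"
        using u[OF g] \<epsilon> wr_nonneg by (simp add: powr_mult prod_powr_distrib prod_nonneg)
      also have "u g * \<epsilon> * (\<Prod>l<d g. wr (r g l) * \<epsilon>) = W g * \<epsilon> ^ Suc (d g)"
        unfolding Wg[OF g] by (simp add: prod.distrib)
      also have "(W g * \<epsilon> ^ Suc (d g)) powr t m \<le> (W g * \<delta>) powr t m"
        using Wpos \<epsilon>_le[OF g] \<epsilon> by (intro powr_t_mono mult_left_mono mult_nonneg_nonneg) auto
      finally have up: "cmod (poly (\<phi> m g) z) \<le> (W g * \<delta>) powr t m" .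
      have "(W g / \<delta>) powr t m \<le> (W g / \<epsilon> ^ Suc (d g)) powr t m"
        using Wpos \<epsilon>_le[OF g] \<epsilon> \<delta> by (intro powr_t_mono divide_left_mono mult_pos_pos) auto
      also have "W g / \<epsilon> ^ Suc (d g) = u g / \<epsilon> * (\<Prod>l<d g. wr (r g l) / \<epsilon>)"
        unfolding Wg[OF g] by (simp add: prod_dividef)
      also have "\<dots> powr t m = (u g / \<epsilon>) powr t m * (\<Prod>l<d g. (wr (r g l) / \<epsilon>) powr t m)"
        using u[OF g] \<epsilon> wr_nonneg by (simp only: powr_mult prod_powr_distrib prod_nonneg divide_nonneg_pos)
      also have "\<dots> \<le> cmod (poly (\<phi> m g) z)"
        unfolding val using bspec[OF A(3) g] bspec[OF B rZ]
        by (intro mult_mono prod_mono prod_nonneg) auto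
      finally show ?thesis using up by blast
    qed
    with k show "\<exists>z. kernel_root m z \<and>
      (\<forall>g\<in>G. near \<delta> (W g) m (poly (\<phi> m g) z))"
      by blast
  qed
qed

end

section \<open>Subsequences that realize the extended valuation\<close>

lemma growth_subseq:
  assumes "growth t" "strict_mono \<sigma>"
  shows "growth (\<lambda>n. t (\<sigma> n))"
proof -
  interpret growth t by fact
  show ?thesis
  proof
    show "filterlim (\<lambda>n. t (\<sigma> n)) at_top sequentially"
      using filterlim_compose[OF t_top filterlim_subseq[OF assms(2)]] .
  qed (rule t_pos)
qed

lemma gr_subseq:
  assumes "growth t" "strict_mono \<sigma>" "growth.gr t c r"
  shows "growth.gr (\<lambda>n. t (\<sigma> n)) (\<lambda>n. c (\<sigma> n)) r"
  unfolding growth.gr_def[OF growth_subseq[OF assms(1,2)]]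
  using growth.grD[OF assms(1,3)] eventually_subseq[OF assms(2)] by blast

lemma lower_subseq:
  assumes "growth t" "strict_mono \<sigma>" "growth.lower t c r"
  shows "growth.lower (\<lambda>n. t (\<sigma> n)) (\<lambda>n. c (\<sigma> n)) r"
  unfolding growth.lower_def[OF growth_subseq[OF assms(1,2)]]
  using growth.lowerD[OF assms(1,3)] eventually_subseq[OF assms(2)] by blast

text \<open>At step \<open>n\<close> the first \<open>n + 1\<close> polynomials of positive value,
  in a fixed enumeration, are approximated within \<open>\<delta> n\<close>, which tends to 1; those
  of value 0 vanish at every step by \<open>kernel_root\<close>.\<close>

theorem (in tower_step) extension:
  "\<exists>\<sigma> z. strict_mono \<sigma> \<and> (\<forall>n. kernel_root (\<sigma> n) (z n)) \<and>
    (\<forall>g\<in>RP. growth.gr (\<lambda>n. t (\<sigma> n)) (\<lambda>n. poly (\<phi> (\<sigma> n) g) (z n)) (W g) \<and>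
      growth.lower (\<lambda>n. t (\<sigma> n)) (\<lambda>n. poly (\<phi> (\<sigma> n) g) (z n)) (W g))"
proof -
  obtain w where "tower_norm t R e W w" using tower_norm_exists by blast
  then interpret tower_norm t R e W w .
  define G where "G = {g\<in>RP. 0 < W g}"
  have Gc: "countable G" unfolding G_def by (rule countable_subset[OF _ RP_countable]) auto
  have "1 \<in> G" by (simp add: G_def RP_1 W_1)
  then have Gne: "G \<noteq> {}" by blast
  define \<gamma> where "\<gamma> = from_nat_into G"
  have \<gamma>: "\<gamma> i \<in> G" for i unfolding \<gamma>_def by (intro from_nat_into Gne)
  define \<delta> where "\<delta> n = 1 + 1 / real (Suc n)" for n
  define Q where "Q n m z \<longleftrightarrow> kernel_root m z \<and>
    (\<forall>i\<le>n. near (\<delta> n) (W (\<gamma> i)) m (poly (\<phi> m (\<gamma> i)) z))" for n m z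
  have "\<exists>\<^sub>F m in sequentially. \<exists>z. Q n m z" for n
  proof -
    have "\<exists>\<^sub>F m in sequentially. \<exists>z. kernel_root m z \<and>
      (\<forall>g\<in>\<gamma> ` {..n}. near (\<delta> n) (W g) m (poly (\<phi> m g) z))"
      using \<gamma> by (intro value_selection) (auto simp: \<delta>_def G_def)
    then show ?thesis
      by (rule frequently_elim1) (auto simp: Q_def)
  qed
  from subsequence_choice[of Q, OF this] obtain \<sigma> z
    where \<sigma>: "strict_mono (\<sigma> :: nat \<Rightarrow> nat)" and Q: "\<And>n. Q n (\<sigma> n) (z n)" by blast
  interpret sub: growth "\<lambda>n. t (\<sigma> n)"
    using growth_subseq[OF growth_axioms \<sigma>] .
  have kernel: "kernel_root (\<sigma> n) (z n)" for n using Q by (simp add: Q_def)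
  have \<delta>: "1 < \<delta> n" "\<And>n'. n \<le> n' \<Longrightarrow> \<delta> n' \<le> \<delta> n" for n
    by (auto simp: \<delta>_def intro: divide_left_mono)
  have \<delta>_lim: "\<exists>n. \<delta> n \<le> b" if b: "1 < b" for b
  proof -
    obtain n where "1 / real (Suc n) < b - 1" using nat_approx_posE[of "b - 1"] b by auto
    then show ?thesis by (intro exI[of _ n]) (simp add: \<delta>_def)
  qed
  have "sub.gr (\<lambda>n. poly (\<phi> (\<sigma> n) g) (z n)) (W g) \<and> sub.lower (\<lambda>n. poly (\<phi> (\<sigma> n) g) (z n)) (W g)"
    if g: "g \<in> RP" for g
  proof (cases "W g = 0")
    case True
    then have "poly (\<phi> (\<sigma> n) g) (z n) = 0" for n using kernel g by (simp add: kernel_root_def)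
    then show ?thesis using True by (simp add: sub.gr_zero sub.lower_def)
  next
    case False
    then have "g \<in> G" and Wg: "0 < W g" using g W_nonneg[of g] by (auto simp: G_def)
    then obtain i where i: "\<gamma> i = g" unfolding \<gamma>_def using from_nat_into_surj[OF Gc] by blast
    have bounds: "(W g / \<delta> n) powr t (\<sigma> n) \<le> cmod (poly (\<phi> (\<sigma> n) g) (z n))"
      "cmod (poly (\<phi> (\<sigma> n) g) (z n)) \<le> (W g * \<delta> n) powr t (\<sigma> n)" if "i \<le> n" for n
      using Q[of n] that i by (auto simp: Q_def)
    have "sub.gr (\<lambda>n. poly (\<phi> (\<sigma> n) g) (z n)) (W g)"
      unfolding sub.gr_def
    proof (intro allI impI)
      fix s assume s: "W g < s"
      then obtain n0 where n0: "\<delta> n0 \<le> s / W g" using \<delta>_lim[of "s / W g"] Wg by auto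
      show "\<forall>\<^sub>F n in sequentially. cmod (poly (\<phi> (\<sigma> n) g) (z n)) \<le> s powr t (\<sigma> n)"
        using eventually_ge_at_top[of "max i n0"]
      proof eventually_elim
        case (elim n)
        have "\<delta> n \<le> s / W g" using \<delta>(2)[of n0 n] elim n0 by simp
        then have "W g * \<delta> n \<le> s" using Wg by (simp add: pos_le_divide_eq mult.commute)
        then have "(W g * \<delta> n) powr t (\<sigma> n) \<le> s powr t (\<sigma> n)"
          using Wg \<delta>(1)[of n] by (intro powr_t_mono mult_nonneg_nonneg) auto
        with bounds(2)[of n] elim show ?case by simp
      qed
    qed
    moreover have "sub.lower (\<lambda>n. poly (\<phi> (\<sigma> n) g) (z n)) (W g)"
      unfolding sub.lower_def
    proof (intro allI impI)
      fix s assume s: "0 < s" "s < W g"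
      then obtain n0 where n0: "\<delta> n0 \<le> W g / s" using \<delta>_lim[of "W g / s"] by auto
      show "\<forall>\<^sub>F n in sequentially. s powr t (\<sigma> n) \<le> cmod (poly (\<phi> (\<sigma> n) g) (z n))"
        using eventually_ge_at_top[of "max i n0"]
      proof eventually_elim
        case (elim n)
        have "\<delta> n \<le> W g / s" using \<delta>(2)[of n0 n] elim n0 by simp
        then have "s \<le> W g / \<delta> n" using s \<delta>(1)[of n] by (simp add: field_simps)
        then have "s powr t (\<sigma> n) \<le> (W g / \<delta> n) powr t (\<sigma> n)"
          using s by (intro powr_t_mono) auto
        with bounds(1)[of n] elim show ?case by simp
      qed
    qed
    ultimately show ?thesis by blast
  qed
  then show ?thesis using \<sigma> kernel by blast
qed

context growth
begin

lemma lower_divide: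
  assumes l: "lower (\<lambda>m. a m * c m) q" and g: "gr a r" and r: "0 < r"
  shows "lower c (q / r)"
  unfolding lower_def
proof (intro allI impI)
  fix s assume s: "0 < s" "s < q / r"
  have "r < q / s" using s r by (simp add: field_simps)
  then obtain r' where r': "r < r'" "r' < q / s" using dense by blast
  have "r' * s < q" "0 < r' * s" using r' s r by (auto simp: field_simps)
  show "\<forall>\<^sub>F m in sequentially. s powr t m \<le> cmod (c m)"
    using lowerD[OF l \<open>0 < r' * s\<close> \<open>r' * s < q\<close>] grD[OF g r'(1)]
  proof eventually_elim
    case (elim m)
    have "r' powr t m * s powr t m \<le> cmod (a m) * cmod (c m)"
      using elim r' r s by (simp add: norm_mult powr_mult)
    also have "\<dots> \<le> r' powr t m * cmod (c m)" using elim by (intro mult_right_mono) auto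
    finally show ?case using r r' by simp
  qed
qed

end

section \<open>Laurent polynomials\<close>

abbreviation "keys \<equiv> Poly_Mapping.keys"
abbreviation "lookup \<equiv> Poly_Mapping.lookup"
abbreviation "single \<equiv> Poly_Mapping.single"

lemma poly_mapping_sum_single: "(\<Sum>x\<in>keys p. single x (lookup p x)) = p"
proof (rule poly_mapping_eqI)
  fix y
  have "(\<Sum>x\<in>keys p. lookup (single x (lookup p x)) y) =
      (\<Sum>x\<in>keys p. if x = y then lookup p y else 0)"
    by (intro sum.cong) (auto simp: lookup_single when_def)
  also have "\<dots> = lookup p y" by (auto simp: in_keys_iff)
  finally show "lookup (\<Sum>x\<in>keys p. single x (lookup p x)) y =
    lookup p y" by (simp add: lookup_sum)
qed

lemma countable_poly_mapping:
  fixes C :: "'b::comm_monoid_add set"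
  assumes "countable A" "countable C"
  shows "countable {p. keys p \<subseteq> A \<and> (\<forall>x. lookup p x \<in> C)}"
proof -
  define F where "F xs = (\<Sum>(x, c)\<leftarrow>xs. single x c)" for xs :: "('a \<times> 'b) list"
  have "{p. keys p \<subseteq> A \<and> (\<forall>x. lookup p x \<in> C)} \<subseteq> F ` lists (A \<times> C)"
  proof
    fix p assume p: "p \<in> {p. keys p \<subseteq> A \<and> (\<forall>x. lookup p x \<in> C)}"
    obtain xs where xs: "set xs = keys p" "distinct xs"
      using finite_distinct_list[of "keys p"] by auto
    have "F (map (\<lambda>x. (x, lookup p x)) xs) = (\<Sum>x\<leftarrow>xs. single x (lookup p x))"
      by (simp add: F_def o_def)
    also have "\<dots> = (\<Sum>x\<in>keys p. single x (lookup p x))"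
      using xs by (simp add: sum_list_distinct_conv_sum_set)
    finally have "p = F (map (\<lambda>x. (x, lookup p x)) xs)"
      by (simp add: poly_mapping_sum_single)
    then show "p \<in> F ` lists (A \<times> C)" using p xs by (intro image_eqI) auto
  qed
  then show ?thesis using assms
    by (meson countable_SIGMA countable_image countable_lists countable_subset)
qed

lemma poly_mapping_mult_sum_single:
  fixes g h :: "'e::monoid_add \<Rightarrow>\<^sub>0 'b::semiring_0"
  shows "g * h = (\<Sum>\<omega>\<in>keys g. \<Sum>\<omega>'\<in>keys h.
    single (\<omega> + \<omega>') (lookup g \<omega> * lookup h \<omega>'))"
  by (subst (1 2) poly_mapping_sum_single[symmetric]) (simp add: sum_product mult_single)

text \<open>\<open>\<theta>\<close> gives the value of each monomial: \<open>mon P\<close> for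
  Laurent polynomials, \<open>vmon v\<close> for the ordinary polynomials that define
  varieties.\<close>

definition pm_eval :: "('e \<Rightarrow> complex) \<Rightarrow> ('e \<Rightarrow>\<^sub>0 complex) \<Rightarrow> complex" where
  "pm_eval \<theta> g = (\<Sum>\<omega>\<in>keys g. lookup g \<omega> * \<theta> \<omega>)"

lemma pm_eval_superset:
  "finite D \<Longrightarrow> keys g \<subseteq> D \<Longrightarrow> pm_eval \<theta> g = (\<Sum>\<omega>\<in>D. lookup g \<omega> * \<theta> \<omega>)"
  unfolding pm_eval_def by (intro sum.mono_neutral_left) (auto simp: in_keys_iff)

lemma pm_eval_0 [simp]: "pm_eval \<theta> 0 = 0" by (simp add: pm_eval_def)

lemma pm_eval_single: "pm_eval \<theta> (single \<omega> c) = c * \<theta> \<omega>"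
  by (cases "c = 0") (simp_all add: pm_eval_def)

lemma pm_eval_add: "pm_eval \<theta> (g + h) = pm_eval \<theta> g + pm_eval \<theta> h"
proof -
  define D where "D = keys g \<union> keys h"
  have "finite D" "keys g \<subseteq> D" "keys h \<subseteq> D" "keys (g + h) \<subseteq> D"
    using Poly_Mapping.keys_add[of g h] by (auto simp: D_def)
  then show ?thesis by (simp add: pm_eval_superset lookup_add distrib_right sum.distrib)
qed

lemma pm_eval_uminus: "pm_eval \<theta> (- g) = - pm_eval \<theta> g"
  using pm_eval_add[of \<theta> g "- g"] by (simp add: eq_neg_iff_add_eq_0 add.commute)

lemma pm_eval_sum: "pm_eval \<theta> (sum f F) = (\<Sum>i\<in>F. pm_eval \<theta> (f i))"
  by (induction F rule: infinite_finite_induct) (auto simp: pm_eval_add)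

lemma pm_eval_mult:
  fixes g h :: "'e::monoid_add \<Rightarrow>\<^sub>0 complex"
  assumes "\<And>\<omega> \<omega>'. \<theta> (\<omega> + \<omega>') = \<theta> \<omega> * \<theta> \<omega>'"
  shows "pm_eval \<theta> (g * h) = pm_eval \<theta> g * pm_eval \<theta> h"
proof -
  have "pm_eval \<theta> (g * h) = (\<Sum>\<omega>\<in>keys g. \<Sum>\<omega>'\<in>keys h.
      (lookup g \<omega> * lookup h \<omega>') * \<theta> (\<omega> + \<omega>'))"
    by (subst poly_mapping_mult_sum_single) (simp add: pm_eval_sum pm_eval_single)
  also have "\<dots> = pm_eval \<theta> g * pm_eval \<theta> h"
    unfolding pm_eval_def by (simp add: assms sum_product mult_ac)
  finally show ?thesis .
qed

type_synonym 'j laurent = "('j \<Rightarrow>\<^sub>0 int) \<Rightarrow>\<^sub>0 complex"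

definition mon :: "('j \<Rightarrow> complex) \<Rightarrow> ('j \<Rightarrow>\<^sub>0 int) \<Rightarrow> complex" where
  "mon P \<omega> = (\<Prod>j\<in>keys \<omega>. P j powi lookup \<omega> j)"

definition ev :: "('j \<Rightarrow> complex) \<Rightarrow> 'j laurent \<Rightarrow> complex" where
  "ev P = pm_eval (mon P)"

lemma mon_superset:
  "finite D \<Longrightarrow> keys \<omega> \<subseteq> D \<Longrightarrow> mon P \<omega> = (\<Prod>j\<in>D. P j powi lookup \<omega> j)"
  unfolding mon_def by (intro prod.mono_neutral_left) (auto simp: in_keys_iff)

lemma mon_0 [simp]: "mon P 0 = 1" by (simp add: mon_def)

text \<open>The law for sums of integer exponents fails at 0; therefore points are taken to be
  nonzero at every index, also outside the variables in use.\<close>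

lemma mon_add:
  assumes "\<And>j. P j \<noteq> 0"
  shows "mon P (\<omega> + \<omega>') = mon P \<omega> * mon P \<omega>'"
proof -
  define D where "D = keys \<omega> \<union> keys \<omega>'"
  have "finite D" "keys \<omega> \<subseteq> D" "keys \<omega>' \<subseteq> D" "keys (\<omega> + \<omega>') \<subseteq> D"
    using Poly_Mapping.keys_add[of \<omega> \<omega>'] by (auto simp: D_def)
  then show ?thesis
    using assms by (simp add: mon_superset lookup_add power_int_add prod.distrib)
qed

lemma mon_single: "mon P (single j n) = P j powi n"
  by (cases "n = 0") (simp_all add: mon_def)

lemma ev_0 [simp]: "ev P 0 = 0" by (simp add: ev_def)

lemma ev_single: "ev P (single \<omega> c) = c * mon P \<omega>"
  by (simp add: ev_def pm_eval_single)

lemma ev_1 [simp]: "ev P 1 = 1"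
  using ev_single[of P 0 1] by simp

lemma ev_add: "ev P (g + h) = ev P g + ev P h"
  by (simp add: ev_def pm_eval_add)

lemma ev_sum: "ev P (sum f F) = (\<Sum>i\<in>F. ev P (f i))"
  by (simp add: ev_def pm_eval_sum)

lemma ev_mult: "(\<And>j. P j \<noteq> 0) \<Longrightarrow> ev P (g * h) = ev P g * ev P h"
  unfolding ev_def by (intro pm_eval_mult mon_add)

lemma ev_cong:
  assumes "\<And>j \<omega>. \<omega> \<in> keys g \<Longrightarrow> j \<in> keys \<omega> \<Longrightarrow> P j = Q j"
  shows "ev P g = ev Q g"
  unfolding ev_def pm_eval_def mon_def using assms
  by (intro sum.cong prod.cong arg_cong2[where f = times]) auto

lemma ev_uminus: "ev P (- g) = - ev P g"
  by (simp add: ev_def pm_eval_uminus)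

lemma ev_diff: "ev P (g - h) = ev P g - ev P h"
  using ev_add[of P g "- h"] by (simp add: ev_uminus)

lemma ev_power: "(\<And>j. P j \<noteq> 0) \<Longrightarrow> ev P (g ^ n) = ev P g ^ n"
  by (induction n) (auto simp: ev_mult)

lemma ev_prod: "(\<And>j. P j \<noteq> 0) \<Longrightarrow> ev P (prod f F) = (\<Prod>i\<in>F. ev P (f i))"
  by (induction F rule: infinite_finite_induct) (auto simp: ev_mult)

definition laurent_polys :: "complex set \<Rightarrow> 'j set \<Rightarrow> 'j laurent set" where
  "laurent_polys k D = {p. (\<forall>\<omega>. lookup p \<omega> \<in> k) \<and> (\<forall>\<omega>\<in>keys p. keys \<omega> \<subseteq> D)}"

definition laurent_var :: "'j \<Rightarrow> 'j laurent" where
  "laurent_var j = single (single j 1) 1"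

lemma ev_var: "ev P (laurent_var j) = P j"
  by (simp add: laurent_var_def ev_single mon_single)

lemma laurent_var_power: "laurent_var j ^ n = single (single j (int n)) 1"
  by (induction n) (auto simp: laurent_var_def mult_single single_add[symmetric] add.commute)

locale coefficient_ring =
  fixes k :: "complex set"
  assumes k_0: "0 \<in> k" and k_1: "1 \<in> k"
    and k_add: "a \<in> k \<Longrightarrow> b \<in> k \<Longrightarrow> a + b \<in> k"
    and k_mult: "a \<in> k \<Longrightarrow> b \<in> k \<Longrightarrow> a * b \<in> k"
    and k_uminus: "a \<in> k \<Longrightarrow> - a \<in> k"
begin

lemma L_single: "c \<in> k \<Longrightarrow> keys \<omega> \<subseteq> D \<Longrightarrow> single \<omega> c \<in> laurent_polys k D"
  by (auto simp: laurent_polys_def lookup_single when_def k_0 split: if_splits)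

lemma L_add: "g \<in> laurent_polys k D \<Longrightarrow> h \<in> laurent_polys k D \<Longrightarrow> g + h \<in> laurent_polys k D"
  using Poly_Mapping.keys_add[of g h] unfolding laurent_polys_def by (fastforce simp: lookup_add k_add)

lemma L_0: "0 \<in> laurent_polys k D"
  by (simp add: laurent_polys_def k_0)

lemma L_1: "1 \<in> laurent_polys k D"
  using L_single[OF k_1, of 0 D] by simp

lemma L_uminus: "g \<in> laurent_polys k D \<Longrightarrow> - g \<in> laurent_polys k D"
  by (auto simp: laurent_polys_def k_uminus in_keys_iff)

lemma L_diff: "g \<in> laurent_polys k D \<Longrightarrow> h \<in> laurent_polys k D \<Longrightarrow> g - h \<in> laurent_polys k D"
  using L_add[of g D "- h"] L_uminus[of h D] by simp

lemma L_sum: "(\<And>i. i \<in> F \<Longrightarrow> f i \<in> laurent_polys k D) \<Longrightarrow> sum f F \<in> laurent_polys k D"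
  by (induction F rule: infinite_finite_induct) (auto intro: L_0 L_add)

lemma L_mult:
  assumes "g \<in> laurent_polys k D" "h \<in> laurent_polys k D"
  shows "g * h \<in> laurent_polys k D"
proof (subst poly_mapping_mult_sum_single, intro L_sum L_single k_mult)
  fix \<omega> \<omega>' assume "\<omega> \<in> keys g" "\<omega>' \<in> keys h"
  then show "keys (\<omega> + \<omega>') \<subseteq> D"
    using assms Poly_Mapping.keys_add[of \<omega> \<omega>'] unfolding laurent_polys_def by fast
qed (use assms in \<open>auto simp: laurent_polys_def\<close>)

lemma L_power: "g \<in> laurent_polys k D \<Longrightarrow> g ^ n \<in> laurent_polys k D"
  by (induction n) (auto intro: L_1 L_mult)

lemma L_prod: "(\<And>i. i \<in> F \<Longrightarrow> f i \<in> laurent_polys k D) \<Longrightarrow> prod f F \<in> laurent_polys k D"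
  by (induction F rule: infinite_finite_induct) (auto intro: L_1 L_mult)

lemma L_var: "j \<in> D \<Longrightarrow> laurent_var j \<in> laurent_polys k D"
  unfolding laurent_var_def by (intro L_single k_1) simp

lemma L_mono: "D \<subseteq> D' \<Longrightarrow> laurent_polys k D \<subseteq> laurent_polys k D'"
  by (auto simp: laurent_polys_def)

lemma L_countable:
  assumes "countable k" "finite D"
  shows "countable (laurent_polys k (D :: 'j set))"
proof -
  have "countable {\<omega> :: 'j \<Rightarrow>\<^sub>0 int. keys \<omega> \<subseteq> D \<and> (\<forall>x. lookup \<omega> x \<in> UNIV)}"
    by (rule countable_poly_mapping[OF countable_finite[OF assms(2)] countableI_type])
  then have "countable {p :: 'j laurent. keys p \<subseteq> {\<omega>. keys \<omega> \<subseteq> D} \<and> (\<forall>x. lookup p x \<in> k)}"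
    using assms(1) by (intro countable_poly_mapping) auto
  then show ?thesis by (rule countable_subset[rotated]) (auto simp: laurent_polys_def)
qed

lemma L_poly: "(\<And>i. coeff g i \<in> laurent_polys k D) \<Longrightarrow> a \<in> laurent_polys k D \<Longrightarrow> poly g a \<in> laurent_polys k D"
  unfolding poly_altdef by (intro L_sum L_mult L_power) auto

text \<open>After multiplication by a power of the variable all its exponents are nonnegative, and a
  Laurent polynomial in the variables \<open>insert j D\<close> becomes a polynomial in one variable
  over the ring for \<open>D\<close>, which is the shape \<open>tower_step\<close> works
  with.\<close>

lemma clear_denominators:
  fixes h :: "'j laurent"
  assumes h: "h \<in> laurent_polys k (insert j D)" and j: "j \<notin> D"
  shows "\<exists>N g. (\<forall>i. coeff g i \<in> laurent_polys k D) \<and> laurent_var j ^ N * h = poly g (laurent_var j)"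
proof -
  define N where "N = (\<Sum>\<omega>\<in>keys h. nat \<bar>lookup \<omega> j\<bar>)"
  define n where "n \<omega> = nat (lookup \<omega> j + int N)" for \<omega> :: "'j \<Rightarrow>\<^sub>0 int"
  define r where "r \<omega> = \<omega> - single j (lookup \<omega> j)" for \<omega> :: "'j \<Rightarrow>\<^sub>0 int"
  define g where "g = (\<Sum>\<omega>\<in>keys h. monom (single (r \<omega>) (lookup h \<omega>)) (n \<omega>))"
  have term_eq: "laurent_var j ^ N * single \<omega> (lookup h \<omega>) =
      single (r \<omega>) (lookup h \<omega>) * laurent_var j ^ n \<omega>"
    if "\<omega> \<in> keys h" for \<omega>
  proof -
    have "nat \<bar>lookup \<omega> j\<bar> \<le> N"
      unfolding N_def using that by (intro member_le_sum) auto
    then have "int (n \<omega>) = lookup \<omega> j + int N" by (simp add: n_def)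
    then have "single j (int N) + \<omega> = r \<omega> + single j (int (n \<omega>))"
      by (simp add: r_def single_add)
    then show ?thesis by (simp add: laurent_var_power mult_single)
  qed
  have "laurent_var j ^ N * h = (\<Sum>\<omega>\<in>keys h. laurent_var j ^ N * single \<omega> (lookup h \<omega>))"
    by (subst poly_mapping_sum_single[of h, symmetric]) (simp add: sum_distrib_left)
  also have "\<dots> = (\<Sum>\<omega>\<in>keys h. single (r \<omega>) (lookup h \<omega>) * laurent_var j ^ n \<omega>)"
    using term_eq by (intro sum.cong) auto
  also have "\<dots> = poly g (laurent_var j)" by (simp add: g_def poly_sum poly_monom)
  finally have "laurent_var j ^ N * h = poly g (laurent_var j)" .
  moreover have "coeff g i \<in> laurent_polys k D" for i
  proof -
    have "single (r \<omega>) (lookup h \<omega>) \<in> laurent_polys k D" if \<omega>: "\<omega> \<in> keys h" for \<omega>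
    proof (rule L_single)
      show "lookup h \<omega> \<in> k" using h by (simp add: laurent_polys_def)
      have "x \<in> D" if "x \<in> keys (r \<omega>)" for x
      proof -
        have ne: "lookup (r \<omega>) x \<noteq> 0" using that by (simp add: in_keys_iff)
        then have "x \<noteq> j" by (auto simp: r_def lookup_minus)
        then have "x \<in> keys \<omega>" using ne by (auto simp: r_def lookup_minus lookup_single in_keys_iff)
        then show ?thesis using h \<omega> \<open>x \<noteq> j\<close> by (auto simp: laurent_polys_def)
      qed
      then show "keys (r \<omega>) \<subseteq> D" by blast
    qed
    then show ?thesis unfolding g_def by (auto simp: coeff_sum L_0 intro!: L_sum)
  qed
  ultimately show ?thesis by blast
qed

end

lemma ev_poly:
  assumes "\<And>j. P j \<noteq> 0"
  shows "ev P (poly g a) = poly (map_poly (ev P) g) (ev P a)"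
  by (induction g) (simp_all add: ev_add ev_mult[OF assms] map_poly_pCons)

section \<open>Points approximating a valuation\<close>

locale laurent_valuation = coefficient_ring k for k +
  fixes J :: "'j set" and v :: "'j laurent \<Rightarrow> real"
  assumes k_countable: "countable k" and J_finite: "finite J"
    and v_nonneg: "0 \<le> v g" and v_0: "v 0 = 0" and v_1: "v 1 = 1"
    and v_add: "g \<in> laurent_polys k J \<Longrightarrow> h \<in> laurent_polys k J \<Longrightarrow> v (g + h) \<le> max (v g) (v h)"
    and v_mult: "g \<in> laurent_polys k J \<Longrightarrow> h \<in> laurent_polys k J \<Longrightarrow> v (g * h) = v g * v h"
    and v_const: "c \<in> k \<Longrightarrow> c \<noteq> 0 \<Longrightarrow> v (single 0 c) = 1"
    and v_var: "j \<in> J \<Longrightarrow> 0 < v (laurent_var j)"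
begin

text \<open>The two growth bounds say that the t_m-th root of \<open>cmod (ev (P m) g)\<close> tends
  to \<open>v g\<close>. An element of value 0 vanishes at every index, not only eventually, because
  \<open>e_null\<close> asks for this when the next variable is adjoined.\<close>

definition approximates :: "'j set \<Rightarrow> (nat \<Rightarrow> real) \<Rightarrow> (nat \<Rightarrow> 'j \<Rightarrow> complex) \<Rightarrow> bool" where
  "approximates D t P \<longleftrightarrow> growth t \<and> (\<forall>m j. P m j \<noteq> 0) \<and>
     (\<forall>g\<in>laurent_polys k D. growth.gr t (\<lambda>m. ev (P m) g) (v g) \<and> growth.lower t (\<lambda>m. ev (P m) g) (v g) \<and>
        (v g = 0 \<longrightarrow> (\<forall>m. ev (P m) g = 0)))"

lemma v_power: "g \<in> laurent_polys k J \<Longrightarrow> v (g ^ n) = v g ^ n"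
  by (induction n) (auto simp: v_1 v_mult L_power)

text \<open>Without variables the ring is \<open>k\<close>, on which \<open>v\<close> is trivial; a
  nonzero constant has growth rate 1, whichever \<open>t\<close> tending to infinity is
  taken.\<close>

lemma approximates_empty: "\<exists>t P. approximates {} t P"
proof (intro exI)
  define t where "t m = real (Suc m)" for m
  interpret growth t
  proof
    show "0 < t m" for m by (simp add: t_def)
    show "filterlim t at_top sequentially"
      unfolding t_def by (rule filterlim_compose[OF filterlim_real_sequentially filterlim_Suc])
  qed
  have "gr (\<lambda>m. ev (\<lambda>j. 1) g) (v g) \<and> lower (\<lambda>m. ev (\<lambda>j. 1) g) (v g) \<and> (v g = 0 \<longrightarrow> ev (\<lambda>j. 1) g = 0)"
    if g: "g \<in> laurent_polys k {}" for g
  proof -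
    define c where "c = lookup g 0"
    have c: "c \<in> k" using g by (simp add: laurent_polys_def c_def)
    have "lookup g \<omega> = 0" if "\<omega> \<noteq> 0" for \<omega>
      using g that by (auto simp: laurent_polys_def in_keys_iff)
    then have gc: "g = single 0 c"
      by (intro poly_mapping_eqI) (auto simp: lookup_single when_def c_def)
    have "ev (\<lambda>j. 1) g = c" by (simp add: gc ev_single)
    then show ?thesis
      using v_const[OF c] v_0 gc gr_const[of c] lower_const[of c] gr_zero[of 0]
      by (cases "c = 0") (auto simp: lower_def)
  qed
  then show "approximates {} t (\<lambda>m j. 1)"
    unfolding approximates_def using growth_axioms by simp
qed

lemma approximates_insert:
  assumes D: "D \<subseteq> J" and j: "j \<in> J" "j \<notin> D" and tP: "approximates D t P"
  shows "\<exists>t P. approximates (insert j D) t P"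
proof -
  interpret growth t using tP by (simp add: approximates_def)
  define R where "R = laurent_polys k D"
  define x where "x = laurent_var j"
  define W where "W g = v (poly g x)" for g
  have P: "P m i \<noteq> 0" for m i using tP by (simp add: approximates_def)
  have RJ: "R \<subseteq> laurent_polys k J" unfolding R_def using D by (rule L_mono)
  have xJ: "x \<in> laurent_polys k J" unfolding x_def using j by (intro L_var)
  have polyJ: "poly g x \<in> laurent_polys k J" if "\<forall>i. coeff g i \<in> R" for g
    using that RJ xJ by (intro L_poly) auto
  interpret tower_step t R "\<lambda>m. ev (P m)" W
  proof
    show "countable R" unfolding R_def
      by (rule L_countable[OF k_countable finite_subset[OF D J_finite]])
    show "gr (\<lambda>m. ev (P m) a) (W [:a:])" "lower (\<lambda>m. ev (P m) a) (W [:a:])" if "a \<in> R" for a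
      using tP that by (auto simp: approximates_def R_def W_def)
    show "ev (P m) a = 0" if "a \<in> R" "W [:a:] = 0" for a m
      using tP that by (auto simp: approximates_def R_def W_def)
    show "W (g + h) \<le> max (W g) (W h)" if "\<forall>i. coeff g i \<in> R" "\<forall>i. coeff h i \<in> R" for g h
      unfolding W_def poly_add by (intro v_add polyJ that)
    show "W (g * h) = W g * W h" if "\<forall>i. coeff g i \<in> R" "\<forall>i. coeff h i \<in> R" for g h
      unfolding W_def poly_mult by (intro v_mult polyJ that)
  qed (auto simp: R_def W_def L_0 L_1 L_add L_mult L_uminus ev_add ev_mult P v_nonneg v_0 v_1)
  obtain \<sigma> z where \<sigma>: "strict_mono \<sigma>" and ker: "\<And>n. kernel_root (\<sigma> n) (z n)"
    and val: "\<And>g. g \<in> RP \<Longrightarrow> growth.gr (\<lambda>n. t (\<sigma> n)) (\<lambda>n. poly (\<phi> (\<sigma> n) g) (z n)) (W g) \<and>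
      growth.lower (\<lambda>n. t (\<sigma> n)) (\<lambda>n. poly (\<phi> (\<sigma> n) g) (z n)) (W g)"
    using extension by blast
  have g1: "growth (\<lambda>n. t (\<sigma> n))" using growth_subseq[OF growth_axioms \<sigma>] .
  have vx: "0 < v x" unfolding x_def by (rule v_var[OF j(1)])
  have "growth.lower (\<lambda>n. t (\<sigma> n)) z (v x)"
    using val[OF RP_X] by (simp add: \<phi>_X W_def)
  then have "\<forall>\<^sub>F n in sequentially. z n \<noteq> 0"
    by (rule growth.lower_nonzero[OF g1 _ vx])
  \<comment> \<open>The positive lower growth rate makes the new coordinate nonzero only eventually;
    finitely many indices are dropped to have it nonzero throughout.\<close>
  then obtain n0 where n0: "\<And>n. n0 \<le> n \<Longrightarrow> z n \<noteq> 0" by (auto simp: eventually_sequentially)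
  define \<tau> where "\<tau> n = \<sigma> (n + n0)" for n
  define y where "y n = z (n + n0)" for n
  have shift: "strict_mono (\<lambda>n. n + n0)" by (simp add: strict_mono_def)
  interpret sub: growth "\<lambda>n. t (\<tau> n)"
    unfolding \<tau>_def by (rule growth_subseq[OF g1 shift])
  have y: "y n \<noteq> 0" for n using n0 by (simp add: y_def)
  have val': "sub.gr (\<lambda>n. poly (\<phi> (\<tau> n) g) (y n)) (W g)" "sub.lower (\<lambda>n. poly (\<phi> (\<tau> n) g) (y n)) (W g)"
    if "g \<in> RP" for g
    using gr_subseq[OF g1 shift] lower_subseq[OF g1 shift] val[OF that] unfolding \<tau>_def y_def by blast+
  define P' where "P' n = (P (\<tau> n))(j := y n)" for n
  have P': "P' n i \<noteq> 0" for n i using P y by (simp add: P'_def)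
  have evR: "ev (P' n) a = ev (P (\<tau> n)) a" if "a \<in> R" for a n
    using that j(2) by (intro ev_cong) (auto simp: P'_def R_def laurent_polys_def)
  have evx: "ev (P' n) x = y n" for n by (simp add: x_def ev_var P'_def)
  have evpoly: "ev (P' n) (poly g x) = poly (\<phi> (\<tau> n) g) (y n)" if "g \<in> RP" for g n
  proof -
    have "map_poly (ev (P' n)) g = \<phi> (\<tau> n) g"
      using RP_coeff[OF that] by (simp add: poly_eq_iff coeff_map_poly evR)
    then show ?thesis using ev_poly[of "P' n" g x, OF P'] evx by simp
  qed
  have "sub.gr (\<lambda>n. ev (P' n) h) (v h) \<and> sub.lower (\<lambda>n. ev (P' n) h) (v h) \<and>
      (v h = 0 \<longrightarrow> (\<forall>n. ev (P' n) h = 0))" if h: "h \<in> laurent_polys k (insert j D)" for h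
  proof -
    obtain N g where g: "\<And>i. coeff g i \<in> laurent_polys k D" and eq: "x ^ N * h = poly g x"
      using clear_denominators[OF h j(2)] unfolding x_def by blast
    have gRP: "g \<in> RP" using g unfolding RP_def by (simp add: R_def)
    have hJ: "h \<in> laurent_polys k J" using h L_mono[of "insert j D" J] D j(1) by blast
    have Wg: "W g = v x ^ N * v h"
      using v_mult[OF L_power[OF xJ] hJ] v_power[OF xJ] by (simp add: W_def eq[symmetric])
    have xN: "monom 1 N \<in> RP" "W (monom 1 N) = v x ^ N"
      using RP_monom[OF R_1] v_power[OF xJ] by (auto simp: W_def poly_monom)
    have \<phi>N: "\<phi> m (monom 1 N) = monom 1 N" for m
      by (simp add: poly_eq_iff)
    have yN: "sub.gr (\<lambda>n. y n ^ N) (v x ^ N)" "sub.lower (\<lambda>n. y n ^ N) (v x ^ N)"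
      using val'[OF xN(1)] xN(2) by (simp_all add: \<phi>N poly_monom)
    have val_eq: "poly (\<phi> (\<tau> n) g) (y n) = y n ^ N * ev (P' n) h" for n
      using evpoly[OF gRP, of n] by (simp add: eq[symmetric] ev_mult[OF P'] ev_power[OF P'] evx)
    have pos: "0 < v x ^ N" using vx by simp
    \<comment> \<open>The power of the variable that cleared denominators is divided out again; this
      uses that both its growth bounds are known.\<close>
    have "sub.gr (\<lambda>n. ev (P' n) h) (v x ^ N * v h / v x ^ N)"
      using val'(1)[OF gRP] vx v_nonneg[of h]
      by (intro sub.gr_divide[OF yN(2) pos]) (auto simp: Wg val_eq)
    moreover have "sub.lower (\<lambda>n. ev (P' n) h) (v x ^ N * v h / v x ^ N)"
      using val'(2)[OF gRP] by (intro sub.lower_divide[OF _ yN(1) pos]) (auto simp: Wg val_eq)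
    moreover have "ev (P' n) h = 0" if "v h = 0" for n
    proof -
      have "poly (\<phi> (\<tau> n) g) (y n) = 0"
        using ker[of "n + n0"] gRP that by (simp add: kernel_root_def Wg \<tau>_def y_def)
      then show ?thesis using y by (simp add: val_eq)
    qed
    ultimately show ?thesis using vx by simp
  qed
  then have "approximates (insert j D) (\<lambda>n. t (\<tau> n)) P'"
    unfolding approximates_def using sub.growth_axioms P' by simp
  then show ?thesis by blast
qed

theorem approximation_exists: "\<exists>t P. approximates J t P"
proof -
  have "\<exists>t P. approximates D t P" if "finite D" "D \<subseteq> J" for D
    using that
  proof (induction D rule: finite_induct)
    case empty
    show ?case by (rule approximates_empty)
  next
    case (insert j D)
    then obtain t P where "approximates D t P" by auto
    with insert show ?case by (intro approximates_insert) auto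
  qed
  then show ?thesis using J_finite by blast
qed

corollary approximating_points:
  obtains t P where "growth t" "\<And>m j. P m j \<noteq> 0"
    and "\<And>m g. g \<in> laurent_polys k J \<Longrightarrow> v g = 0 \<Longrightarrow> ev (P m) g = 0"
    and "\<And>j. j \<in> J \<Longrightarrow> (\<lambda>m. ln (cmod (P m j)) / t m) \<longlonglongrightarrow> ln (v (laurent_var j))"
proof -
  obtain t P where tP: "approximates J t P" using approximation_exists by blast
  interpret growth t using tP by (simp add: approximates_def)
  have P: "P m j \<noteq> 0" for m j using tP by (simp add: approximates_def)
  have lim: "(\<lambda>m. ln (cmod (P m j)) / t m) \<longlonglongrightarrow> ln (v (laurent_var j))" if j: "j \<in> J" for j
  proof -
    define r where "r = v (laurent_var j)"
    have r: "0 < r" using v_var[OF j] by (simp add: r_def)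
    have g: "gr (\<lambda>m. P m j) r" and l: "lower (\<lambda>m. P m j) r"
      using tP L_var[OF j] by (auto simp: approximates_def ev_var r_def)
    show ?thesis
      unfolding r_def[symmetric]
    proof (rule order_tendstoI)
      fix a assume a: "ln r < a"
      then obtain b where b: "ln r < b" "b < a" using dense by blast
      then have "r < exp b" using r by (metis exp_less_mono exp_ln)
      from grD[OF g this] show "\<forall>\<^sub>F m in sequentially. ln (cmod (P m j)) / t m < a"
      proof eventually_elim
        case (elim m)
        have "ln (cmod (P m j)) \<le> ln (exp b powr t m)" using elim P by (intro ln_mono) auto
        also have "\<dots> = b * t m" by (simp add: ln_powr)
        finally show ?case using t_pos[of m] b
          by (simp add: pos_divide_less_eq) (meson le_less_trans mult_strict_right_mono)
      qed
    next
      fix a assume a: "a < ln r"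
      then obtain b where b: "a < b" "b < ln r" using dense by blast
      then have "exp b < r" using r by (metis exp_less_mono exp_ln)
      from lowerD[OF l _ this] have "\<forall>\<^sub>F m in sequentially. exp b powr t m \<le> cmod (P m j)" by simp
      then show "\<forall>\<^sub>F m in sequentially. a < ln (cmod (P m j)) / t m"
      proof eventually_elim
        case (elim m)
        have "b * t m = ln (exp b powr t m)" by (simp add: ln_powr)
        also have "\<dots> \<le> ln (cmod (P m j))" using elim P by (intro ln_mono) auto
        finally show ?case using t_pos[of m] b
          by (simp add: pos_less_divide_eq) (meson less_le_trans mult_strict_right_mono)
      qed
    qed
  qed
  show ?thesis
    using that[OF growth_axioms P _ lim] tP by (auto simp: approximates_def)
qed

end

section \<open>The valuation of a tropical point\<close>

lemma exponent_pairing_superset: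
  "finite D \<Longrightarrow> keys \<omega> \<subseteq> D \<Longrightarrow>
    exponent_pairing x \<omega> = (\<Sum>j\<in>D. x j * real_of_int (lookup \<omega> j))"
  unfolding exponent_pairing_def by (intro sum.mono_neutral_left) (auto simp: in_keys_iff)

lemma exponent_pairing_0 [simp]: "exponent_pairing x 0 = 0"
  by (simp add: exponent_pairing_def)

lemma exponent_pairing_add: "exponent_pairing x (\<omega> + \<omega>') = exponent_pairing x \<omega> + exponent_pairing x \<omega>'"
proof -
  define D where "D = keys \<omega> \<union> keys \<omega>'"
  have "finite D" "keys \<omega> \<subseteq> D" "keys \<omega>' \<subseteq> D" "keys (\<omega> + \<omega>') \<subseteq> D"
    using Poly_Mapping.keys_add[of \<omega> \<omega>'] by (auto simp: D_def)
  then show ?thesis by (simp add: exponent_pairing_superset lookup_add distrib_left sum.distrib)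
qed

lemma exponent_pairing_single: "exponent_pairing x (single j 1) = x j"
  by (simp add: exponent_pairing_def)

lemma tropical_hypersurface_iff:
  assumes "finite A"
  shows "x \<in> tropical_hypersurface J A \<longleftrightarrow> x \<in> topspace (powertop_real J) \<and>
    (\<forall>w\<in>A. \<exists>\<omega>\<in>A - {w}. exponent_pairing x w \<le> exponent_pairing x \<omega>)"
proof -
  have "ereal (exponent_pairing x w) \<le> tropical_poly B x \<longleftrightarrow>
      (\<exists>\<omega>\<in>B. exponent_pairing x w \<le> exponent_pairing x \<omega>)" if B: "finite B" for B w
  proof (cases "B = {}")
    case True
    then show ?thesis by (simp add: tropical_poly_def bot_ereal_def)
  next
    case False
    have "tropical_poly B x = Max ((\<lambda>\<omega>. ereal (exponent_pairing x \<omega>)) ` B)"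
      unfolding tropical_poly_def using B False by (simp add: Max_Sup)
    then show ?thesis using B False by (simp add: Max_ge_iff)
  qed
  then show ?thesis using assms by (simp add: tropical_hypersurface_def)
qed

text \<open>\<open>M\<close> consists of the balls of the quotient norm modulo \<open>I\<close>, a
  representative being measured by its largest weight; the terms with nonzero coefficient are the
  multipliers. Elements of \<open>I\<close> lie in \<open>M 0\<close> and so get value 0, while
  nonzero constants have weight 1, which makes the valuation trivial on \<open>k\<close>.\<close>

lemma (in coefficient_ring) seminorm_of_tropical_point:
  fixes J :: "'j set" and I :: "'j laurent set"
  assumes countable: "countable k" and J: "finite J"
    and I_L: "I \<subseteq> laurent_polys k J" and I_0: "0 \<in> I"
    and I_add: "\<And>g h. g \<in> I \<Longrightarrow> h \<in> I \<Longrightarrow> g + h \<in> I"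
    and I_mult: "\<And>g h. g \<in> laurent_polys k J \<Longrightarrow> h \<in> I \<Longrightarrow> g * h \<in> I"
    and trop: "\<And>p w. p \<in> I \<Longrightarrow> w \<in> keys p \<Longrightarrow>
      \<exists>\<omega>\<in>keys p - {w}. exponent_pairing x w \<le> exponent_pairing x \<omega>"
  obtains v where "laurent_valuation k J v" "\<And>g. g \<in> I \<Longrightarrow> v g = 0"
    "\<And>j. j \<in> J \<Longrightarrow> v (laurent_var j) = exp (x j)"
proof -
  define wt where "wt \<omega> = exp (exponent_pairing x \<omega>)" for \<omega> :: "'j \<Rightarrow>\<^sub>0 int"
  have wt_add: "wt (\<omega> + \<omega>') = wt \<omega> * wt \<omega>'" for \<omega> \<omega>'
    by (simp add: wt_def exponent_pairing_add exp_add)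
  have wt_pos: "0 < wt \<omega>" for \<omega> by (simp add: wt_def)
  define M where "M q = {a \<in> laurent_polys k J. \<exists>i\<in>I. \<forall>\<omega>\<in>keys (a - i). wt \<omega> \<le> q}" for q
  define S where "S = {(single \<omega> c, wt \<omega>) | \<omega> c. c \<in> k \<and> c \<noteq> 0 \<and> keys \<omega> \<subseteq> J}"
  have in_L: "a \<in> laurent_polys k J" if "a \<in> M q" for a q using that by (simp add: M_def)
  have MI: "a \<in> M q" if "a \<in> laurent_polys k J" "i \<in> I" "\<And>\<omega>. \<omega> \<in> keys (a - i) \<Longrightarrow> wt \<omega> \<le> q" for a i q
    using that by (auto simp: M_def)
  have ME: "\<exists>i\<in>I. \<forall>\<omega>\<in>keys (a - i). wt \<omega> \<le> q" if "a \<in> M q" for a q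
    using that by (simp add: M_def)
  have S_elem: "single \<omega> c \<in> M (wt \<omega>)" if "c \<in> k" "keys \<omega> \<subseteq> J" for \<omega> c
    using that I_0 by (intro MI[of _ 0] L_single) (auto split: if_splits)
  interpret filtered_ring M S
  proof
    show "0 \<in> M q" for q using L_0 I_0 by (intro MI[of 0 0]) auto
    show "1 \<in> M 1" using L_1 I_0 by (intro MI[of 1 0]) (auto simp: wt_def)
    show "M q \<subseteq> M q'" if "q \<le> q'" for q q' using that unfolding M_def by fastforce
    show "a + b \<in> M q" if a: "a \<in> M q" and b: "b \<in> M q" for a b q
    proof -
      obtain i where i: "i \<in> I" "\<forall>\<omega>\<in>keys (a - i). wt \<omega> \<le> q" using ME[OF a] by blast
      obtain i' where i': "i' \<in> I" "\<forall>\<omega>\<in>keys (b - i'). wt \<omega> \<le> q" using ME[OF b] by blast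
      have "a + b - (i + i') = (a - i) + (b - i')" by simp
      then have "keys (a + b - (i + i')) \<subseteq> keys (a - i) \<union> keys (b - i')"
        using Poly_Mapping.keys_add[of "a - i" "b - i'"] by (simp only: \<open>a + b - _ = _\<close>)
      then show ?thesis using i i' in_L[OF a] in_L[OF b] by (intro MI[of "a + b" "i + i'"] L_add I_add) auto
    qed
    show "a * b \<in> M (q * q')" if q: "0 \<le> q" "0 \<le> q'" and a: "a \<in> M q" and b: "b \<in> M q'" for a b q q'
    proof -
      obtain i where i: "i \<in> I" "\<forall>\<omega>\<in>keys (a - i). wt \<omega> \<le> q" using ME[OF a] by blast
      obtain i' where i': "i' \<in> I" "\<forall>\<omega>\<in>keys (b - i'). wt \<omega> \<le> q'" using ME[OF b] by blast
      have iL: "i \<in> laurent_polys k J" "i' \<in> laurent_polys k J" using i i' I_L by auto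
      \<comment> \<open>The product of the reduced representatives represents the product, and the
        correction stays in the ideal.\<close>
      have eq: "a * b - (b * i + (a - i) * i') = (a - i) * (b - i')" by (simp add: algebra_simps)
      have "b * i + (a - i) * i' \<in> I"
        using i i' iL in_L[OF a] in_L[OF b] by (intro I_add I_mult L_diff)
      moreover have "wt \<omega> \<le> q * q'" if om: "\<omega> \<in> keys (a * b - (b * i + (a - i) * i'))" for \<omega>
      proof -
        obtain \<omega>1 \<omega>2 where *: "\<omega> = \<omega>1 + \<omega>2" "\<omega>1 \<in> keys (a - i)" "\<omega>2 \<in> keys (b - i')"
          using om Poly_Mapping.keys_mult[of "a - i" "b - i'"] unfolding eq by blast
        then have "wt \<omega>1 \<le> q" "wt \<omega>2 \<le> q'" using i i' by auto
        then show ?thesis unfolding *(1) wt_add using q wt_pos[of \<omega>2] by (intro mult_mono) auto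
      qed
      ultimately show ?thesis using in_L[OF a] in_L[OF b]
        by (intro MI[of "a * b" "b * i + (a - i) * i'"] L_mult) auto
    qed
    show "0 < r \<and> s \<in> M r" if "(s, r) \<in> S" for s r using that S_elem wt_pos by (auto simp: S_def)
    show "(1, 1) \<in> S" using k_1 by (auto simp: S_def wt_def intro!: exI[of _ 0] exI[of _ 1])
    show "(s * s', r * r') \<in> S" if s: "(s, r) \<in> S" and s': "(s', r') \<in> S" for s r s' r'
    proof -
      obtain \<omega> c where 1: "s = single \<omega> c" "r = wt \<omega>" "c \<in> k" "c \<noteq> 0" "keys \<omega> \<subseteq> J"
        using s by (auto simp: S_def)
      obtain \<omega>' c' where 2: "s' = single \<omega>' c'" "r' = wt \<omega>'" "c' \<in> k" "c' \<noteq> 0" "keys \<omega>' \<subseteq> J"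
        using s' by (auto simp: S_def)
      have "keys (\<omega> + \<omega>') \<subseteq> J" using 1 2 Poly_Mapping.keys_add[of \<omega> \<omega>'] by auto
      then show ?thesis
        using 1 2 k_mult unfolding S_def
        by (auto simp: mult_single wt_add intro!: exI[of _ "\<omega> + \<omega>'"] exI[of _ "c * c'"])
    qed
    \<comment> \<open>The tropical condition enters here: if a term is congruent to an element of
      smaller weights, some \<open>i\<close> in \<open>I\<close> has to cancel it, but
      \<open>i\<close> contains another term of at least the same weight, and that one survives in
      \<open>s - i\<close>.\<close>
    show "r \<le> q" if s: "(s, r) \<in> S" and M: "s \<in> M q" for s r q
    proof (rule ccontr)
      assume "\<not> r \<le> q"
      obtain \<omega> c where 1: "s = single \<omega> c" "r = wt \<omega>" "c \<noteq> 0"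
        using s by (auto simp: S_def)
      obtain i where i: "i \<in> I" "\<And>\<omega>'. \<omega>' \<in> keys (s - i) \<Longrightarrow> wt \<omega>' \<le> q"
        using ME[OF M] by blast
      have "\<omega> \<notin> keys (s - i)" using i(2)[of \<omega>] \<open>\<not> r \<le> q\<close> 1 by auto
      then have "lookup i \<omega> = c"
        using 1 by (simp add: in_keys_iff lookup_minus)
      then have "\<omega> \<in> keys i" using 1 by (simp add: in_keys_iff)
      then obtain \<omega>' where w: "\<omega>' \<in> keys i" "\<omega>' \<noteq> \<omega>" "exponent_pairing x \<omega> \<le> exponent_pairing x \<omega>'"
        using trop[OF i(1)] by blast
      have "\<omega>' \<in> keys (s - i)"
        using w 1 by (simp add: in_keys_iff lookup_minus lookup_single)
      then have "wt \<omega>' \<le> q" by (rule i(2))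
      then show False using w(3) \<open>\<not> r \<le> q\<close> 1 by (auto simp: wt_def not_le dest: le_less_trans)
    qed
  qed
  obtain w where w: "\<And>a. 0 \<le> w a"
    "\<And>a b. a \<in> B \<Longrightarrow> b \<in> B \<Longrightarrow> w (a + b) \<le> max (w a) (w b)"
    "\<And>a b. a \<in> B \<Longrightarrow> b \<in> B \<Longrightarrow> w (a * b) = w a * w b"
    "\<And>a q. 0 \<le> q \<Longrightarrow> a \<in> M q \<Longrightarrow> w a \<le> q"
    "\<And>s r. (s, r) \<in> S \<Longrightarrow> w s = r"
    by (rule multiplicative_seminorm) (rule that, assumption+)
  have LB: "a \<in> B" if "a \<in> laurent_polys k J" for a
  proof -
    define q where "q = (\<Sum>\<omega>\<in>keys a. wt \<omega>)"
    have "wt \<omega> \<le> q" if "\<omega> \<in> keys a" for \<omega>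
      unfolding q_def using that wt_pos by (intro member_le_sum) (auto intro: less_imp_le)
    then have "a \<in> M q" using that I_0 by (intro MI[of a 0]) auto
    moreover have "0 \<le> q" unfolding q_def using wt_pos by (intro sum_nonneg) (auto intro: less_imp_le)
    ultimately show ?thesis by (auto simp: B_def)
  qed
  have wI: "w g = 0" if "g \<in> I" for g
    using w(4)[of 0 g] w(1)[of g] MI[of g g 0] that I_L by auto
  have w_S: "w (single \<omega> c) = wt \<omega>" if "c \<in> k" "c \<noteq> 0" "keys \<omega> \<subseteq> J" for \<omega> c
    using that by (intro w(5)) (auto simp: S_def)
  have wvar: "w (laurent_var j) = exp (x j)" if "j \<in> J" for j
    unfolding laurent_var_def using w_S[OF k_1, of "single j 1"] that
    by (simp add: wt_def exponent_pairing_single)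
  have "laurent_valuation k J w"
  proof
    show "w 1 = 1" using w_S[OF k_1, of 0] by (simp add: wt_def)
    show "w 0 = 0" using wI I_0 by blast
    show "w (single 0 c) = 1" if "c \<in> k" "c \<noteq> 0" for c
      using w_S[OF that, of 0] by (simp add: wt_def)
    show "0 < w (laurent_var j)" if "j \<in> J" for j using wvar[OF that] by simp
  qed (use w LB countable J in auto)
  then show ?thesis using that wI wvar by blast
qed

section \<open>The localized coordinate ring as a ring of functions\<close>

text \<open>A ring whose elements are determined by complex values on \<open>D\<close>, so that
  every axiom can be checked pointwise. Negation is an existence statement because the additive
  inverse has its meaning only once the additive group is known. Instances are the coordinate ring
  on \<open>V\<close> and its localization on \<open>V'\<close>.\<close>

locale pointwise_ring =
  fixes R :: "('a, 'm) ring_scheme" (structure) and val :: "'a \<Rightarrow> 'x \<Rightarrow> complex" and D :: "'x set"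
  assumes zero_in: "\<zero> \<in> carrier R" and one_in: "\<one> \<in> carrier R"
    and add_in: "a \<in> carrier R \<Longrightarrow> b \<in> carrier R \<Longrightarrow> a \<oplus> b \<in> carrier R"
    and mult_in: "a \<in> carrier R \<Longrightarrow> b \<in> carrier R \<Longrightarrow> a \<otimes> b \<in> carrier R"
    and val_zero: "x \<in> D \<Longrightarrow> val \<zero> x = 0" and val_one: "x \<in> D \<Longrightarrow> val \<one> x = 1"
    and val_add: "a \<in> carrier R \<Longrightarrow> b \<in> carrier R \<Longrightarrow> x \<in> D \<Longrightarrow> val (a \<oplus> b) x = val a x + val b x"
    and val_mult: "a \<in> carrier R \<Longrightarrow> b \<in> carrier R \<Longrightarrow> x \<in> D \<Longrightarrow> val (a \<otimes> b) x = val a x * val b x"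
    and val_neg: "a \<in> carrier R \<Longrightarrow> \<exists>b\<in>carrier R. \<forall>x\<in>D. val b x = - val a x"
    and val_inj: "a \<in> carrier R \<Longrightarrow> b \<in> carrier R \<Longrightarrow> (\<And>x. x \<in> D \<Longrightarrow> val a x = val b x) \<Longrightarrow> a = b"
begin

lemma is_cring: "cring R"
proof (intro cringI abelian_groupI comm_monoidI)
  fix a assume a: "a \<in> carrier R"
  obtain b where b: "b \<in> carrier R" "\<forall>x\<in>D. val b x = - val a x" using val_neg[OF a] by blast
  then have "b \<oplus> a = \<zero>"
    using a by (intro val_inj add_in zero_in) (auto simp: val_add val_zero)
  with b show "\<exists>b\<in>carrier R. b \<oplus> a = \<zero>" by blast
qed (auto intro!: val_inj add_in mult_in zero_in one_in
    simp: val_add val_mult val_zero val_one add_in mult_in zero_in one_in algebra_simps)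

end

sublocale pointwise_ring \<subseteq> cring R
  by (rule is_cring)

context pointwise_ring
begin

lemma val_a_inv:
  assumes "a \<in> carrier R" "x \<in> D"
  shows "val (\<ominus> a) x = - val a x"
proof -
  have "val (a \<oplus> \<ominus> a) x = 0" using assms by (simp add: r_neg val_zero)
  then show ?thesis using assms by (simp add: val_add eq_neg_iff_add_eq_0 add.commute)
qed

lemma val_minus: "a \<in> carrier R \<Longrightarrow> b \<in> carrier R \<Longrightarrow> x \<in> D \<Longrightarrow> val (a \<ominus> b) x = val a x - val b x"
  by (simp add: a_minus_def val_add val_a_inv)

lemma val_finsum:
  assumes "finite F" "g \<in> F \<rightarrow> carrier R" "x \<in> D"
  shows "val (\<Oplus>i\<in>F. g i) x = (\<Sum>i\<in>F. val (g i) x)"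
  using assms
proof (induction F rule: finite_induct)
  case (insert a F)
  then have "g \<in> F \<rightarrow> carrier R" "g a \<in> carrier R" by auto
  with insert show ?case by (simp add: finsum_insert val_add)
qed (simp add: val_zero)

lemma val_finprod:
  assumes "finite F" "g \<in> F \<rightarrow> carrier R" "x \<in> D"
  shows "val (\<Otimes>i\<in>F. g i) x = (\<Prod>i\<in>F. val (g i) x)"
  using assms
proof (induction F rule: finite_induct)
  case (insert a F)
  then have "g \<in> F \<rightarrow> carrier R" "g a \<in> carrier R" by auto
  with insert show ?case by (simp add: finprod_insert val_mult)
qed (simp add: val_one)

lemma val_nat_pow: "a \<in> carrier R \<Longrightarrow> x \<in> D \<Longrightarrow> val (a [^] (n::nat)) x = val a x ^ n"
  by (induction n) (simp_all add: val_one val_mult)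

lemma val_inv:
  assumes "a \<in> Units R" "x \<in> D"
  shows "val (inv a) x = inverse (val a x)"
proof -
  have a: "a \<in> carrier R" "inv a \<in> carrier R" using assms by auto
  have "val a x * val (inv a) x = 1"
    using val_mult[OF a assms(2)] assms by (simp add: val_one)
  then show ?thesis by (metis inverse_unique)
qed

lemma Units_nat_pow: "a \<in> Units R \<Longrightarrow> a [^] (n::nat) \<in> Units R"
  by (induction n) auto

lemma int_pow_cases:
  fixes n :: int
  obtains (nonneg) m where "n = int m" "a [^] n = a [^] m"
  | (neg) m where "n = - int m" "a [^] n = inv (a [^] m)"
proof (cases "n < 0")
  case True
  then show ?thesis using neg[of "nat (- n)"] int_pow_def2[of R a n] by (simp only: if_True)
next
  case False
  then show ?thesis using nonneg[of "nat n"] int_pow_def2[of R a n] by (simp only: if_False)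
qed

lemma int_pow_in:
  assumes "a \<in> Units R"
  shows "a [^] (n::int) \<in> carrier R"
  by (rule int_pow_cases[of n a]) (use Units_nat_pow[OF assms] Units_closed[OF assms] in auto)

lemma val_int_pow:
  assumes "a \<in> Units R" "x \<in> D"
  shows "val (a [^] (n::int)) x = val a x powi n"
proof (rule int_pow_cases[of n a])
  show ?thesis if "n = int m" "a [^] n = a [^] m" for m
    unfolding that(2) unfolding that(1) using assms by (simp add: val_nat_pow Units_closed)
  show ?thesis if "n = - int m" "a [^] n = inv (a [^] m)" for m
    unfolding that(2) unfolding that(1)
    using assms by (simp add: val_inv[OF Units_nat_pow] val_nat_pow Units_closed power_int_minus)
qed

end

section \<open>Ordinary polynomials and the coordinate ring\<close>

definition vmon :: "complex ^ 'n \<Rightarrow> ('n::finite \<Rightarrow>\<^sub>0 nat) \<Rightarrow> complex" where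
  "vmon v m = (\<Prod>i\<in>UNIV. (v $ i) ^ lookup m i)"

lemma poly_eval_altdef: "poly_eval p v = pm_eval (vmon v) p"
  by (simp add: poly_eval_def pm_eval_def vmon_def)

lemma vmon_add: "vmon v (m + m') = vmon v m * vmon v m'"
  by (simp add: vmon_def lookup_add power_add prod.distrib)

lemma vmon_0: "vmon v 0 = 1" by (simp add: vmon_def)

lemma vmon_single: "vmon v (single i 1) = v $ i"
proof -
  have "vmon v (single i 1) = (\<Prod>l\<in>UNIV. if l = i then v $ l else 1)"
    unfolding vmon_def by (intro prod.cong) (auto simp: lookup_single when_def)
  then show ?thesis by simp
qed

lemma poly_eval_mult: "poly_eval (p * q) v = poly_eval p v * poly_eval q v"
  unfolding poly_eval_altdef by (intro pm_eval_mult vmon_add)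

context coefficient_ring
begin

lemma polys_over_single: "c \<in> k \<Longrightarrow> single m c \<in> polys_over k"
  by (auto simp: polys_over_def lookup_single when_def k_0)

lemma polys_over_0: "0 \<in> polys_over k"
  by (simp add: polys_over_def k_0)

lemma polys_over_add: "p \<in> polys_over k \<Longrightarrow> q \<in> polys_over k \<Longrightarrow> p + q \<in> polys_over k"
  by (simp add: polys_over_def lookup_add k_add)

lemma polys_over_uminus: "p \<in> polys_over k \<Longrightarrow> - p \<in> polys_over k"
  by (simp add: polys_over_def k_uminus)

lemma polys_over_sum: "(\<And>i. i \<in> F \<Longrightarrow> p i \<in> polys_over k) \<Longrightarrow> sum p F \<in> polys_over k"
  by (induction F rule: infinite_finite_induct) (auto intro: polys_over_0 polys_over_add)

lemma polys_over_mult: "p \<in> polys_over k \<Longrightarrow> q \<in> polys_over k \<Longrightarrow> p * q \<in> polys_over k"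
  by (subst poly_mapping_mult_sum_single)
    (intro polys_over_sum polys_over_single k_mult; simp add: polys_over_def)

end

locale variety_family = coefficient_ring k for k +
  fixes V :: "(complex ^ 'n::finite) set" and J :: "'j set" and f :: "'j \<Rightarrow> complex ^ 'n \<Rightarrow> complex"
  assumes finite_J: "finite J" and generating: "generating_family k V J f"
begin

abbreviation CR where "CR \<equiv> coordinate_ring k V"
abbreviation V' where "V' \<equiv> nonvanishing_part V J f"
abbreviation MS where "MS \<equiv> family_mult_set k V J f"

lemma carrier_CR: "carrier CR = (\<lambda>p. restrict (poly_eval p) V) ` polys_over k"
  by (simp add: coordinate_ring_def)

lemma CR_elem: "p \<in> polys_over k \<Longrightarrow> restrict (poly_eval p) V \<in> carrier CR"
  by (simp add: carrier_CR)

lemma CR_ops: "a \<otimes>\<^bsub>CR\<^esub> b = (\<lambda>x\<in>V. a x * b x)" "a \<oplus>\<^bsub>CR\<^esub> b = (\<lambda>x\<in>V. a x + b x)"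
  "\<one>\<^bsub>CR\<^esub> = (\<lambda>x\<in>V. 1)" "\<zero>\<^bsub>CR\<^esub> = (\<lambda>x\<in>V. 0)"
  by (simp_all add: coordinate_ring_def)

lemma CR_const: "c \<in> k \<Longrightarrow> (\<lambda>x\<in>V. c) \<in> carrier CR"
proof -
  assume "c \<in> k"
  moreover have "poly_eval (single 0 c) = (\<lambda>x :: complex ^ 'n. c)"
    by (rule ext) (simp add: poly_eval_altdef pm_eval_single vmon_0)
  ultimately show ?thesis using CR_elem[OF polys_over_single, of c 0] by simp
qed

sublocale CR: pointwise_ring CR "\<lambda>a. a" V
proof
  show "\<zero>\<^bsub>CR\<^esub> \<in> carrier CR" "\<one>\<^bsub>CR\<^esub> \<in> carrier CR"
    unfolding CR_ops by (auto intro: CR_const k_0 k_1)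
  fix a b assume "a \<in> carrier CR" "b \<in> carrier CR"
  then obtain p q where p: "p \<in> polys_over k" "a = restrict (poly_eval p) V"
    and q: "q \<in> polys_over k" "b = restrict (poly_eval q) V" by (auto simp: carrier_CR)
  have "a \<oplus>\<^bsub>CR\<^esub> b = restrict (poly_eval (p + q)) V"
    unfolding CR_ops p q by (auto simp: poly_eval_altdef pm_eval_add)
  then show "a \<oplus>\<^bsub>CR\<^esub> b \<in> carrier CR" using CR_elem[OF polys_over_add] p q by simp
  have "a \<otimes>\<^bsub>CR\<^esub> b = restrict (poly_eval (p * q)) V"
    unfolding CR_ops p q by (auto simp: poly_eval_mult)
  then show "a \<otimes>\<^bsub>CR\<^esub> b \<in> carrier CR" using CR_elem[OF polys_over_mult] p q by simp
  show "\<exists>b\<in>carrier CR. \<forall>x\<in>V. b x = - a x"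
    using CR_elem[OF polys_over_uminus[OF p(1)]]
    by (rule bexI[rotated]) (simp add: p poly_eval_altdef pm_eval_uminus)
  show "a = b" if "\<And>x. x \<in> V \<Longrightarrow> a x = b x"
    using that unfolding p q by (intro restrict_ext) auto
qed (auto simp: CR_ops)

lemma f_CR: "j \<in> J \<Longrightarrow> f j \<in> carrier CR"
  using generating by (auto simp: generating_family_def)

lemma V'_V: "x \<in> V' \<Longrightarrow> x \<in> V" and V'_nz: "x \<in> V' \<Longrightarrow> j \<in> J \<Longrightarrow> f j x \<noteq> 0"
  by (auto simp: nonvanishing_part_def)

lemma MS_least: "submonoid T CR \<Longrightarrow> f ` J \<subseteq> T \<Longrightarrow> MS \<subseteq> T"
  unfolding family_mult_set_def by (intro hull_minimal)

lemma MS_CR: "s \<in> MS \<Longrightarrow> s \<in> carrier CR"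
  using MS_least[of "carrier CR"] f_CR by (force simp: submonoid_def)

lemma submonoid_MS: "submonoid MS CR"
proof -
  have inter: "submonoid (\<Inter>C) CR" if C: "\<forall>T\<in>C. submonoid T CR" "C \<noteq> {}" for C
  proof
    show "\<Inter>C \<subseteq> carrier CR" using C submonoid.subset by fastforce
    show "x \<otimes>\<^bsub>CR\<^esub> y \<in> \<Inter>C" if "x \<in> \<Inter>C" "y \<in> \<Inter>C" for x y
      using C that submonoid.m_closed by fastforce
    show "\<one>\<^bsub>CR\<^esub> \<in> \<Inter>C" using C submonoid.one_closed by fastforce
  qed
  have "carrier CR \<in> {T. submonoid T CR \<and> f ` J \<subseteq> T}"
    using f_CR by (auto simp: submonoid_def)
  then have "{T. submonoid T CR \<and> f ` J \<subseteq> T} \<noteq> {}" by blast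
  then show ?thesis unfolding family_mult_set_def hull_def by (intro inter) simp_all
qed

lemma MS_mult: "s \<in> MS \<Longrightarrow> t \<in> MS \<Longrightarrow> s \<otimes>\<^bsub>CR\<^esub> t \<in> MS"
  and MS_one: "\<one>\<^bsub>CR\<^esub> \<in> MS"
  using submonoid.m_closed[OF submonoid_MS] submonoid.one_closed[OF submonoid_MS] by auto

lemma MS_f: "j \<in> J \<Longrightarrow> f j \<in> MS"
  unfolding family_mult_set_def using hull_subset[of "f ` J"] by blast

lemma MS_nonzero: "s \<in> MS \<Longrightarrow> x \<in> V' \<Longrightarrow> s x \<noteq> 0"
proof -
  assume s: "s \<in> MS" and x: "x \<in> V'"
  have "submonoid {s \<in> carrier CR. s x \<noteq> 0} CR"
    using V'_V[OF x] by unfold_locales (auto simp: CR.val_mult CR.val_one)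
  then have "MS \<subseteq> {s \<in> carrier CR. s x \<noteq> 0}"
    using f_CR V'_nz[OF x] by (intro MS_least) auto
  with s show ?thesis by blast
qed

lemma MS_product: "\<exists>u\<in>MS. \<forall>x\<in>V. u x = (\<Prod>j\<in>J. f j x)"
proof -
  have "\<exists>u\<in>MS. \<forall>x\<in>V. u x = (\<Prod>j\<in>F. f j x)" if "finite F" "F \<subseteq> J" for F
    using that
  proof (induction F rule: finite_induct)
    case empty
    show ?case using MS_one by (intro bexI[of _ "\<one>\<^bsub>CR\<^esub>"]) (auto simp: CR_ops)
  next
    case (insert j F)
    then obtain u where "u \<in> MS" "\<forall>x\<in>V. u x = (\<Prod>j\<in>F. f j x)" by auto
    with insert show ?case
      by (intro bexI[of _ "f j \<otimes>\<^bsub>CR\<^esub> u"] MS_mult MS_f) (auto simp: CR_ops)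
  qed
  then show ?thesis using finite_J by blast
qed

text \<open>Multiplying by the product of all \<open>f j\<close> kills everything that vanishes on \<open>V'\<close>; so
  fractions are determined by their values on \<open>V'\<close>.\<close>

lemma fraction_eq:
  assumes a: "a \<in> carrier CR" and s: "s \<in> MS"
  shows "fraction CR MS a s = {(b, t) \<in> carrier CR \<times> MS. \<forall>x\<in>V'. b x / t x = a x / s x}"
proof -
  have "(\<exists>u\<in>MS. u \<otimes>\<^bsub>CR\<^esub> (a \<otimes>\<^bsub>CR\<^esub> t \<ominus>\<^bsub>CR\<^esub> b \<otimes>\<^bsub>CR\<^esub> s) = \<zero>\<^bsub>CR\<^esub>) \<longleftrightarrow> (\<forall>x\<in>V'. b x / t x = a x / s x)"
    if b: "b \<in> carrier CR" and t: "t \<in> MS" for b t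
  proof -
    note in_CR = a b MS_CR[OF s] MS_CR[OF t]
    have val: "(u \<otimes>\<^bsub>CR\<^esub> (a \<otimes>\<^bsub>CR\<^esub> t \<ominus>\<^bsub>CR\<^esub> b \<otimes>\<^bsub>CR\<^esub> s)) x = u x * (a x * t x - b x * s x)"
      if "u \<in> MS" "x \<in> V" for u x
      using that in_CR MS_CR[OF that(1)] by (simp add: CR.val_mult CR.val_minus)
    have cross: "b x / t x = a x / s x \<longleftrightarrow> a x * t x - b x * s x = 0" if "x \<in> V'" for x
      using MS_nonzero[OF s that] MS_nonzero[OF t that] by (auto simp: field_simps)
    show ?thesis
    proof
      assume "\<exists>u\<in>MS. u \<otimes>\<^bsub>CR\<^esub> (a \<otimes>\<^bsub>CR\<^esub> t \<ominus>\<^bsub>CR\<^esub> b \<otimes>\<^bsub>CR\<^esub> s) = \<zero>\<^bsub>CR\<^esub>"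
      then obtain u where u: "u \<in> MS" "u \<otimes>\<^bsub>CR\<^esub> (a \<otimes>\<^bsub>CR\<^esub> t \<ominus>\<^bsub>CR\<^esub> b \<otimes>\<^bsub>CR\<^esub> s) = \<zero>\<^bsub>CR\<^esub>" by blast
      show "\<forall>x\<in>V'. b x / t x = a x / s x"
      proof
        fix x assume x: "x \<in> V'"
        have "u x * (a x * t x - b x * s x) = 0"
          using val[OF u(1) V'_V[OF x]] u(2) CR.val_zero[OF V'_V[OF x]] by simp
        then show "b x / t x = a x / s x" using MS_nonzero[OF u(1) x] cross[OF x] by simp
      qed
    next
      assume eq: "\<forall>x\<in>V'. b x / t x = a x / s x"
      obtain u where u: "u \<in> MS" "\<forall>x\<in>V. u x = (\<Prod>j\<in>J. f j x)" using MS_product by blast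
      have "u x * (a x * t x - b x * s x) = 0" if x: "x \<in> V" for x
      proof (cases "x \<in> V'")
        case True
        then show ?thesis using eq cross by simp
      next
        case False
        then have "u x = 0" using u(2) x finite_J by (auto simp: nonvanishing_part_def)
        then show ?thesis by simp
      qed
      then have "u \<otimes>\<^bsub>CR\<^esub> (a \<otimes>\<^bsub>CR\<^esub> t \<ominus>\<^bsub>CR\<^esub> b \<otimes>\<^bsub>CR\<^esub> s) = \<zero>\<^bsub>CR\<^esub>"
        using in_CR MS_CR[OF u(1)] val[OF u(1)] by (intro CR.val_inj) (auto simp: CR.val_zero)
      with u(1) show "\<exists>u\<in>MS. u \<otimes>\<^bsub>CR\<^esub> (a \<otimes>\<^bsub>CR\<^esub> t \<ominus>\<^bsub>CR\<^esub> b \<otimes>\<^bsub>CR\<^esub> s) = \<zero>\<^bsub>CR\<^esub>" by blast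
    qed
  qed
  then show ?thesis unfolding fraction_def by blast
qed

section \<open>Fractions as functions on the nonvanishing part\<close>

abbreviation LR where "LR \<equiv> localized_coordinate_ring k V J f"

text \<open>Any representative may be chosen: by \<open>fraction_eq\<close> all pairs in a class
  have the same quotient at the points of \<open>V'\<close>.\<close>

definition frac_val where "frac_val F x = (case SOME p. p \<in> F of (a, s) \<Rightarrow> a x / s x)"

lemma frac_self: "a \<in> carrier CR \<Longrightarrow> s \<in> MS \<Longrightarrow> (a, s) \<in> fraction CR MS a s"
  by (simp add: fraction_eq)

lemma frac_cong:
  "a \<in> carrier CR \<Longrightarrow> s \<in> MS \<Longrightarrow> b \<in> carrier CR \<Longrightarrow> t \<in> MS \<Longrightarrow>
     (\<And>x. x \<in> V' \<Longrightarrow> a x / s x = b x / t x) \<Longrightarrow> fraction CR MS a s = fraction CR MS b t"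
  by (simp add: fraction_eq)

lemma frac_val_fraction:
  assumes "a \<in> carrier CR" "s \<in> MS" "x \<in> V'"
  shows "frac_val (fraction CR MS a s) x = a x / s x"
proof -
  have "(SOME p. p \<in> fraction CR MS a s) \<in> fraction CR MS a s"
    using frac_self[OF assms(1,2)] by (rule someI)
  then obtain b t where bt: "(SOME p. p \<in> fraction CR MS a s) = (b, t)" "(b, t) \<in> fraction CR MS a s"
    by (metis surj_pair)
  then have "b x / t x = a x / s x" using assms by (simp add: fraction_eq)
  then show ?thesis by (simp add: frac_val_def bt(1))
qed

lemma LR_carrierE:
  assumes "F \<in> carrier LR"
  obtains a s where "a \<in> carrier CR" "s \<in> MS" "F = fraction CR MS a s"
  using assms by (auto simp: localized_coordinate_ring_def localization_def)

lemma LR_carrierI: "a \<in> carrier CR \<Longrightarrow> s \<in> MS \<Longrightarrow> fraction CR MS a s \<in> carrier LR"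
  by (auto simp: localized_coordinate_ring_def localization_def)

text \<open>The product is a union over all pairs of representatives; it is a single class because
  every pair yields the same fraction.\<close>

lemma LR_mult:
  assumes "a \<in> carrier CR" "s \<in> MS" "b \<in> carrier CR" "t \<in> MS"
  shows "fraction CR MS a s \<otimes>\<^bsub>LR\<^esub> fraction CR MS b t = fraction CR MS (a \<otimes>\<^bsub>CR\<^esub> b) (s \<otimes>\<^bsub>CR\<^esub> t)"
proof -
  have "fraction CR MS (a' \<otimes>\<^bsub>CR\<^esub> b') (s' \<otimes>\<^bsub>CR\<^esub> t') = fraction CR MS (a \<otimes>\<^bsub>CR\<^esub> b) (s \<otimes>\<^bsub>CR\<^esub> t)"
    if "(a', s') \<in> fraction CR MS a s" "(b', t') \<in> fraction CR MS b t" for a' s' b' t'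
  proof (rule frac_cong)
    have *: "a' \<in> carrier CR" "s' \<in> MS" "b' \<in> carrier CR" "t' \<in> MS"
      "\<And>x. x \<in> V' \<Longrightarrow> a' x / s' x = a x / s x" "\<And>x. x \<in> V' \<Longrightarrow> b' x / t' x = b x / t x"
      using that assms by (auto simp: fraction_eq)
    show "a' \<otimes>\<^bsub>CR\<^esub> b' \<in> carrier CR" "s' \<otimes>\<^bsub>CR\<^esub> t' \<in> MS" using * MS_mult by auto
    fix x assume x: "x \<in> V'"
    have "(a' \<otimes>\<^bsub>CR\<^esub> b') x / (s' \<otimes>\<^bsub>CR\<^esub> t') x = (a' x / s' x) * (b' x / t' x)"
      using V'_V[OF x] by (simp add: CR_ops)
    also have "\<dots> = (a x / s x) * (b x / t x)" using * x by simp
    also have "\<dots> = (a \<otimes>\<^bsub>CR\<^esub> b) x / (s \<otimes>\<^bsub>CR\<^esub> t) x" using V'_V[OF x] by (simp add: CR_ops)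
    finally show "(a' \<otimes>\<^bsub>CR\<^esub> b') x / (s' \<otimes>\<^bsub>CR\<^esub> t') x = (a \<otimes>\<^bsub>CR\<^esub> b) x / (s \<otimes>\<^bsub>CR\<^esub> t) x" .
  qed (use assms MS_mult in auto)
  then have "(\<Union>(a', s')\<in>fraction CR MS a s. \<Union>(b', t')\<in>fraction CR MS b t.
      fraction CR MS (a' \<otimes>\<^bsub>CR\<^esub> b') (s' \<otimes>\<^bsub>CR\<^esub> t')) = fraction CR MS (a \<otimes>\<^bsub>CR\<^esub> b) (s \<otimes>\<^bsub>CR\<^esub> t)"
    using frac_self[OF assms(1,2)] frac_self[OF assms(3,4)] by fast
  then show ?thesis by (simp add: localized_coordinate_ring_def localization_def)
qed

lemma LR_add:
  assumes "a \<in> carrier CR" "s \<in> MS" "b \<in> carrier CR" "t \<in> MS"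
  shows "fraction CR MS a s \<oplus>\<^bsub>LR\<^esub> fraction CR MS b t =
    fraction CR MS (a \<otimes>\<^bsub>CR\<^esub> t \<oplus>\<^bsub>CR\<^esub> b \<otimes>\<^bsub>CR\<^esub> s) (s \<otimes>\<^bsub>CR\<^esub> t)"
proof -
  have val: "(a \<otimes>\<^bsub>CR\<^esub> t \<oplus>\<^bsub>CR\<^esub> b \<otimes>\<^bsub>CR\<^esub> s) x / (s \<otimes>\<^bsub>CR\<^esub> t) x = a x / s x + b x / t x"
    if "s \<in> MS" "t \<in> MS" "x \<in> V'" for a s b t x
    using V'_V[OF that(3)] MS_nonzero[OF that(1,3)] MS_nonzero[OF that(2,3)]
    by (simp add: CR_ops add_divide_distrib)
  have "fraction CR MS (a' \<otimes>\<^bsub>CR\<^esub> t' \<oplus>\<^bsub>CR\<^esub> b' \<otimes>\<^bsub>CR\<^esub> s') (s' \<otimes>\<^bsub>CR\<^esub> t') =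
      fraction CR MS (a \<otimes>\<^bsub>CR\<^esub> t \<oplus>\<^bsub>CR\<^esub> b \<otimes>\<^bsub>CR\<^esub> s) (s \<otimes>\<^bsub>CR\<^esub> t)"
    if "(a', s') \<in> fraction CR MS a s" "(b', t') \<in> fraction CR MS b t" for a' s' b' t'
  proof (rule frac_cong)
    have *: "a' \<in> carrier CR" "s' \<in> MS" "b' \<in> carrier CR" "t' \<in> MS"
      "\<And>x. x \<in> V' \<Longrightarrow> a' x / s' x = a x / s x" "\<And>x. x \<in> V' \<Longrightarrow> b' x / t' x = b x / t x"
      using that assms by (auto simp: fraction_eq)
    show "a' \<otimes>\<^bsub>CR\<^esub> t' \<oplus>\<^bsub>CR\<^esub> b' \<otimes>\<^bsub>CR\<^esub> s' \<in> carrier CR" "s' \<otimes>\<^bsub>CR\<^esub> t' \<in> MS"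
      using * MS_mult MS_CR by auto
    show "(a' \<otimes>\<^bsub>CR\<^esub> t' \<oplus>\<^bsub>CR\<^esub> b' \<otimes>\<^bsub>CR\<^esub> s') x / (s' \<otimes>\<^bsub>CR\<^esub> t') x =
        (a \<otimes>\<^bsub>CR\<^esub> t \<oplus>\<^bsub>CR\<^esub> b \<otimes>\<^bsub>CR\<^esub> s) x / (s \<otimes>\<^bsub>CR\<^esub> t) x" if "x \<in> V'" for x
      using * assms that by (simp add: val)
  qed (use assms MS_mult MS_CR in auto)
  then have "(\<Union>(a', s')\<in>fraction CR MS a s. \<Union>(b', t')\<in>fraction CR MS b t.
      fraction CR MS (a' \<otimes>\<^bsub>CR\<^esub> t' \<oplus>\<^bsub>CR\<^esub> b' \<otimes>\<^bsub>CR\<^esub> s') (s' \<otimes>\<^bsub>CR\<^esub> t')) =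
      fraction CR MS (a \<otimes>\<^bsub>CR\<^esub> t \<oplus>\<^bsub>CR\<^esub> b \<otimes>\<^bsub>CR\<^esub> s) (s \<otimes>\<^bsub>CR\<^esub> t)"
    using frac_self[OF assms(1,2)] frac_self[OF assms(3,4)] by fast
  then show ?thesis by (simp add: localized_coordinate_ring_def localization_def)
qed

lemma LR_zero: "\<zero>\<^bsub>LR\<^esub> = fraction CR MS \<zero>\<^bsub>CR\<^esub> \<one>\<^bsub>CR\<^esub>"
  and LR_one: "\<one>\<^bsub>LR\<^esub> = fraction CR MS \<one>\<^bsub>CR\<^esub> \<one>\<^bsub>CR\<^esub>"
  by (simp_all add: localized_coordinate_ring_def localization_def)

sublocale LR: pointwise_ring LR frac_val V'
proof
  show "\<zero>\<^bsub>LR\<^esub> \<in> carrier LR" "\<one>\<^bsub>LR\<^esub> \<in> carrier LR"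
    unfolding LR_zero LR_one using MS_one by (auto intro: LR_carrierI)
  show "frac_val \<zero>\<^bsub>LR\<^esub> x = 0" "frac_val \<one>\<^bsub>LR\<^esub> x = 1" if "x \<in> V'" for x
    unfolding LR_zero LR_one using MS_one that V'_V[OF that]
    by (simp_all add: frac_val_fraction CR.val_zero CR.val_one)
  fix F G assume F: "F \<in> carrier LR" and G: "G \<in> carrier LR"
  obtain a s where as: "a \<in> carrier CR" "s \<in> MS" "F = fraction CR MS a s" by (rule LR_carrierE[OF F])
  obtain b t where bt: "b \<in> carrier CR" "t \<in> MS" "G = fraction CR MS b t" by (rule LR_carrierE[OF G])
  note in_CR = as(1,2) bt(1,2) MS_CR[OF as(2)] MS_CR[OF bt(2)] MS_mult[OF as(2) bt(2)]
  show "F \<oplus>\<^bsub>LR\<^esub> G \<in> carrier LR" "F \<otimes>\<^bsub>LR\<^esub> G \<in> carrier LR"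
    unfolding as bt using in_CR by (auto simp: LR_add LR_mult intro!: LR_carrierI)
  show "frac_val (F \<oplus>\<^bsub>LR\<^esub> G) x = frac_val F x + frac_val G x"
    "frac_val (F \<otimes>\<^bsub>LR\<^esub> G) x = frac_val F x * frac_val G x" if x: "x \<in> V'" for x
    unfolding as bt using in_CR x V'_V[OF x] MS_nonzero[OF as(2) x] MS_nonzero[OF bt(2) x]
    by (simp_all add: LR_add LR_mult frac_val_fraction CR.val_add CR.val_mult add_divide_distrib)
  show "\<exists>G\<in>carrier LR. \<forall>x\<in>V'. frac_val G x = - frac_val F x"
    using in_CR V'_V
    by (intro bexI[of _ "fraction CR MS (\<ominus>\<^bsub>CR\<^esub> a) s"] LR_carrierI)
      (auto simp: as frac_val_fraction CR.val_a_inv)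
  show "F = G" if "\<And>x. x \<in> V' \<Longrightarrow> frac_val F x = frac_val G x"
    using that unfolding as bt using in_CR by (intro frac_cong) (auto simp: frac_val_fraction)
qed

abbreviation \<iota> where "\<iota> \<equiv> localized_fraction k V J f"

lemma \<iota>_in: "a \<in> carrier CR \<Longrightarrow> \<iota> a \<in> carrier LR"
  unfolding localized_fraction_def using MS_one by (intro LR_carrierI)

lemma val_\<iota>: "a \<in> carrier CR \<Longrightarrow> x \<in> V' \<Longrightarrow> frac_val (\<iota> a) x = a x"
  unfolding localized_fraction_def using MS_one V'_V by (simp add: frac_val_fraction CR.val_one)

lemma \<iota>_f_Unit:
  assumes j: "j \<in> J"
  shows "\<iota> (f j) \<in> Units LR"
proof -
  define G where "G = fraction CR MS \<one>\<^bsub>CR\<^esub> (f j)"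
  have G: "G \<in> carrier LR" unfolding G_def using MS_f[OF j] by (intro LR_carrierI) auto
  have val: "frac_val G x = 1 / f j x" if "x \<in> V'" for x
    unfolding G_def using MS_f[OF j] that V'_V[OF that] by (simp add: frac_val_fraction CR.val_one)
  have "\<iota> (f j) \<otimes>\<^bsub>LR\<^esub> G = \<one>\<^bsub>LR\<^esub>"
    using G \<iota>_in[OF f_CR[OF j]] V'_nz j
    by (intro LR.val_inj) (auto simp: LR.val_mult LR.val_one val val_\<iota> f_CR)
  then show ?thesis using G \<iota>_in[OF f_CR[OF j]] LR.m_comm by (auto simp: Units_def)
qed

lemma laurent_hom_val:
  assumes p: "p \<in> laurent_polys k J"
  shows "laurent_hom k V J f p \<in> carrier LR"
    and "x \<in> V' \<Longrightarrow> frac_val (laurent_hom k V J f p) x = ev (\<lambda>j. f j x) p"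
proof -
  have keys: "keys \<omega> \<subseteq> J" if "\<omega> \<in> keys p" for \<omega>
    using p that by (auto simp: laurent_polys_def)
  have c: "(\<lambda>x\<in>V. lookup p \<omega>) \<in> carrier CR" for \<omega>
    using p by (intro CR_const) (simp add: laurent_polys_def)
  have pw: "(\<lambda>j. \<iota> (f j) [^]\<^bsub>LR\<^esub> lookup \<omega> j) \<in> keys \<omega> \<rightarrow> carrier LR"
    if "\<omega> \<in> keys p" for \<omega>
    using keys[OF that] by (auto intro!: LR.int_pow_in \<iota>_f_Unit)
  have term_in: "(\<lambda>\<omega>. \<iota> (\<lambda>x\<in>V. lookup p \<omega>) \<otimes>\<^bsub>LR\<^esub>
      (\<Otimes>\<^bsub>LR\<^esub>j\<in>keys \<omega>. \<iota> (f j) [^]\<^bsub>LR\<^esub> lookup \<omega> j)) \<in> keys p \<rightarrow> carrier LR"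
    using \<iota>_in[OF c] pw by (auto intro!: LR.mult_in LR.finprod_closed)
  then show "laurent_hom k V J f p \<in> carrier LR"
    unfolding laurent_hom_def Let_def by (rule LR.finsum_closed)
  assume x: "x \<in> V'"
  have "frac_val (laurent_hom k V J f p) x = (\<Sum>\<omega>\<in>keys p. frac_val (\<iota> (\<lambda>x\<in>V. lookup p \<omega>) \<otimes>\<^bsub>LR\<^esub>
      (\<Otimes>\<^bsub>LR\<^esub>j\<in>keys \<omega>. \<iota> (f j) [^]\<^bsub>LR\<^esub> lookup \<omega> j)) x)"
    unfolding laurent_hom_def Let_def by (rule LR.val_finsum[OF _ term_in x]) simp
  also have "\<dots> = (\<Sum>\<omega>\<in>keys p. lookup p \<omega> * mon (\<lambda>j. f j x) \<omega>)"
  proof (rule sum.cong)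
    fix \<omega> assume \<omega>: "\<omega> \<in> keys p"
    have "frac_val (\<Otimes>\<^bsub>LR\<^esub>j\<in>keys \<omega>. \<iota> (f j) [^]\<^bsub>LR\<^esub> lookup \<omega> j) x =
        (\<Prod>j\<in>keys \<omega>. frac_val (\<iota> (f j) [^]\<^bsub>LR\<^esub> lookup \<omega> j) x)"
      by (rule LR.val_finprod[OF _ pw[OF \<omega>] x]) simp
    also have "\<dots> = mon (\<lambda>j. f j x) \<omega>"
      unfolding mon_def using keys[OF \<omega>] x
      by (intro prod.cong) (auto simp: LR.val_int_pow[OF \<iota>_f_Unit] val_\<iota> f_CR subset_iff)
    finally show "frac_val (\<iota> (\<lambda>x\<in>V. lookup p \<omega>) \<otimes>\<^bsub>LR\<^esub>
      (\<Otimes>\<^bsub>LR\<^esub>j\<in>keys \<omega>. \<iota> (f j) [^]\<^bsub>LR\<^esub> lookup \<omega> j)) x =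
      lookup p \<omega> * mon (\<lambda>j. f j x) \<omega>"
      using x V'_V[OF x] pw[OF \<omega>] \<iota>_in[OF c] by (simp add: LR.val_mult val_\<iota>[OF c])
  qed simp
  finally show "frac_val (laurent_hom k V J f p) x = ev (\<lambda>j. f j x) p"
    by (simp add: ev_def pm_eval_def)
qed

text \<open>No nonzero element of the localization is invisible on \<open>V'\<close>, so the kernel
  consists of the Laurent relations that hold at all points of \<open>V'\<close>. The comparison
  with ideal points uses the ideal in this form.\<close>

theorem laurent_ideal_eq:
  "laurent_ideal k V J f = {p \<in> laurent_polys k J. \<forall>x\<in>V'. ev (\<lambda>j. f j x) p = 0}"
proof -
  have "laurent_hom k V J f p = \<zero>\<^bsub>LR\<^esub> \<longleftrightarrow> (\<forall>x\<in>V'. ev (\<lambda>j. f j x) p = 0)" if p: "p \<in> laurent_polys k J" for p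
  proof
    assume "laurent_hom k V J f p = \<zero>\<^bsub>LR\<^esub>"
    then show "\<forall>x\<in>V'. ev (\<lambda>j. f j x) p = 0"
      using laurent_hom_val(2)[OF p] LR.val_zero by metis
  next
    assume "\<forall>x\<in>V'. ev (\<lambda>j. f j x) p = 0"
    then show "laurent_hom k V J f p = \<zero>\<^bsub>LR\<^esub>"
      using laurent_hom_val[OF p] by (intro LR.val_inj) (auto simp: LR.val_zero)
  qed
  moreover have "carrier (laurent_ring k J) = laurent_polys k J"
    by (simp add: laurent_ring_def laurent_polys_def)
  ultimately show ?thesis
    unfolding laurent_ideal_def a_kernel_def kernel_def by auto
qed

end

section \<open>Ideal points\<close>

lemma topspace_punctured: "x \<in> topspace (punctured_space J) \<longleftrightarrow> x \<in> extensional J \<and> x \<noteq> zero_vec J"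
  by (auto simp: punctured_space_def PiE_def)

lemma self_in_ray: "y \<in> extensional J \<Longrightarrow> y \<in> ray J y"
  unfolding ray_def by (auto intro!: exI[of _ 1] simp: extensional_restrict)

lemma ray_scale:
  assumes c: "0 < c"
  shows "ray J (\<lambda>j\<in>J. c * y j) = ray J y"
proof (intro subset_antisym subsetI)
  fix z assume "z \<in> ray J (\<lambda>j\<in>J. c * y j)"
  then obtain d where d: "0 < d" "z = (\<lambda>j\<in>J. d * (\<lambda>j\<in>J. c * y j) j)" unfolding ray_def by blast
  then have "z = (\<lambda>j\<in>J. (d * c) * y j)" by (auto simp: mult.assoc)
  moreover have "0 < d * c" using c d by simp
  ultimately show "z \<in> ray J y" unfolding ray_def by blast
next
  fix z assume "z \<in> ray J y"
  then obtain d where d: "0 < d" "z = (\<lambda>j\<in>J. d * y j)" unfolding ray_def by blast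
  then have "z = (\<lambda>j\<in>J. (d / c) * (\<lambda>j\<in>J. c * y j) j)" using c by auto
  moreover have "0 < d / c" using c d by simp
  ultimately show "z \<in> ray J (\<lambda>j\<in>J. c * y j)" unfolding ray_def by blast
qed

text \<open>An open set stable under positive scaling is saturated for the projection, so its image
  is open in the quotient and captures the rays eventually; by saturation the vectors themselves
  then lie in the set.\<close>

lemma ray_limit_eventually_in_cone:
  assumes lim: "limitin (ray_space J) (\<lambda>n. ray J (y n)) (ray J x) F"
    and y: "\<And>n. y n \<in> extensional J"
    and C: "openin (powertop_real J) C" "zero_vec J \<notin> C" "x \<in> C"
    and scale: "\<And>y c. y \<in> C \<Longrightarrow> 0 < c \<Longrightarrow> (\<lambda>j\<in>J. c * y j) \<in> C"
  shows "\<forall>\<^sub>F n in F. y n \<in> C"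
proof -
  have Cext: "z \<in> extensional J" if "z \<in> C" for z using openin_subset[OF C(1)] that by (auto simp: PiE_def)
  have inC: "z \<in> C" if z: "z \<in> extensional J" "z' \<in> C" "ray J z = ray J z'" for z z'
  proof -
    have "z \<in> ray J z'" using self_in_ray[OF z(1)] z(3) by simp
    then show ?thesis using scale[OF z(2)] by (auto simp: ray_def)
  qed
  have pre: "{z \<in> topspace (punctured_space J). ray J z \<in> ray J ` C} = C"
    using inC Cext C(2) by (auto simp: topspace_punctured)
  have "openin (punctured_space J) C"
    unfolding punctured_space_def openin_subtopology using C(1,2) by blast
  moreover have "ray J ` C \<subseteq> ray J ` topspace (punctured_space J)"
    using Cext C(2) by (auto simp: topspace_punctured)
  ultimately have "openin (ray_space J) (ray J ` C)"
    unfolding ray_space_def openin_quotient_topology pre by blast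
  then have "\<forall>\<^sub>F n in F. ray J (y n) \<in> ray J ` C"
    using lim C(3) by (auto simp: limitin_def)
  then show ?thesis
    by eventually_elim (use inC y in blast)
qed

lemma continuous_map_pairing:
  "finite J \<Longrightarrow> continuous_map (powertop_real J) euclideanreal (\<lambda>y. \<Sum>j\<in>J. y j * c j)"
  by (intro continuous_map_sum continuous_map_real_mult continuous_map_product_projection) auto

lemma continuous_map_l1:
  "finite J \<Longrightarrow> continuous_map (powertop_real J) euclideanreal (\<lambda>y. \<Sum>j\<in>J. \<bar>y j\<bar>)"
  by (intro continuous_map_sum continuous_map_real_abs continuous_map_product_projection) auto

lemma norm_mon:
  assumes "\<And>j. j \<in> keys \<omega> \<Longrightarrow> P j \<noteq> 0"
  shows "cmod (mon P \<omega>) = exp (exponent_pairing (\<lambda>j. ln (cmod (P j))) \<omega>)"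
proof -
  have "cmod (P j powi n) = exp (ln (cmod (P j)) * real_of_int n)" if "P j \<noteq> 0" for j n
    using that by (simp add: norm_power_int powr_real_of_int'[symmetric] powr_def mult.commute)
  then show ?thesis
    unfolding mon_def exponent_pairing_def using assms
    by (simp add: prod_norm[symmetric] exp_sum)
qed

context variety_family
begin

abbreviation I where "I \<equiv> laurent_ideal k V J f"

text \<open>The value 1 outside \<open>J\<close> makes the point nonzero in every coordinate, as the
  multiplicativity of \<open>ev\<close> asks; Laurent polynomials in the variables from
  \<open>J\<close> do not see it.\<close>

definition pt :: "complex ^ 'n \<Rightarrow> 'j \<Rightarrow> complex" where "pt x j = (if j \<in> J then f j x else 1)"

lemma pt_nonzero: "x \<in> V' \<Longrightarrow> pt x j \<noteq> 0"
  using V'_nz by (auto simp: pt_def)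

lemma ev_pt: "p \<in> laurent_polys k J \<Longrightarrow> ev (\<lambda>j. f j x) p = ev (pt x) p"
  by (intro ev_cong) (auto simp: pt_def laurent_polys_def)

lemma ideal_iff: "p \<in> I \<longleftrightarrow> p \<in> laurent_polys k J \<and> (\<forall>x\<in>V'. ev (pt x) p = 0)"
  unfolding laurent_ideal_eq using ev_pt by auto

lemma CR_induct [consumes 1, case_names const gen neg add mult]:
  assumes "g \<in> carrier CR"
    and "\<And>c. c \<in> k \<Longrightarrow> Q (\<lambda>x\<in>V. c)" and "\<And>j. j \<in> J \<Longrightarrow> Q (f j)"
    and "\<And>a. a \<in> carrier CR \<Longrightarrow> Q a \<Longrightarrow> Q (\<ominus>\<^bsub>CR\<^esub> a)"
    and "\<And>a b. a \<in> carrier CR \<Longrightarrow> b \<in> carrier CR \<Longrightarrow> Q a \<Longrightarrow> Q b \<Longrightarrow> Q (a \<oplus>\<^bsub>CR\<^esub> b)"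
    and "\<And>a b. a \<in> carrier CR \<Longrightarrow> b \<in> carrier CR \<Longrightarrow> Q a \<Longrightarrow> Q b \<Longrightarrow> Q (a \<otimes>\<^bsub>CR\<^esub> b)"
  shows "Q g"
proof -
  define H where "H = (\<lambda>c. \<lambda>x\<in>V. c) ` k \<union> f ` J"
  have HC: "h \<in> carrier CR" if "h \<in> H" for h using that CR_const f_CR by (auto simp: H_def)
  have "g \<in> generate_ring CR H" using assms(1) generating by (simp add: generating_family_def H_def)
  then have "g \<in> carrier CR \<and> Q g"
  proof (induction rule: generate_ring.induct)
    case one
    show ?case using assms(2)[OF k_1] CR_const[OF k_1] unfolding CR_ops by blast
  next
    case (incl h)
    then show ?case using HC[OF incl] assms(2,3) by (auto simp: H_def)
  qed (use assms(4-6) in auto)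
  then show ?thesis by blast
qed

text \<open>This is how the generating property is used: in particular the coordinates of a point of
  \<open>V'\<close> can be recovered from the values of the family.\<close>

lemma laurent_representation:
  assumes "g \<in> carrier CR"
  shows "\<exists>q\<in>laurent_polys k J. \<forall>x\<in>V'. ev (pt x) q = g x"
  using assms
proof (induction rule: CR_induct)
  case (const c)
  then show ?case using V'_V
    by (intro bexI[of _ "single 0 c"] L_single) (auto simp: ev_single)
next
  case (gen j)
  then show ?case by (intro bexI[of _ "laurent_var j"] L_var) (auto simp: ev_var pt_def)
next
  case (neg a)
  then obtain q where "q \<in> laurent_polys k J" "\<forall>x\<in>V'. ev (pt x) q = a x" by blast
  then show ?case using V'_V neg by (intro bexI[of _ "- q"] L_uminus) (auto simp: ev_uminus CR.val_a_inv)
next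
  case (add a b)
  then obtain q r where "q \<in> laurent_polys k J" "\<forall>x\<in>V'. ev (pt x) q = a x"
    "r \<in> laurent_polys k J" "\<forall>x\<in>V'. ev (pt x) r = b x" by blast
  then show ?case using V'_V add by (intro bexI[of _ "q + r"] L_add) (auto simp: ev_add CR.val_add)
next
  case (mult a b)
  then obtain q r where "q \<in> laurent_polys k J" "\<forall>x\<in>V'. ev (pt x) q = a x"
    "r \<in> laurent_polys k J" "\<forall>x\<in>V'. ev (pt x) r = b x" by blast
  then show ?case using V'_V mult
    by (intro bexI[of _ "q * r"] L_mult) (auto simp: ev_mult[OF pt_nonzero] CR.val_mult)
qed

lemma coordinate_in_CR: "(\<lambda>x\<in>V. x $ i) \<in> carrier CR"
proof -
  have "poly_eval (single (single i 1) 1) = (\<lambda>x. x $ i)"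
    by (rule ext) (simp only: poly_eval_altdef pm_eval_single vmon_single mult_1)
  then show ?thesis using CR_elem[OF polys_over_single[OF k_1], of "single i 1"] by simp
qed

text \<open>A zero of the ideal on the torus is the image of a point of \<open>V'\<close>, because the coordinates
  are polynomials in the generating family.\<close>

lemma lift_point:
  assumes variety: "affine_variety_over k V" and P: "\<And>j. P j \<noteq> 0" and zero: "\<And>g. g \<in> I \<Longrightarrow> ev P g = 0"
  shows "\<exists>y\<in>V'. \<forall>j\<in>J. f j y = P j"
proof -
  have "\<forall>i. \<exists>q. q \<in> laurent_polys k J \<and> (\<forall>x\<in>V'. ev (pt x) q = x $ i)"
    using laurent_representation[OF coordinate_in_CR] V'_V by force
  then obtain q where q: "\<And>i. q i \<in> laurent_polys k J" "\<And>i x. x \<in> V' \<Longrightarrow> ev (pt x) (q i) = x $ i"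
    by metis
  define y where "y P = (\<chi> i. ev P (q i))" for P :: "'j \<Rightarrow> complex"
  \<comment> \<open>Substitution of the \<open>q i\<close> for the coordinates. A polynomial that
    vanishes on \<open>V\<close> becomes an element of \<open>I\<close>, so the hypothesis on
    \<open>P\<close> puts the point \<open>y P\<close> on \<open>V\<close>.\<close>
  define sub where "sub p = (\<Sum>m\<in>keys p. single 0 (lookup p m) *
      (\<Prod>i\<in>UNIV. q i ^ lookup m i))" for p :: "('n \<Rightarrow>\<^sub>0 nat) \<Rightarrow>\<^sub>0 complex"
  have sub_L: "sub p \<in> laurent_polys k J" if "p \<in> polys_over k" for p
    unfolding sub_def using that q
    by (intro L_sum L_mult L_prod L_power L_single) (auto simp: polys_over_def)
  have ev_sub: "ev P (sub p) = poly_eval p (y P)" if "\<And>j. P j \<noteq> 0" for P p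
    using that by (simp add: sub_def poly_eval_def y_def ev_sum ev_mult ev_single ev_prod ev_power)
  have y_pt: "y (pt x) = x" if "x \<in> V'" for x
    using q(2)[OF that] by (simp add: y_def vec_eq_iff)
  obtain Ps where Ps: "Ps \<subseteq> polys_over k" "V = {v. \<forall>p\<in>Ps. poly_eval p v = 0}"
    using variety by (auto simp: affine_variety_over_def)
  have "poly_eval p (y P) = 0" if p: "p \<in> Ps" for p
  proof -
    have "sub p \<in> I"
      unfolding ideal_iff
    proof (intro conjI ballI)
      show "sub p \<in> laurent_polys k J" using sub_L p Ps by blast
      fix x assume x: "x \<in> V'"
      have "ev (pt x) (sub p) = poly_eval p x"
        using ev_sub[of "pt x", OF pt_nonzero[OF x]] y_pt[OF x] by simp
      then show "ev (pt x) (sub p) = 0" using V'_V[OF x] Ps(2) p by auto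
    qed
    from zero[OF this] show ?thesis using ev_sub[of P, OF P, of p] by simp
  qed
  then have yV: "y P \<in> V" using Ps by blast
  have fj: "f j (y P) = P j" if j: "j \<in> J" for j
  proof -
    obtain p where p: "p \<in> polys_over k" "f j = restrict (poly_eval p) V"
      using f_CR[OF j] by (auto simp: carrier_CR)
    \<comment> \<open>The relation that expresses the j-th member of the family through the
      coordinates: it holds on \<open>V'\<close>, hence lies in \<open>I\<close>, hence holds at
      \<open>P\<close>.\<close>
    have "sub p - laurent_var j \<in> I"
      unfolding ideal_iff
    proof (intro conjI ballI)
      show "sub p - laurent_var j \<in> laurent_polys k J" using sub_L[OF p(1)] L_var[OF j] by (rule L_diff)
      fix x assume x: "x \<in> V'"
      have "ev (pt x) (sub p) = poly_eval p x"
        using ev_sub[of "pt x", OF pt_nonzero[OF x]] y_pt[OF x] by simp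
      then show "ev (pt x) (sub p - laurent_var j) = 0"
        using V'_V[OF x] j by (simp add: ev_diff ev_var pt_def p(2))
    qed
    from zero[OF this] have "ev P (sub p) = P j" by (simp add: ev_diff ev_var)
    then show ?thesis using ev_sub[of P, OF P, of p] yV by (simp add: p(2))
  qed
  then have "y P \<in> V'" using yV P by (auto simp: nonvanishing_part_def)
  then show ?thesis using fj by blast
qed

lemma continuous_on_poly_eval: "continuous_on S (poly_eval p)"
  unfolding poly_eval_def by (intro continuous_intros)

lemma continuous_on_f:
  assumes "j \<in> J"
  shows "continuous_on V (f j)"
proof -
  obtain p where p: "p \<in> polys_over k" "f j = restrict (poly_eval p) V"
    using f_CR[OF assms] by (auto simp: carrier_CR)
  show ?thesis
    by (rule continuous_on_eq[OF continuous_on_poly_eval]) (simp add: p)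
qed

lemma closed_V:
  assumes "affine_variety_over k V"
  shows "closed V"
proof -
  obtain Ps where Ps: "V = {v. \<forall>p\<in>Ps. poly_eval p v = 0}"
    using assms by (auto simp: affine_variety_over_def)
  have "V = (\<Inter>p\<in>Ps. {v. poly_eval p v = 0})" using Ps by auto
  moreover have "closed {v. poly_eval p v = 0}" for p
    by (intro closed_Collect_eq continuous_on_poly_eval continuous_on_const)
  ultimately show ?thesis by auto
qed

text \<open>The box is closed because its bounds keep every \<open>f j\<close> away from 0, so that
  no limit leaves \<open>V'\<close>; it is bounded because the coordinates are generated by
  constants and the \<open>f j\<close>. Through it, leaving compact sets becomes a statement about
  the size of \<open>Log_map\<close>.\<close>

lemma compact_log_box:
  assumes variety: "affine_variety_over k V"
  shows "compact {x \<in> V'. \<forall>j\<in>J. \<bar>ln (cmod (f j x))\<bar> \<le> r}" (is "compact ?K")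
proof -
  have K: "?K = {x \<in> V. \<forall>j\<in>J. exp (- r) \<le> cmod (f j x) \<and> cmod (f j x) \<le> exp r}"
  proof -
    have "(f j x \<noteq> 0 \<and> \<bar>ln (cmod (f j x))\<bar> \<le> r) \<longleftrightarrow> exp (- r) \<le> cmod (f j x) \<and> cmod (f j x) \<le> exp r" for j x
    proof (cases "f j x = 0")
      case False
      then have "0 < cmod (f j x)" by simp
      then have "exp (- r) \<le> cmod (f j x) \<longleftrightarrow> - r \<le> ln (cmod (f j x))"
        "cmod (f j x) \<le> exp r \<longleftrightarrow> ln (cmod (f j x)) \<le> r"
        by (metis exp_le_cancel_iff exp_ln)+
      then show ?thesis using False by (auto simp: abs_le_iff)
    qed auto
    then show ?thesis unfolding nonvanishing_part_def by blast
  qed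
  have K_Int: "?K = V \<inter> (\<Inter>j\<in>J. V \<inter> f j -` (cmod -` {exp (- r)..exp r}))" unfolding K by auto
  have cl: "closed (V \<inter> f j -` (cmod -` {exp (- r)..exp r}))" if "j \<in> J" for j
    by (intro continuous_closed_preimage continuous_on_f[OF that] closed_V[OF variety]
      continuous_closed_vimage continuous_intros)
  have "closed ?K"
    unfolding K_Int by (rule closed_Int[OF closed_V[OF variety] closed_INT]) (use cl in blast)
  moreover have "bounded ?K"
  proof -
    have bd: "\<exists>b. \<forall>x\<in>?K. cmod (g x) \<le> b" if "g \<in> carrier CR" for g
      using that
    proof (induction rule: CR_induct)
      case (const c)
      then show ?case using V'_V by (intro exI[of _ "cmod c"]) auto
    next
      case (gen j)
      then show ?case unfolding K by (intro exI[of _ "exp r"]) auto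
    next
      case (neg a)
      then show ?case using V'_V by (auto simp: CR.val_a_inv)
    next
      case (add a b)
      then obtain c d where "\<forall>x\<in>?K. cmod (a x) \<le> c" "\<forall>x\<in>?K. cmod (b x) \<le> d" by blast
      then have "cmod ((a \<oplus>\<^bsub>CR\<^esub> b) x) \<le> c + d" if "x \<in> ?K" for x
        using that add(1,2) V'_V norm_triangle_mono[of "a x" c "b x" d] by (simp add: CR.val_add)
      then show ?case by blast
    next
      case (mult a b)
      then obtain c d where "\<forall>x\<in>?K. cmod (a x) \<le> c" "\<forall>x\<in>?K. cmod (b x) \<le> d" by blast
      then have "cmod ((a \<otimes>\<^bsub>CR\<^esub> b) x) \<le> c * d" if "x \<in> ?K" for x
        using that mult(1,2) V'_V
        by (force simp: CR.val_mult norm_mult intro: mult_mono order_trans[OF norm_ge_zero])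
      then show ?case by blast
    qed
    have "\<forall>i. \<exists>b. \<forall>x\<in>?K. cmod (x $ i) \<le> b"
    proof
      fix i
      show "\<exists>b. \<forall>x\<in>?K. cmod (x $ i) \<le> b" using bd[OF coordinate_in_CR, of i] V'_V by force
    qed
    from choice[OF this] obtain \<beta> where \<beta>: "\<forall>i. \<forall>x\<in>?K. cmod (x $ i) \<le> \<beta> i" ..
    show ?thesis
    proof (rule boundedI)
      fix x assume x: "x \<in> ?K"
      have "norm x \<le> (\<Sum>i\<in>UNIV. cmod (x $ i))"
        unfolding norm_vec_def by (rule L2_set_le_sum) simp
      also have "\<dots> \<le> sum \<beta> UNIV" using \<beta> x by (intro sum_mono) blast
      finally show "norm x \<le> sum \<beta> UNIV" .
    qed
  qed
  ultimately show ?thesis by (simp add: compact_eq_bounded_closed)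
qed

end

section \<open>The two inclusions\<close>

context variety_family
begin

lemma ideal_L: "I \<subseteq> laurent_polys k J"
  using ideal_iff by blast

lemma ideal_0: "0 \<in> I"
  by (simp add: ideal_iff L_0)

lemma ideal_add: "g \<in> I \<Longrightarrow> h \<in> I \<Longrightarrow> g + h \<in> I"
  by (simp add: ideal_iff L_add ev_add)

lemma ideal_mult: "g \<in> laurent_polys k J \<Longrightarrow> h \<in> I \<Longrightarrow> g * h \<in> I"
  by (simp add: ideal_iff L_mult ev_mult[OF pt_nonzero])

lemma tropical_variety_iff:
  "x \<in> tropical_variety J I \<longleftrightarrow> x \<in> extensional J \<and>
    (\<forall>p\<in>I. \<forall>w\<in>keys p. \<exists>\<omega>\<in>keys p - {w}. exponent_pairing x w \<le> exponent_pairing x \<omega>)"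
  unfolding tropical_variety_def using ideal_0 by (auto simp: tropical_hypersurface_iff PiE_def)

lemma Log_extensional: "Log_map J f x \<in> extensional J"
  by (simp add: Log_map_def)

text \<open>At a point of \<open>V'\<close> the terms of a relation sum to 0, so each one is
  balanced by the others; the absolute value of a monomial is the exponential of its pairing with
  \<open>Log_map\<close>.\<close>

lemma term_le_others:
  assumes p: "p \<in> I" and w: "w \<in> keys p" and x: "x \<in> V'"
  shows "cmod (lookup p w) * exp (exponent_pairing (Log_map J f x) w) \<le>
    (\<Sum>\<omega>\<in>keys p - {w}. cmod (lookup p \<omega>) * exp (exponent_pairing (Log_map J f x) \<omega>))"
proof -
  have norm: "cmod (mon (pt x) \<omega>) = exp (exponent_pairing (Log_map J f x) \<omega>)" if "\<omega> \<in> keys p" for \<omega>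
  proof -
    have keys: "keys \<omega> \<subseteq> J" using p that by (auto simp: ideal_iff laurent_polys_def)
    have "cmod (mon (pt x) \<omega>) = exp (exponent_pairing (\<lambda>j. ln (cmod (pt x j))) \<omega>)"
      using pt_nonzero[OF x] by (intro norm_mon)
    also have "exponent_pairing (\<lambda>j. ln (cmod (pt x j))) \<omega> = exponent_pairing (Log_map J f x) \<omega>"
      unfolding exponent_pairing_def using keys by (intro sum.cong) (auto simp: Log_map_def pt_def)
    finally show ?thesis .
  qed
  have "0 = (\<Sum>\<omega>\<in>keys p. lookup p \<omega> * mon (pt x) \<omega>)"
    using p x by (simp add: ideal_iff ev_def pm_eval_def)
  also have "\<dots> = lookup p w * mon (pt x) w +
      (\<Sum>\<omega>\<in>keys p - {w}. lookup p \<omega> * mon (pt x) \<omega>)"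
    using w by (simp add: sum.remove)
  finally have "lookup p w * mon (pt x) w =
      - (\<Sum>\<omega>\<in>keys p - {w}. lookup p \<omega> * mon (pt x) \<omega>)"
    by (simp add: eq_neg_iff_add_eq_0)
  then have "cmod (lookup p w * mon (pt x) w) =
      cmod (\<Sum>\<omega>\<in>keys p - {w}. lookup p \<omega> * mon (pt x) \<omega>)"
    by (simp only: norm_minus_cancel)
  also have "\<dots> \<le> (\<Sum>\<omega>\<in>keys p - {w}. cmod (lookup p \<omega> * mon (pt x) \<omega>))"
    by (rule norm_sum)
  finally show ?thesis using w by (simp add: norm_mult norm)
qed

text \<open>A single nonzero term vanishes nowhere on \<open>V'\<close>, so every exponent of a
  relation has a competitor; at the origin all pairings are 0.\<close>

lemma zero_vec_tropical:
  assumes "V' \<noteq> {}"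
  shows "zero_vec J \<in> tropical_variety J I"
  unfolding tropical_variety_iff
proof (intro conjI ballI)
  show "zero_vec J \<in> extensional J" by (simp add: zero_vec_def)
  fix p w assume p: "p \<in> I" and w: "w \<in> keys p"
  obtain x where x: "x \<in> V'" using assms by blast
  have "keys p - {w} \<noteq> {}"
  proof
    assume "keys p - {w} = {}"
    then have "cmod (lookup p w) * exp (exponent_pairing (Log_map J f x) w) \<le> 0"
      using term_le_others[OF p w x] by (simp only: sum.empty)
    then show False using w by (simp add: mult_le_0_iff in_keys_iff)
  qed
  then obtain \<omega> where \<omega>: "\<omega> \<in> keys p - {w}" by blast
  have "exponent_pairing (zero_vec J) \<omega> = 0" if "\<omega> \<in> keys p" for \<omega>
  proof -
    have "keys \<omega> \<subseteq> J" using p that by (auto simp: ideal_iff laurent_polys_def)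
    then show ?thesis unfolding exponent_pairing_def by (intro sum.neutral) (auto simp: zero_vec_def)
  qed
  then show "\<exists>\<omega>\<in>keys p - {w}. exponent_pairing (zero_vec J) w \<le> exponent_pairing (zero_vec J) \<omega>"
    using \<omega> w by (intro bexI[of _ \<omega>]) auto
qed

text \<open>If the term \<open>w\<close> strictly dominated at \<open>x\<close>, it would do so on
  an open cone around \<open>x\<close>, with a margin proportional to the l1 norm. The logarithms of
  the sequence enter this cone and eventually leave any box, which contradicts
  \<open>term_le_others\<close>.\<close>

lemma ideal_point_tropical:
  assumes variety: "affine_variety_over k V"
    and x: "x \<in> topspace (punctured_space J)" and ideal: "ray J x \<in> ideal_points V J f"
  shows "x \<in> tropical_variety J I"
  unfolding tropical_variety_iff
proof (intro conjI ballI)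
  show x_ext: "x \<in> extensional J" using x by (simp add: topspace_punctured)
  fix p w assume p: "p \<in> I" and w: "w \<in> keys p"
  obtain y where y: "\<And>n. y n \<in> V'"
    and leave: "\<And>K. compact K \<Longrightarrow> K \<subseteq> V' \<Longrightarrow> \<forall>\<^sub>F n in sequentially. y n \<notin> K"
    and lim: "limitin (ray_space J) (\<lambda>n. ray J (Log_map J f (y n))) (ray J x) sequentially"
    using ideal unfolding ideal_points_def by blast
  define A where "A = keys p - {w}"
  have finA: "finite A" by (simp add: A_def)
  have keys: "keys \<omega> \<subseteq> J" if "\<omega> \<in> keys p" for \<omega>
    using p that by (auto simp: ideal_iff laurent_polys_def)
  define pair where "pair z \<omega> = (\<Sum>j\<in>J. z j * real_of_int (lookup \<omega> j))" for z :: "'j \<Rightarrow> real" and \<omega>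
  have pair: "exponent_pairing z \<omega> = pair z \<omega>" if "\<omega> \<in> keys p" for z \<omega>
    unfolding pair_def by (rule exponent_pairing_superset[OF finite_J keys[OF that]])
  define l1 where "l1 z = (\<Sum>j\<in>J. \<bar>z j\<bar>)" for z :: "'j \<Rightarrow> real"
  show "\<exists>\<omega>\<in>keys p - {w}. exponent_pairing x w \<le> exponent_pairing x \<omega>"
  proof (rule ccontr)
    assume "\<not> ?thesis"
    then have gap: "0 < pair x w - pair x \<omega>" if "\<omega> \<in> A" for \<omega>
      using that w by (auto simp: A_def pair not_le)
    obtain \<delta> where \<delta>: "0 < \<delta>" "\<And>\<omega>. \<omega> \<in> A \<Longrightarrow> \<delta> * l1 x < pair x w - pair x \<omega>"
    proof -
      have "\<forall>\<^sub>F \<delta> in at_right (0::real). \<forall>\<omega>\<in>A. \<delta> * l1 x < pair x w - pair x \<omega>"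
      proof (intro eventually_ball_finite ballI finA)
        fix \<omega> assume "\<omega> \<in> A"
        have "((\<lambda>\<delta>. \<delta> * l1 x) \<longlongrightarrow> 0 * l1 x) (at_right 0)" by (intro tendsto_intros)
        then show "\<forall>\<^sub>F \<delta> in at_right 0. \<delta> * l1 x < pair x w - pair x \<omega>"
          using gap[OF \<open>\<omega> \<in> A\<close>] by (intro order_tendstoD(2)) auto
      qed
      then have "\<exists>b>0. \<forall>\<delta>>0. \<delta> < b \<longrightarrow> (\<forall>\<omega>\<in>A. \<delta> * l1 x < pair x w - pair x \<omega>)"
        by (simp add: eventually_at_right_field)
      then obtain b where b: "0 < b" "\<And>\<delta>. 0 < \<delta> \<Longrightarrow> \<delta> < b \<Longrightarrow> \<forall>\<omega>\<in>A. \<delta> * l1 x < pair x w - pair x \<omega>" by blast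
      obtain \<delta> where "0 < \<delta>" "\<delta> < b" using dense[OF b(1)] by blast
      with b(2)[OF this] show ?thesis using that by blast
    qed
    \<comment> \<open>The conditions are homogeneous, so \<open>C\<close> is a cone; positivity of
      \<open>l1\<close> excludes the origin also when \<open>w\<close> is the only exponent.\<close>
    define C where "C = {z \<in> topspace (powertop_real J). 0 < l1 z} \<inter>
      (\<Inter>\<omega>\<in>A. {z \<in> topspace (powertop_real J). 0 < pair z w - pair z \<omega> - \<delta> * l1 z}) "
    have C_iff: "z \<in> C \<longleftrightarrow> z \<in> extensional J \<and> 0 < l1 z \<and> (\<forall>\<omega>\<in>A. \<delta> * l1 z < pair z w - pair z \<omega>)" for z
      by (auto simp: C_def PiE_def)
    have openC: "openin (powertop_real J) C"
    proof -
      have l1c: "continuous_map (powertop_real J) euclideanreal l1"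
        unfolding l1_def by (rule continuous_map_l1[OF finite_J])
      have pairc: "continuous_map (powertop_real J) euclideanreal (\<lambda>z. pair z \<omega>)" for \<omega>
        unfolding pair_def by (rule continuous_map_pairing[OF finite_J])
      have pos: "openin (powertop_real J) {z \<in> topspace (powertop_real J). 0 < g z}"
        if "continuous_map (powertop_real J) euclideanreal g" for g
        using openin_continuous_map_preimage[OF that, of "{0<..}"] by simp
      have "openin (powertop_real J) {z \<in> topspace (powertop_real J). 0 < l1 z}" by (rule pos[OF l1c])
      moreover have "openin (powertop_real J)
          {z \<in> topspace (powertop_real J). 0 < pair z w - pair z \<omega> - \<delta> * l1 z}" for \<omega>
        by (intro pos continuous_map_diff pairc continuous_map_real_mult_left l1c)
      ultimately show ?thesis
        unfolding C_def using finA by (cases "A = {}") (auto intro!: openin_Int openin_Inter)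
    qed
    have l1x: "0 < l1 x"
    proof (rule ccontr)
      assume "\<not> 0 < l1 x"
      moreover have "0 \<le> l1 x" unfolding l1_def by (intro sum_nonneg) simp
      ultimately have "l1 x = 0" by linarith
      then have "x j = 0" if "j \<in> J" for j using that finite_J by (simp add: l1_def sum_nonneg_eq_0_iff)
      then have "x = zero_vec J" using x_ext by (intro extensionalityI[of _ J]) (auto simp: zero_vec_def)
      then show False using x by (simp add: topspace_punctured)
    qed
    have "\<forall>\<^sub>F n in sequentially. Log_map J f (y n) \<in> C"
    proof (rule ray_limit_eventually_in_cone[OF lim Log_extensional openC])
      show "zero_vec J \<notin> C" by (simp add: C_iff l1_def zero_vec_def)
      show "x \<in> C" using x_ext l1x \<delta> by (simp add: C_iff)
      fix z c assume z: "z \<in> C" and c: "(0::real) < c"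
      have "l1 (\<lambda>j\<in>J. c * z j) = c * l1 z" using c by (simp add: l1_def sum_distrib_left abs_mult)
      moreover have "pair (\<lambda>j\<in>J. c * z j) \<omega> = c * pair z \<omega>" for \<omega>
        by (simp add: pair_def sum_distrib_left mult.assoc)
      moreover have "\<delta> * (c * l1 z) < c * pair z w - c * pair z \<omega>" if "\<omega> \<in> A" for \<omega>
      proof -
        have "c * (\<delta> * l1 z) < c * (pair z w - pair z \<omega>)" using z c that by (simp add: C_iff)
        then show ?thesis by (simp add: algebra_simps)
      qed
      ultimately show "(\<lambda>j\<in>J. c * z j) \<in> C" using z c by (simp add: C_iff)
    qed
    moreover define B where "B = (\<Sum>\<omega>\<in>A. cmod (lookup p \<omega>))"
    define a where "a = cmod (lookup p w)"
    have a: "0 < a" using w by (simp add: a_def in_keys_iff)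
    have B: "0 \<le> B" by (simp add: B_def sum_nonneg)
    \<comment> \<open>With this bound, \<open>r < l1 L\<close> gives
      \<open>B < a * (\<delta> * l1 L)\<close>, which is incompatible with
      \<open>a * exp (\<delta> * l1 L) \<le> B\<close>.\<close>
    define r where "r = B / (a * \<delta>)"
    have "\<forall>\<^sub>F n in sequentially. y n \<notin> {x \<in> V'. \<forall>j\<in>J. \<bar>ln (cmod (f j x))\<bar> \<le> r}"
      by (rule leave[OF compact_log_box[OF variety]]) blast
    ultimately have "\<forall>\<^sub>F n in sequentially. False"
    proof eventually_elim
      case (elim n)
      define L where "L = Log_map J f (y n)"
      obtain j where j: "j \<in> J" "r < \<bar>L j\<bar>" using elim(2) y by (auto simp: L_def Log_map_def not_le)
      have "\<bar>L j\<bar> \<le> l1 L" unfolding l1_def using j finite_J by (intro member_le_sum) auto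
      then have rL: "r < l1 L" using j by simp
      have "a * exp (pair L w) \<le> (\<Sum>\<omega>\<in>A. cmod (lookup p \<omega>) * exp (pair L \<omega>))"
        using term_le_others[OF p w y[of n]] w by (simp add: a_def A_def pair L_def)
      also have "\<dots> \<le> (\<Sum>\<omega>\<in>A. cmod (lookup p \<omega>) * exp (pair L w - \<delta> * l1 L))"
      proof (intro sum_mono mult_left_mono)
        fix \<omega> assume "\<omega> \<in> A"
        then have "\<delta> * l1 L < pair L w - pair L \<omega>" using elim(1) by (simp add: C_iff L_def)
        then show "exp (pair L \<omega>) \<le> exp (pair L w - \<delta> * l1 L)" by simp
      qed simp
      also have "\<dots> = B * (exp (pair L w) / exp (\<delta> * l1 L))"
        by (simp only: B_def sum_distrib_right exp_diff)
      finally have "exp (pair L w) * (a * exp (\<delta> * l1 L)) \<le> exp (pair L w) * B"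
        by (simp add: field_simps)
      then have "a * exp (\<delta> * l1 L) \<le> B" by simp
      moreover have "\<delta> * l1 L < exp (\<delta> * l1 L)" using exp_ge_add_one_self[of "\<delta> * l1 L"] by linarith
      then have "a * (\<delta> * l1 L) < a * exp (\<delta> * l1 L)" using a by simp
      moreover have "B < a * (\<delta> * l1 L)"
        using rL a \<delta>(1) by (simp add: r_def pos_divide_less_eq mult_ac)
      ultimately show False by linarith
    qed
    then show False by simp
  qed
qed

text \<open>The approximating points kill \<open>I\<close> and hence lift to \<open>V'\<close>.
  Their logarithms divided by \<open>t m\<close> tend to \<open>x\<close>, and rays do not see this
  positive factor.\<close>

lemma tropical_ideal_point:
  assumes variety: "affine_variety_over k V" and countable: "countable k"
    and x: "x \<in> tropical_variety J I" "x \<noteq> zero_vec J"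
  shows "ray J x \<in> ideal_points V J f"
proof -
  have x_ext: "x \<in> extensional J" using x by (simp add: tropical_variety_iff)
  then have x_punct: "x \<in> topspace (punctured_space J)" using x by (simp add: topspace_punctured)
  obtain v where v: "laurent_valuation k J v" "\<And>g. g \<in> I \<Longrightarrow> v g = 0"
    "\<And>j. j \<in> J \<Longrightarrow> v (laurent_var j) = exp (x j)"
  proof (rule seminorm_of_tropical_point[OF countable finite_J ideal_L ideal_0 ideal_add ideal_mult])
    show "\<exists>\<omega>\<in>keys p - {w}. exponent_pairing x w \<le> exponent_pairing x \<omega>"
      if "p \<in> I" "w \<in> keys p" for p w
      using x(1) that by (simp add: tropical_variety_iff)
  qed (assumption | rule that)+
  interpret laurent_valuation k J v by (rule v(1))
  obtain t P where "growth t" and P: "\<And>m j. P m j \<noteq> 0"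
    and zero: "\<And>m g. g \<in> laurent_polys k J \<Longrightarrow> v g = 0 \<Longrightarrow> ev (P m) g = 0"
    and lim: "\<And>j. j \<in> J \<Longrightarrow> (\<lambda>m. ln (cmod (P m j)) / t m) \<longlonglongrightarrow> ln (v (laurent_var j))"
    by (rule approximating_points) (rule that, assumption+)
  interpret growth t by fact
  have "\<forall>m. \<exists>y. y \<in> V' \<and> (\<forall>j\<in>J. f j y = P m j)"
  proof
    fix m
    have "ev (P m) g = 0" if "g \<in> I" for g using zero v(2) that ideal_L by blast
    then have "\<exists>y\<in>V'. \<forall>j\<in>J. f j y = P m j" by (rule lift_point[OF variety, of "P m", OF P])
    then show "\<exists>y. y \<in> V' \<and> (\<forall>j\<in>J. f j y = P m j)" by blast
  qed
  from choice[OF this] obtain y where y: "\<And>m. y m \<in> V'" "\<And>m j. j \<in> J \<Longrightarrow> f j (y m) = P m j" by blast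
  have lim': "(\<lambda>m. ln (cmod (P m j)) / t m) \<longlonglongrightarrow> x j" if "j \<in> J" for j
    using lim[OF that] v(3)[OF that] by simp
  \<comment> \<open>At a nonzero coordinate of \<open>x\<close> the logarithm has absolute value of
    the order of \<open>t m\<close>, so the points leave every compact subset of
    \<open>V'\<close>.\<close>
  obtain j0 where j0: "j0 \<in> J" "x j0 \<noteq> 0"
  proof -
    have "\<exists>j\<in>J. x j \<noteq> 0"
    proof (rule ccontr)
      assume "\<not> ?thesis"
      then have "x = zero_vec J" using x_ext by (intro extensionalityI[of _ J]) (auto simp: zero_vec_def)
      then show False using x(2) by simp
    qed
    then show ?thesis using that by blast
  qed
  have "\<forall>\<^sub>F n in sequentially. y n \<notin> K" if K: "compact K" "K \<subseteq> V'" for K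
  proof -
    have "continuous_on K (\<lambda>x. ln (cmod (f j0 x)))"
    proof (intro continuous_on_ln continuous_on_norm)
      show "continuous_on K (f j0)"
        using continuous_on_subset[OF continuous_on_f[OF j0(1)]] K(2) V'_V by blast
    qed (use K(2) V'_nz[OF _ j0(1)] in auto)
    then have "bounded ((\<lambda>x. ln (cmod (f j0 x))) ` K)"
      using K(1) by (intro compact_imp_bounded compact_continuous_image)
    then obtain b where b: "\<And>z. z \<in> K \<Longrightarrow> \<bar>ln (cmod (f j0 z))\<bar> \<le> b"
      by (auto simp: bounded_iff)
    have "filterlim (\<lambda>m. \<bar>ln (cmod (P m j0)) / t m\<bar> * t m) at_top sequentially"
      using j0 by (intro filterlim_tendsto_pos_mult_at_top[OF tendsto_rabs[OF lim'] _ t_top]) auto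
    then have "\<forall>\<^sub>F m in sequentially. b < \<bar>ln (cmod (P m j0)) / t m\<bar> * t m"
      by (simp add: filterlim_at_top_dense)
    then show ?thesis
    proof eventually_elim
      case (elim m)
      then have "b < \<bar>ln (cmod (f j0 (y m)))\<bar>"
        using t_pos[of m] y(2)[OF j0(1)] by (simp add: abs_divide)
      then show ?case using b[of "y m"] by auto
    qed
  qed
  moreover have "limitin (ray_space J) (\<lambda>m. ray J (Log_map J f (y m))) (ray J x) sequentially"
  proof -
    define z where "z m = (\<lambda>j\<in>J. (1 / t m) * Log_map J f (y m) j)" for m
    have zj: "z m j = ln (cmod (P m j)) / t m" if "j \<in> J" for m j
      using that by (simp add: z_def Log_map_def y(2))
    have "limitin euclideanreal (\<lambda>m. z m j) (x j) sequentially" if "j \<in> J" for j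
      using lim'[OF that] by (simp add: zj[OF that])
    moreover have "z m \<in> topspace (powertop_real J)" for m by (simp add: z_def)
    ultimately have "limitin (powertop_real J) z x sequentially"
      unfolding limitin_componentwise using x_ext by simp
    moreover have "\<forall>\<^sub>F m in sequentially. z m \<in> - {zero_vec J}"
    proof -
      have "\<forall>\<^sub>F m in sequentially. ln (cmod (P m j0)) / t m \<noteq> 0"
        by (rule tendsto_imp_eventually_ne[OF lim'[OF j0(1)] j0(2)])
      then show ?thesis
      proof eventually_elim
        case (elim m)
        then have "z m j0 \<noteq> zero_vec J j0" using zj[OF j0(1)] j0(1) by (simp add: zero_vec_def)
        then show ?case by auto
      qed
    qed
    ultimately have "limitin (punctured_space J) z x sequentially"
      unfolding punctured_space_def limitin_subtopology using x(2) by blast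
    moreover have "continuous_map (punctured_space J) (ray_space J) (ray J)"
      unfolding ray_space_def by (rule quotient_imp_continuous_map[OF quotient_map_quotient_topology])
    ultimately have "limitin (ray_space J) (ray J \<circ> z) (ray J x) sequentially"
      by (rule continuous_map_limit[rotated])
    moreover have "ray J (z m) = ray J (Log_map J f (y m))" for m
      unfolding z_def using t_pos[of m] by (intro ray_scale) simp
    ultimately show ?thesis by (simp add: o_def)
  qed
  moreover have "ray J x \<in> topspace (ray_space J)"
    unfolding ray_space_def topspace_quotient_topology using x_punct by blast
  ultimately show ?thesis unfolding ideal_points_def using y(1) by blast
qed

theorem cone_eq_tropical_variety:
  assumes variety: "affine_variety_over k V" and countable: "countable k"
  shows "cone_over_ideal_points V J f = tropical_variety J I"
proof (cases "V' = {}")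
  case True
  \<comment> \<open>With \<open>V'\<close> empty every Laurent polynomial is a relation; the single
    exponent of 1 has no competitor, so both sides are empty.\<close>
  have "1 \<in> I" using True by (simp add: ideal_iff L_1)
  then have "tropical_variety J I = {}"
    using tropical_variety_iff by fastforce
  then show ?thesis using True by (simp add: cone_over_ideal_points_def)
next
  case False
  show ?thesis
  proof (intro subset_antisym subsetI)
    fix x assume "x \<in> cone_over_ideal_points V J f"
    then have "x = zero_vec J \<or> x \<in> topspace (punctured_space J) \<and> ray J x \<in> ideal_points V J f"
      using False by (auto simp: cone_over_ideal_points_def)
    then show "x \<in> tropical_variety J I"
      using zero_vec_tropical[OF False] ideal_point_tropical[OF variety] by blast
  next
    fix x assume x: "x \<in> tropical_variety J I"
    then have "x \<in> extensional J" by (simp add: tropical_variety_iff)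
    then show "x \<in> cone_over_ideal_points V J f"
      using False tropical_ideal_point[OF variety countable x]
      by (auto simp: cone_over_ideal_points_def topspace_punctured)
  qed
qed

end

lemma coefficient_ring_of_subring:
  assumes "subring k (ring_of_type_algebra :: complex ring)"
  shows "coefficient_ring k"
proof -
  let ?R = "ring_of_type_algebra :: complex ring"
  interpret R: ring ?R by (rule ring_from_type_algebra)
  have ops: "a \<otimes>\<^bsub>?R\<^esub> b = a * b" "a \<oplus>\<^bsub>?R\<^esub> b = a + b" "\<one>\<^bsub>?R\<^esub> = 1" "\<zero>\<^bsub>?R\<^esub> = 0" "carrier ?R = UNIV" for a b
    by (simp_all add: ring_of_type_algebra_def)
  have "\<ominus>\<^bsub>?R\<^esub> a \<oplus>\<^bsub>?R\<^esub> a = \<zero>\<^bsub>?R\<^esub>" for a by (rule R.l_neg) (simp add: ops)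
  then have neg: "\<ominus>\<^bsub>?R\<^esub> a = - a" for a by (simp add: ops eq_neg_iff_add_eq_0)
  show ?thesis
    using subringE(2,3,5-7)[OF assms] by unfold_locales (simp_all add: ops neg)
qed

theorem proposition3p9:
  fixes k :: "complex set"
    and V :: "(complex ^ 'n::finite) set"
    and J :: "'j set"
    and f :: "'j \<Rightarrow> complex ^ 'n \<Rightarrow> complex"
  assumes "subfield k (ring_of_type_algebra :: complex ring)"
    and "countable k"
    and "affine_variety_over k V"
    and "generating_family k V J f"
    and "finite J"
  shows "cone_over_ideal_points V J f = tropical_variety J (laurent_ideal k V J f)"
proof -
  interpret coefficient_ring k using subfieldE(1)[OF assms(1)] by (rule coefficient_ring_of_subring)
  interpret variety_family k V J f using assms(4,5) by unfold_locales
  show ?thesis using assms(3,2) by (rule cone_eq_tropical_variety)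
qed

end
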